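(* Let $f(x)\in\mathbb{Z}[x]$ be a nonconstant polynomial with nonzero discriminant, and suppose every irreducible factor of $f(x)$ over $\mathbb{Q}$ has degree at most six. Then there exists a bound $P_0$ such that for every prime $p>P_0$ and every integer $r$ not divisible by $p$, there exist infinitely many $d\in S_{\mathbb{Q}}(f)$ such that $d\equiv r\pmod p$.
   Context: For a squarefree integer $d$, let $C_d$ denote the curve $dy^2=f(x)$ over $\mathbb{Q}$. $S_{\mathbb{Q}}(f)$ denotes the set of all squarefree integers $d$ such that $C_d$ has a nontrivial rational point, i.e., there exist rational numbers $x_0,y_0$ with $y_0\neq 0$ and $dy_0^2=f(x_0)$. *)

theory Defs
  imports
    "Subresultants.Resultant_Prelim"
    "HOL-Computational_Algebra.Computational_Algebra"
    "HOL-Number_Theory.Number_Theory"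
begin

abbreviation rat_poly_of :: "int poly \<Rightarrow> rat poly" where
  "rat_poly_of f \<equiv> map_poly rat_of_int f"

(* disc(f) = (-1)^(n(n-1)/2) / a_n * Res(f, f'), where n is the degree and a_n the
   leading coefficient of f.  In characteristic 0 the derivative f' has degree
   exactly n - 1, so Res is the determinant of the usual (2n-1) x (2n-1) Sylvester matrix.
   In particular disc(f) = 1 when f is linear.  The value is only meaningful for
   nonconstant f. *)
definition discriminant :: "'a :: field_char_0 poly \<Rightarrow> 'a" where
  "discriminant f =
     (- 1) ^ (degree f * (degree f - 1) div 2) * resultant f (pderiv f) / lead_coeff f"

(* C_d : d y^2 = f(x), considered as an affine curve over the rationals. *)
definition twist_points :: "int poly \<Rightarrow> int \<Rightarrow> (rat \<times> rat) set" where
  "twist_points f d = {(x, y). of_int d * y\<^sup>2 = poly (rat_poly_of f) x}"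

(* The set S_Q(f); note that squarefree integers may be negative, and that 0 is not squarefree. *)
definition S_rat :: "int poly \<Rightarrow> int set" where
  "S_rat f = {d. squarefree d \<and> (\<exists>x\<^sub>0 y\<^sub>0. (x\<^sub>0, y\<^sub>0) \<in> twist_points f d \<and> y\<^sub>0 \<noteq> 0)}"

end

theory Submission
  imports Defs "Subresultants.Subresultant_Gcd" "HOL-Real_Asymp.Real_Asymp"
    "HOL-Computational_Algebra.Field_as_Ring"
begin

text \<open>
  Choose \<open>a\<close> with \<open>c = f(a) \<noteq> 0\<close>. Then \<open>f(a + ct) = c g(t)\<close> with \<open>g(0) = 1\<close>, and clearing denominators in
  \<open>t = y/x\<close> turns \<open>g\<close> into a squarefree binary form \<open>V(x,y)\<close> of even degree, monic in one variable, with
  irreducible factors of degree at most six. With \<open>c\<^sub>1\<close> the squarefree part of \<open>c\<close>, an integer \<open>d = c\<^sub>1E\<close> lies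
  in \<open>S_rat f\<close> as soon as \<open>V(x,y) = m\<^sup>2E\<close> with \<open>d\<close> squarefree, so it suffices to find infinitely many
  squarefree \<open>E\<close> in prescribed residue classes.

  Choosing \<open>m\<close> gives access to every residue class modulo a large prime \<open>p\<close>: Hensel's lemma and the Chinese
  remainder theorem realise every \<open>m\<close> composed of primes at which \<open>V\<close> has a simple root, in particular products
  of suitable values of \<open>V\<close>, and Stepanov's method shows that these cover all classes modulo \<open>p\<close>.

  In the box \<open>x, y \<le> N\<close> the pairs for which \<open>q\<^sup>2\<close> divides \<open>V(x,y)\<close> must be discarded. Small primes are controlled
  by congruences and those up to \<open>N\<close> by counting. A prime \<open>q\<close> with \<open>N < q \<le> \<Lambda>N\<^sup>2\<close> contributes a bounded number of
  coprime pairs, hence \<open>o(N\<^sup>2)\<close> in total by Chebyshev's estimate. For larger \<open>q\<close> an irreducible factor \<open>U\<close> of \<open>V\<close>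
  takes the value \<open>\<plusminus>n q\<^sup>2\<close> with \<open>n\<close> at most a small multiple of \<open>N\<^sup>2\<close>, because \<open>deg U \<le> 6\<close>. Such pairs lie on
  lattices \<open>x \<equiv> \<omega>y (mod n)\<close>, where \<open>\<omega>\<close> is a root of \<open>U\<close> modulo \<open>n\<close>; the number of pairs \<open>(n,\<omega>)\<close> is linear in
  the range of \<open>n\<close>. On the lines of each lattice parallel to its shortest vector, \<open>\<plusminus>nU\<close> has to be a square,
  and sieving by quadratic residues modulo auxiliary primes, again with Stepanov's method, leaves a negligible
  proportion of the points.
\<close>

hide_const (open) up_ring.coeff up_ring.monom

section \<open>Integer polynomials modulo a prime\<close>

text \<open>The balance behind degree six: a value of size N^6 divisible by q^2 with q > Lambda N^2
  leaves a cofactor n of order at most N^2 / Lambda^2, and a lattice x = omega y (mod n) has roughly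
  N^2 / n points in the box. Over one dyadic range n ~ N^2 / 2^j, with linearly many lattices, this
  already adds up to order N^2, so the trivial count diverges with the number of ranges. Each range
  needs a saving that is summable in j. Sieving with about sqrt j primes between j^2 and j^4 yields
  1 / j^2, and a large Lambda leaves only the tail j >= J. The number of sieving primes is limited
  because their product must not exceed the number of points on a line.

  Power residues enter only through proportions: it suffices that a given value of the power
  character misses a fixed fraction of the residues. The bound p (1 - 1/(2K)) from Stepanov's method
  gives this, and no square root cancellation is required.

  The degree is made even so that the power of x clearing the denominators of t = y/x is a square
  and can be absorbed in the second coordinate of the curve.\<close>

text \<open>This is divisibility of \<open>B\<close> by \<open>A\<close> in F_p[x], expressed on
  integer lifts so that the prime remains an ordinary variable.\<close>

definition dvdm :: "int \<Rightarrow> int poly \<Rightarrow> int poly \<Rightarrow> bool" where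
  "dvdm p A B \<longleftrightarrow> (\<exists>C. [:p:] dvd (B - A * C))"

lemma monic_division_exists:
  fixes P E :: "int poly"
  assumes "lead_coeff P = 1"
  shows "\<exists>Q R. E = P * Q + R \<and> (R = 0 \<or> degree R < degree P)"
proof -
  obtain q r where qr: "pseudo_divmod E P = (q, r)" by force
  have "P \<noteq> 0" using assms by auto
  from pseudo_divmod[OF this qr] show ?thesis using assms by auto
qed

text \<open>Reducing the error term modulo the monic \<open>P\<close> turns the congruence into an
  exact equation between F - pR and a multiple of \<open>P\<close>; the degrees then force that
  multiple to be zero.\<close>

lemma dvdm_degree_less:
  assumes "lead_coeff P = 1" "dvdm p P F" "degree F < degree P"
  shows "[:p:] dvd F"
proof -
  obtain C E where CE: "F - P * C = [:p:] * E" using assms(2) by (auto simp: dvdm_def dvd_def)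
  obtain Q R where QR: "E = P * Q + R" "R = 0 \<or> degree R < degree P"
    using monic_division_exists[OF assms(1)] by blast
  have eq: "F - [:p:] * R = P * (C + [:p:] * Q)" using CE QR(1) by (simp add: algebra_simps)
  have "degree ([:p:] * R) < degree P" using QR(2) assms(3)
    by (auto intro: le_less_trans[OF degree_smult_le])
  hence "degree (F - [:p:] * R) < degree P" using assms(3) degree_diff_less by blast
  moreover have "P \<noteq> 0" using assms(1) by auto
  ultimately have "C + [:p:] * Q = 0" using eq
    by (metis degree_mult_eq less_add_same_cancel1 not_less0 less_not_refl add_lessD1)
  hence "F = [:p:] * R" using eq by simp
  thus ?thesis by (metis dvd_triv_left)
qed

lemma prime_elem_pconst: "prime p \<Longrightarrow> prime_elem [:int p:]"
  by (simp only: prime_elem_const_poly_iff prime_imp_prime_elem prime_nat_int_transfer)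

lemma pconst_dvd_multD:
  "prime p \<Longrightarrow> [:int p:] dvd A * B \<Longrightarrow> [:int p:] dvd A \<or> [:int p:] dvd B"
  by (rule prime_elem_dvd_multD[OF prime_elem_pconst])

lemma pconst_dvd_poly: "[:p:] dvd F \<Longrightarrow> p dvd poly F x"
  by (auto simp: dvd_def)

lemma monic_not_pconst_dvd:
  assumes "prime p" "lead_coeff P = 1"
  shows "\<not> [:int p:] dvd P"
proof
  assume "[:int p:] dvd P"
  hence "int p dvd coeff P (degree P)" by (simp add: const_poly_dvd_iff)
  thus False using assms by auto
qed

text \<open>The factors are moved over to \<open>C\<close> one at a time: once L^K is cancelled
  modulo p, evaluation at x shows that p divides P(x) C'(x), so the next root belongs to the
  cofactor.\<close>

lemma linear_power_dvdm_cancel: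
  assumes p: "prime p" and nP: "\<not> int p dvd poly P x" and d: "dvdm p ([:-x,1:]^K) (P * C)"
  shows "dvdm p ([:-x,1:]^K) C"
  using d
proof (induction K)
  case 0
  show ?case by (auto simp: dvdm_def intro!: exI[of _ C])
next
  case (Suc K)
  define L where "L = [:-x, 1::int:]"
  obtain Z where Z: "[:int p:] dvd (P * C - L ^ Suc K * Z)" using Suc.prems by (auto simp: dvdm_def L_def)
  hence "dvdm p (L ^ K) (P * C)" by (auto simp: dvdm_def mult.assoc power_Suc2 intro!: exI[of _ "L * Z"] simp del: power_Suc)
  then obtain C' where C': "[:int p:] dvd (C - L ^ K * C')" using Suc.IH by (auto simp: dvdm_def L_def)
  have "L ^ K * (P * C' - L * Z) = (P * C - L ^ Suc K * Z) - P * (C - L ^ K * C')"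
    by (simp add: algebra_simps)
  hence "[:int p:] dvd L ^ K * (P * C' - L * Z)" using Z C' by (metis dvd_diff dvd_mult)
  moreover have "\<not> [:int p:] dvd L ^ K"
    by (rule monic_not_pconst_dvd[OF p]) (simp add: L_def degree_linear_power lead_coeff_power)
  ultimately have PZ: "[:int p:] dvd P * C' - L * Z" using pconst_dvd_multD[OF p] by blast
  have "int p dvd poly (P * C' - L * Z) x" by (rule pconst_dvd_poly[OF PZ])
  hence "int p dvd poly P x * poly C' x" by (simp add: L_def)
  hence pC: "int p dvd poly C' x" using nP p by (metis prime_dvd_mult_iff prime_nat_int_transfer)
  have C'eq: "C' = L * synthetic_div C' x + [:poly C' x:]"
    using synthetic_div_correct'[of x C'] by (simp add: L_def)
  have "C - L ^ Suc K * synthetic_div C' x = (C - L ^ K * C') + L ^ K * (C' - L * synthetic_div C' x)"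
    by (simp add: algebra_simps)
  also have "C' - L * synthetic_div C' x = [:poly C' x:]" using C'eq by (metis add_diff_cancel_left')
  finally have "[:int p:] dvd C - L ^ Suc K * synthetic_div C' x"
    using C' pC by (metis dvd_add dvd_mult const_poly_dvd)
  thus ?case by (auto simp: dvdm_def L_def)
qed

text \<open>Representatives in [0, p) are distinct modulo p, so the product over the earlier points
  does not vanish at the new one and can be cancelled.\<close>

lemma prod_linear_power_dvdm:
  assumes p: "prime p" and "finite X" "X \<subseteq> {0..<int p}" "\<And>x. x \<in> X \<Longrightarrow> dvdm p ([:-x,1:]^K) F"
  shows "dvdm p (\<Prod>x\<in>X. [:-x,1:]^K) F"
  using assms(2-)
proof (induction X rule: finite_induct)
  case empty
  show ?case by (auto simp: dvdm_def intro!: exI[of _ F])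
next
  case (insert x X)
  define P where "P = (\<Prod>x\<in>X. [:-x,1::int:]^K)"
  have "dvdm p P F" unfolding P_def using insert by auto
  then obtain C where C: "[:int p:] dvd (F - P * C)" by (auto simp: dvdm_def)
  obtain Z where Z: "[:int p:] dvd (F - [:-x,1:]^K * Z)" using insert.prems(2)[of x] by (auto simp: dvdm_def)
  have "[:int p:] dvd (F - [:-x,1:]^K * Z) - (F - P * C)" using C Z by (rule dvd_diff[rotated])
  hence "dvdm p ([:-x,1:]^K) (P * C)" by (auto simp: dvdm_def intro!: exI[of _ Z])
  moreover have "\<not> int p dvd poly P x"
  proof
    assume "int p dvd poly P x"
    hence "int p dvd (\<Prod>y\<in>X. (x - y)^K)" by (simp add: P_def poly_prod poly_power)
    then obtain y where y: "y \<in> X" "int p dvd (x - y)^K"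
      using prime_dvd_prod_iff[OF insert(1), of "int p" "\<lambda>y. (x - y)^K"] p by auto
    hence "int p dvd x - y" using prime_dvd_power[of "int p"] p by auto
    moreover have "x \<in> {0..<int p}" "y \<in> {0..<int p}" using insert.prems(1) y(1) by auto
    hence "\<bar>x - y\<bar> < int p" by auto
    ultimately have "x - y = 0" by (metis abs_of_nat dvd_imp_le_int not_le)
    thus False using y(1) insert(2) by auto
  qed
  ultimately have "dvdm p ([:-x,1:]^K) C" using linear_power_dvdm_cancel[OF p] by blast
  then obtain C' where C': "[:int p:] dvd (C - [:-x,1:]^K * C')" by (auto simp: dvdm_def)
  have "F - ([:-x,1:]^K * P) * C' = (F - P * C) + P * (C - [:-x,1:]^K * C')" by (simp add: algebra_simps)
  hence "[:int p:] dvd F - ([:-x,1:]^K * P) * C'" using C C' by (metis dvd_add dvd_mult)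
  thus ?case using insert(1,2) by (auto simp: dvdm_def P_def)
qed

lemma prod_linear_power_monic:
  fixes X :: "int set"
  assumes "finite X"
  shows "lead_coeff (\<Prod>x\<in>X. [:-x,1::int:]^K) = 1" "degree (\<Prod>x\<in>X. [:-x,1::int:]^K) = card X * K"
proof -
  show "lead_coeff (\<Prod>x\<in>X. [:-x,1::int:]^K) = 1"
    by (simp add: lead_coeff_prod lead_coeff_power)
  show "degree (\<Prod>x\<in>X. [:-x,1::int:]^K) = card X * K"
    by (subst degree_prod_eq_sum_degree) (simp_all only: degree_linear_power, simp_all)
qed

text \<open>The counting half of Stepanov's method: high order of vanishing at many points costs
  degree, unless the polynomial is zero modulo p.\<close>

lemma vanishing_multiplicity_bound:
  assumes p: "prime p" and X: "X \<subseteq> {0..<int p}" "\<And>x. x \<in> X \<Longrightarrow> dvdm p ([:-x,1:]^K) F"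
    and nd: "\<not> [:int p:] dvd F"
  shows "card X * K \<le> degree F"
proof (rule ccontr)
  assume "\<not> ?thesis"
  moreover have fX: "finite X" using X(1) finite_subset by blast
  ultimately show False
    using dvdm_degree_less[OF prod_linear_power_monic(1)[OF fX, of K] prod_linear_power_dvdm[OF p fX X]]
      prod_linear_power_monic(2)[OF fX, of K] nd by simp
qed

lemma roots_mod_prime_le_degree:
  assumes p: "prime p" and nd: "\<not> [:int p:] dvd F"
  shows "card {x\<in>{0..<int p}. int p dvd poly F x} \<le> degree F"
proof -
  have "dvdm p ([:-x,1:]^1) F" if "int p dvd poly F x" for x
  proof -
    have "F - [:-x,1:] * synthetic_div F x = [:poly F x:]"
      using synthetic_div_correct'[of x F] by (metis add_diff_cancel_left')
    thus ?thesis using that by (auto simp: dvdm_def intro!: exI[of _ "synthetic_div F x"])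
  qed
  hence "card {x\<in>{0..<int p}. int p dvd poly F x} * 1 \<le> degree F"
    by (intro vanishing_multiplicity_bound[OF p _ _ nd]) auto
  thus ?thesis by simp
qed

section \<open>Power residues of polynomial values\<close>

lemma pderiv_power_Suc_of_nat: "pderiv (q ^ Suc n) = of_nat (Suc n) * q ^ n * pderiv (q :: int poly)"
  by (simp add: pderiv_power_Suc of_nat_poly del: of_nat_Suc power_Suc)

text \<open>The \<open>k\<close>-th derivative of \<open>g\<^sup>-\<^sup>a\<close> is \<open>twisted_deriv g a k / g\<^sup>a\<^sup>+\<^sup>k\<close>.\<close>

fun twisted_deriv :: "int poly \<Rightarrow> nat \<Rightarrow> nat \<Rightarrow> int poly" where
  "twisted_deriv g a 0 = 1"
| "twisted_deriv g a (Suc k) = g * pderiv (twisted_deriv g a k) - of_nat (a + k) * (pderiv g * twisted_deriv g a k)"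

lemma degree_of_nat_mult_le: "degree (of_nat n * p :: int poly) \<le> degree p"
  by (metis degree_of_nat degree_mult_le add_0)

lemma degree_twisted_deriv: "degree g \<le> D \<Longrightarrow> degree (twisted_deriv g a k) \<le> k * D"
proof (induction k)
  case (Suc k)
  have "degree (pderiv (twisted_deriv g a k)) \<le> k * D" using Suc by (auto simp: degree_pderiv)
  hence 1: "degree (g * pderiv (twisted_deriv g a k)) \<le> Suc k * D" using Suc.prems
    by (intro le_trans[OF degree_mult_le]) auto
  have "degree (pderiv g) \<le> D" using Suc by (auto simp: degree_pderiv)
  hence "degree (pderiv g * twisted_deriv g a k) \<le> Suc k * D" using Suc
    by (intro le_trans[OF degree_mult_le]) auto
  hence 2: "degree (of_nat (a + k) * (pderiv g * twisted_deriv g a k)) \<le> Suc k * D"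
    using degree_of_nat_mult_le le_trans by blast
  show ?case unfolding twisted_deriv.simps using 1 2 by (rule degree_diff_le)
qed simp

text \<open>Modulo g only the second term of the recursion survives. The top coefficient is thus a
  unit multiple of a power of g' as long as p divides none of a, ..., a+k-1, which is how its
  vanishing is refuted later.\<close>

lemma twisted_deriv_mod: "\<exists>C. twisted_deriv g a k = g * C + of_int ((-1)^k * (\<Prod>i<k. int (a + i))) * pderiv g ^ k"
proof (induction k)
  case (Suc k)
  then obtain C where C: "twisted_deriv g a k = g * C + of_int ((-1)^k * (\<Prod>i<k. int (a + i))) * pderiv g ^ k" by blast
  have "twisted_deriv g a (Suc k) = g * (pderiv (twisted_deriv g a k) - of_nat (a + k) * pderiv g * C)
     + of_int ((-1)^Suc k * (\<Prod>i<Suc k. int (a + i))) * pderiv g ^ Suc k"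
    unfolding twisted_deriv.simps C by (simp add: algebra_simps)
  thus ?case by blast
qed (auto intro: exI[of _ 0])

context
  fixes g T W :: "int poly" and p :: int and a K :: nat
  assumes T': "pderiv T = -1 + [:p:] * W"
begin

text \<open>\<open>K!/k!\<close> clears the denominator \<open>k!\<close> of the Taylor coefficients up to order \<open>K\<close>.\<close>

definition "taylor_scale k = (of_nat (\<Prod>{Suc k..K}) :: int poly)"

lemma taylor_scale_step: "Suc k \<le> K \<Longrightarrow> taylor_scale k = of_nat (Suc k) * taylor_scale (Suc k)"
  unfolding taylor_scale_def by (subst prod.atLeast_Suc_atMost) (assumption, simp only: of_nat_mult)

lemma pderiv_taylor_scale: "pderiv (taylor_scale k) = 0"
  unfolding taylor_scale_def by (simp only: of_nat_poly) (simp add: pderiv_pCons)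

text \<open>\<open>T\<close> stands for x^p - x, whose derivative is -1 modulo p. Differentiating
  T^k therefore yields the negative of what differentiating the twisted derivative yields in the
  preceding summand.\<close>

lemma taylor_term_deriv:
  assumes "k < K"
  shows "\<exists>E. g * pderiv (taylor_scale k * twisted_deriv g a k * g^(K-k) * T^k) =
     of_nat (a+K) * pderiv g * (taylor_scale k * twisted_deriv g a k * g^(K-k) * T^k)
     + taylor_scale k * twisted_deriv g a (Suc k) * g^(K-k) * T^k
     - (if k = 0 then 0 else taylor_scale (k-1) * twisted_deriv g a k * g^(K-(k-1)) * T^(k-1)) + [:p:] * E"
proof -
  obtain n where n: "K - k = Suc n" using assms by (metis Suc_diff_Suc)
  have aK: "of_nat (a + K) = (of_nat (a + k) + of_nat (Suc n) :: int poly)" using n assms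
    by (metis of_nat_add add.assoc le_add_diff_inverse less_imp_le)
  show ?thesis
  proof (cases k)
    case 0
    have "pderiv (taylor_scale 0 * g ^ Suc n) = taylor_scale 0 * (of_nat (Suc n) * g ^ n * pderiv g)"
      by (simp add: pderiv_mult[of "taylor_scale 0"] pderiv_taylor_scale pderiv_power_Suc_of_nat del: power_Suc of_nat_Suc)
    hence "g * pderiv (taylor_scale 0 * g ^ Suc n) = of_nat (Suc n) * pderiv g * (taylor_scale 0 * g ^ Suc n)"
      by (simp add: algebra_simps)
    thus ?thesis unfolding aK unfolding n unfolding 0
      by (intro exI[of _ 0]) (simp add: algebra_simps del: power_Suc of_nat_Suc)
  next
    case (Suc j)
    have K1: "K - (k - 1) = Suc (Suc n)" using n Suc assms by auto
    have cfj: "taylor_scale (k - 1) = of_nat k * taylor_scale k" using taylor_scale_step[of j] assms Suc by simp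
    define V where "V = twisted_deriv g a k"
    have pT: "pderiv (T ^ Suc j) = of_nat k * T ^ j * (- 1 + [:p:] * W)"
      by (simp only: pderiv_power_Suc_of_nat T' Suc)
    have pg: "pderiv (g ^ Suc n) = of_nat (Suc n) * g ^ n * pderiv g"
      by (rule pderiv_power_Suc_of_nat)
    have 1: "pderiv (taylor_scale k * V * g ^ Suc n * T ^ Suc j) = taylor_scale k * (pderiv V * g ^ Suc n * T ^ Suc j
       + V * pderiv (g ^ Suc n) * T ^ Suc j + V * g ^ Suc n * pderiv (T ^ Suc j))"
      by (simp only: pderiv_mult pderiv_taylor_scale) (simp add: algebra_simps)
    have Sk: "twisted_deriv g a (Suc k) = g * pderiv V - of_nat (a + k) * (pderiv g * V)" by (simp add: V_def)
    have "g * pderiv (taylor_scale k * V * g ^ Suc n * T ^ Suc j) =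
       (of_nat (a + k) + of_nat (Suc n)) * pderiv g * (taylor_scale k * V * g ^ Suc n * T ^ Suc j)
       + taylor_scale k * (g * pderiv V - of_nat (a + k) * (pderiv g * V)) * g ^ Suc n * T ^ Suc j
       - of_nat k * taylor_scale k * V * g ^ Suc (Suc n) * T ^ j + [:p:] * (of_nat k * taylor_scale k * V * g ^ Suc (Suc n) * T ^ j * W)"
      unfolding 1 pT pg by (simp add: algebra_simps)
    thus ?thesis unfolding aK Sk unfolding n K1 cfj using Suc unfolding V_def[symmetric] by auto
  qed
qed

text \<open>The terms telescope to a single error with the factor T^(m-1). For m = K this factor is
  what allows vanishing to be propagated up to order K.\<close>

lemma taylor_sum_deriv:
  assumes "m \<le> K"
  shows "\<exists>E. g * pderiv (\<Sum>k<m. taylor_scale k * twisted_deriv g a k * g^(K-k) * T^k) =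
     of_nat (a+K) * pderiv g * (\<Sum>k<m. taylor_scale k * twisted_deriv g a k * g^(K-k) * T^k)
     + (if m = 0 then 0 else taylor_scale (m-1) * twisted_deriv g a m * g^(K-(m-1)) * T^(m-1)) + [:p:] * E"
  using assms
proof (induction m)
  case 0
  show ?case by (auto intro: exI[of _ 0])
next
  case (Suc m)
  then obtain E where E: "g * pderiv (\<Sum>k<m. taylor_scale k * twisted_deriv g a k * g^(K-k) * T^k) =
     of_nat (a+K) * pderiv g * (\<Sum>k<m. taylor_scale k * twisted_deriv g a k * g^(K-k) * T^k)
     + (if m = 0 then 0 else taylor_scale (m-1) * twisted_deriv g a m * g^(K-(m-1)) * T^(m-1)) + [:p:] * E" by auto
  obtain E' where E': "g * pderiv (taylor_scale m * twisted_deriv g a m * g^(K-m) * T^m) =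
     of_nat (a+K) * pderiv g * (taylor_scale m * twisted_deriv g a m * g^(K-m) * T^m)
     + taylor_scale m * twisted_deriv g a (Suc m) * g^(K-m) * T^m
     - (if m = 0 then 0 else taylor_scale (m-1) * twisted_deriv g a m * g^(K-(m-1)) * T^(m-1)) + [:p:] * E'"
    using taylor_term_deriv[of m] Suc.prems by auto
  have "g * pderiv (\<Sum>k<Suc m. taylor_scale k * twisted_deriv g a k * g^(K-k) * T^k) =
     g * pderiv (\<Sum>k<m. taylor_scale k * twisted_deriv g a k * g^(K-k) * T^k) + g * pderiv (taylor_scale m * twisted_deriv g a m * g^(K-m) * T^m)"
    by (simp add: pderiv_add distrib_left)
  also have "\<dots> = of_nat (a+K) * pderiv g * (\<Sum>k<Suc m. taylor_scale k * twisted_deriv g a k * g^(K-k) * T^k)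
     + taylor_scale m * twisted_deriv g a (Suc m) * g^(K-m) * T^m + [:p:] * (E + E')"
    unfolding E E' by (simp del: twisted_deriv.simps add: algebra_simps smult_add_right)
  finally show ?case by auto
qed

end

lemma power_dvdm_witness:
  assumes "T = L * T1 + [:p:] * E"
  shows "\<exists>S E'. T ^ i = L ^ i * S + [:p:] * (E' :: int poly)"
proof (induction i)
  case 0
  show ?case by (auto intro: exI[of _ 1] exI[of _ 0])
next
  case (Suc i)
  then obtain S E' where "T ^ i = L ^ i * S + [:p:] * E'" by blast
  hence "T ^ Suc i = L ^ Suc i * (T1 * S) + [:p:] * (L * T1 * E' + E * L ^ i * S + E * [:p:] * E')"
    unfolding power_Suc assms by (simp add: algebra_simps)
  thus ?case by blast
qed

text \<open>If F = L^i Z modulo p, comparing the coefficient of L^(i-1) in the differential equation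
  gives i g(x) Z(x) = 0 modulo p. As 0 < i < p and g(x) is a unit, Z vanishes at x and the order
  rises by one.\<close>

lemma linear_power_dvdm_step:
  fixes L F :: "int poly"
  assumes p: "prime p" and L: "L = [:-x,1:]" and i: "0 < i" "i < p"
    and F: "F = L ^ i * Z + [:int p:] * E1" and ng: "\<not> int p dvd poly g x"
    and ode: "g * pderiv F = H * F + G * S' + [:int p:] * E" and S': "S' = L ^ i * S + [:int p:] * E3"
  shows "dvdm p (L ^ Suc i) F"
proof -
  obtain j where j: "i = Suc j" using i by (cases i) auto
  have pL: "pderiv L = 1" by (simp add: L pderiv_pCons)
  have "pderiv F = of_nat i * L ^ j * Z + L ^ i * pderiv Z + [:int p:] * pderiv E1"
    using pL unfolding F j by (simp add: pderiv_add pderiv_mult pderiv_power_Suc_of_nat pderiv_smult algebra_simps del: power_Suc of_nat_Suc)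
  hence "L ^ j * (of_nat i * g * Z + L * (g * pderiv Z - H * Z - G * S)) =
     [:int p:] * (H * E1 + G * E3 + E - g * pderiv E1)"
    using ode unfolding S' unfolding F j by (simp add: algebra_simps)
  hence "[:int p:] dvd L ^ j * (of_nat i * g * Z + L * (g * pderiv Z - H * Z - G * S))" by (metis dvd_triv_left)
  moreover have "\<not> [:int p:] dvd L ^ j"
    by (rule monic_not_pconst_dvd[OF p]) (simp add: L degree_linear_power lead_coeff_power)
  ultimately have "[:int p:] dvd of_nat i * g * Z + L * (g * pderiv Z - H * Z - G * S)"
    using pconst_dvd_multD[OF p] by blast
  from pconst_dvd_poly[OF this, of x] have "int p dvd int i * poly g x * poly Z x"
    by (simp add: L)
  moreover have "\<not> int p dvd int i" using i by (auto dest: zdvd_imp_le)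
  ultimately have pZ: "int p dvd poly Z x" using ng p
    by (metis prime_dvd_mult_iff prime_nat_int_transfer)
  have Zeq: "Z = L * synthetic_div Z x + [:poly Z x:]"
    using synthetic_div_correct'[of x Z] by (simp add: L)
  have "F - L ^ Suc i * synthetic_div Z x = L ^ i * (Z - L * synthetic_div Z x) + [:int p:] * E1"
    unfolding F by (simp add: algebra_simps)
  also have "Z - L * synthetic_div Z x = [:poly Z x:]" using Zeq by (metis add_diff_cancel_left')
  finally have "F - L ^ Suc i * synthetic_div Z x = L ^ i * [:poly Z x:] + [:int p:] * E1" .
  moreover have "[:int p:] dvd L ^ i * [:poly Z x:] + [:int p:] * E1"
    by (rule dvd_add[OF dvd_mult dvd_triv_left]) (use pZ in simp)
  ultimately show ?thesis unfolding dvdm_def by metis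
qed

text \<open>Stepanov's method. Modulo \<open>p\<close> the power \<open>g\<^sup>a\<close> and the Taylor polynomial of
  \<open>g(x)\<^sup>a g(x + T)\<^sup>-\<^sup>a\<close> in \<open>T = x\<^sup>p - x\<close> satisfy the same differential equation up to order \<open>K\<close>,
  so their difference vanishes to order \<open>K\<close> at every point where \<open>g\<^sup>a = \<epsilon>\<close>. Too many such points
  would force the \<open>K\<close>-th Taylor coefficient to vanish modulo \<open>p\<close>.\<close>

lemma stepanov_power_residues:
  fixes g :: "int poly"
  assumes p: "prime p" and deg: "degree g \<le> D" and K: "K = Suc D" and large: "2 * K * K < p"
    and a: "1 \<le> a" "2 * a < p" and eps: "\<not> int p dvd \<epsilon>" and nd: "\<not> dvdm p g (pderiv g ^ K)"
  shows "card {x\<in>{0..<int p}. [poly g x ^ a = \<epsilon>] (mod int p)} * (2 * K) \<le> p * (2 * K - 1)"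
proof (rule ccontr)
  assume contr: "\<not> ?thesis"
  define X where "X = {x\<in>{0..<int p}. [poly g x ^ a = \<epsilon>] (mod int p)}"
  define x1 where "x1 = [:0, 1::int:]"
  define T where "T = x1 ^ p - x1"
  define C where "C = taylor_scale K"
  define S where "S = (\<Sum>k<K. C k * twisted_deriv g a k * g^(K-k) * T^k)"
  \<comment> \<open>\<open>S\<close> is K! g^K times the Taylor polynomial of (g(x) / g(x+T))^a in
    T. Fermat makes T vanish at every residue, leaving only the term k = 0, so F vanishes wherever
    g^a = \<epsilon>.\<close>
  define F where "F = C 0 * g ^ K * g ^ a - of_int \<epsilon> * S"
  have Kp: "K < p" using large K by (simp add: algebra_simps)
  have p0: "p > 0" using Kp by simp
  have pi: "prime (int p)" using p by simp
  have T': "pderiv T = -1 + [:int p:] * x1 ^ (p - 1)"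
  proof -
    obtain q where q: "p = Suc q" using p0 by (cases p) auto
    have "pderiv x1 = 1" by (simp add: x1_def pderiv_pCons)
    thus ?thesis unfolding T_def q by (simp add: pderiv_diff pderiv_power_Suc del: power_Suc)
  qed
  have degT: "degree T = p" and lcT: "lead_coeff T = 1"
  proof -
    have 1: "degree (x1 ^ p) = p" unfolding x1_def by (rule degree_linear_power)
    have 2: "degree x1 < p" using large K unfolding x1_def by simp
    show d: "degree T = p" unfolding T_def using degree_add_eq_left[of "-x1" "x1^p"] 1 2 by simp
    have "coeff (x1 ^ p) p = 1" using 1 lead_coeff_power[of x1 p] by (simp add: x1_def)
    thus "lead_coeff T = 1" unfolding d using 2 by (simp add: T_def coeff_eq_0)
  qed
  have C_K: "C (K - 1) = of_nat K" unfolding C_def taylor_scale_def[OF T'] using K by simp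
  have pC: "pderiv (C 0) = 0" unfolding C_def by (rule pderiv_taylor_scale[OF T'])
  obtain E where E: "g * pderiv S = of_nat (a+K) * pderiv g * S
     + of_nat K * twisted_deriv g a K * g * T ^ (K - 1) + [:int p:] * E"
    using taylor_sum_deriv[OF T', of K K g a] K C_K unfolding S_def C_def by auto
  have ga: "pderiv (g ^ K * g ^ a) * g = of_nat (a + K) * pderiv g * (g ^ K * g ^ a)"
  proof -
    obtain b where b: "K + a = Suc b" using K by (cases "K + a") auto
    show ?thesis unfolding power_add[symmetric] b add.commute[of a K]
      by (simp add: pderiv_power_Suc_of_nat algebra_simps del: power_Suc of_nat_Suc) (simp add: algebra_simps)
  qed
  have ode: "g * pderiv F = of_nat (a+K) * pderiv g * F + (- of_int \<epsilon> * of_nat K * twisted_deriv g a K * g) * T ^ (K - 1)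
     + [:int p:] * (- of_int \<epsilon> * E)"
  proof -
    have eq: "pderiv F = C 0 * pderiv (g ^ K * g ^ a) - of_int \<epsilon> * pderiv S"
    proof -
      have pe: "pderiv (of_int \<epsilon> :: int poly) = 0" by (simp only: of_int_poly) (simp add: pderiv_pCons)
      show ?thesis unfolding F_def mult.assoc[of "C 0"] by (simp add: pderiv_diff pderiv_mult[of "C 0"] pderiv_mult[of "of_int \<epsilon>"] pC pe)
    qed
    have "g * pderiv F = C 0 * (pderiv (g ^ K * g ^ a) * g) - of_int \<epsilon> * (g * pderiv S)"
      unfolding eq by (simp add: algebra_simps)
    also have "\<dots> = of_nat (a+K) * pderiv g * F + (- of_int \<epsilon> * of_nat K * twisted_deriv g a K * g) * T ^ (K - 1)
     + [:int p:] * (- of_int \<epsilon> * E)"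
      unfolding ga E F_def by (simp del: twisted_deriv.simps of_nat_add add: algebra_simps)
    finally show ?thesis .
  qed
  \<comment> \<open>Order one comes from the choice of x; every further order up to K comes from the
    differential equation \<open>ode\<close>, whose error term contains T^(K-1) and hence enough
    powers of X - x.\<close>
  have mult: "dvdm p ([:-x,1:]^j) F" if x: "x \<in> X" and j: "j \<le> K" for x j
    using j
  proof (induction j)
    case 0
    show ?case by (auto simp: dvdm_def intro!: exI[of _ F])
  next
    case (Suc i)
    have gx: "[poly g x ^ a = \<epsilon>] (mod int p)" using x by (simp add: X_def)
    have ng: "\<not> int p dvd poly g x"
    proof
      assume "int p dvd poly g x"
      hence "int p dvd poly g x ^ a" using a by (cases a) auto
      thus False using cong_dvd_iff[OF gx] eps by simp
    qed
    have Tx: "int p dvd poly T x"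
    proof -
      have "[x ^ p = x] (mod int p)"
      proof (cases "int p dvd x")
        case True
        thus ?thesis using p0 by (metis cong_0_iff cong_sym cong_trans dvd_power dvd_trans)
      next
        case False
        have "[x ^ (p - 1) = 1] (mod int p)"
        proof -
          have "coprime x (int p)" using False pi by (metis prime_imp_coprime coprime_commute)
          moreover have "totient p = p - 1" using p by (simp add: totient_prime)
          moreover have "residues (int p)" using p prime_gt_1_nat[OF p] by unfold_locales auto
          ultimately show ?thesis using residues.euler_theorem[of "int p" x] by simp
        qed
        hence "[x ^ (p - 1) * x = 1 * x] (mod int p)" by (rule cong_scalar_right)
        thus ?thesis using p0 by (simp flip: power_Suc2)
      qed
      thus ?thesis by (simp add: T_def x1_def poly_power cong_iff_dvd_diff)
    qed
    show ?case
    proof (cases "i = 0")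
      case True
      have "poly S x = (\<Sum>k<K. poly (C k * twisted_deriv g a k * g^(K-k)) x * poly T x ^ k)"
        by (simp add: S_def poly_sum poly_power)
      also have "\<dots> = poly (C 0 * g ^ K) x + (\<Sum>k=1..<K. poly (C k * twisted_deriv g a k * g^(K-k)) x * poly T x ^ k)"
        using K by (simp add: lessThan_atLeast0 sum.atLeast_Suc_lessThan)
      finally have 1: "poly S x = poly (C 0 * g ^ K) x + (\<Sum>k=1..<K. poly (C k * twisted_deriv g a k * g^(K-k)) x * poly T x ^ k)" .
      have "int p dvd (\<Sum>k=1..<K. poly (C k * twisted_deriv g a k * g^(K-k)) x * poly T x ^ k)"
      proof (intro dvd_sum dvd_mult)
        fix k assume "k \<in> {1..<K}"
        hence "poly T x dvd poly T x ^ k" by (intro dvd_power) auto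
        thus "int p dvd poly T x ^ k" by (rule dvd_trans[OF Tx])
      qed
      moreover have "poly F x = poly (C 0 * g ^ K) x * (poly g x ^ a - \<epsilon>)
          - \<epsilon> * (\<Sum>k=1..<K. poly (C k * twisted_deriv g a k * g^(K-k)) x * poly T x ^ k)"
        unfolding F_def by (simp add: 1 poly_power) (simp add: algebra_simps)
      moreover have "int p dvd poly g x ^ a - \<epsilon>" using gx by (simp add: cong_iff_dvd_diff)
      ultimately have pF: "int p dvd poly F x" by (simp only:) (rule dvd_diff; rule dvd_mult; assumption)
      have "F - [:-x,1:] * synthetic_div F x = [:poly F x:]"
        using synthetic_div_correct'[of x F] by (metis add_diff_cancel_left')
      thus ?thesis using pF True by (auto simp: dvdm_def intro!: exI[of _ "synthetic_div F x"])
    next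
      case False
      define L where "L = [:-x,1::int:]"
      have "dvdm p (L ^ i) F" using Suc by (simp add: L_def)
      then obtain Z E1 where FZ: "F = L ^ i * Z + [:int p:] * E1"
        by (auto simp: dvdm_def dvd_def) (metis add.commute diff_add_cancel)
      obtain r where r: "poly T x = int p * r" using Tx by (auto simp: dvd_def)
      have "[:int p:] * [:r:] = [:poly T x:]" by (simp add: r)
      hence "T = L * synthetic_div T x + [:int p:] * [:r:]"
        using synthetic_div_correct'[of x T] by (simp only: L_def)
      from power_dvdm_witness[OF this, of i] obtain S1 E2 where S1: "T ^ i = L ^ i * S1 + [:int p:] * E2" by blast
      have "T ^ (K - 1) = T ^ i * T ^ (K - 1 - i)" using Suc.prems by (simp flip: power_add)
      hence S2: "T ^ (K - 1) = L ^ i * (S1 * T ^ (K - 1 - i)) + [:int p:] * (E2 * T ^ (K - 1 - i))"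
        unfolding S1 by (simp add: algebra_simps)
      show ?thesis unfolding L_def[symmetric]
        by (rule linear_power_dvdm_step[OF p L_def _ _ FZ ng ode S2]) (use False Suc.prems Kp in auto)
    qed
  qed
  have degC: "degree (C k) = 0" for k unfolding C_def taylor_scale_def[OF T'] by (rule degree_of_nat)
  \<comment> \<open>If the lemma fails, the zeros of F counted with order K number more than (K -
    1/2) p. The degree is only (K - 1) p + K D, and the margin p/2 absorbs K D because 2 K^2 <
    p.\<close>
  have degF: "degree F \<le> K * D + (K - 1) * p"
  proof -
    have gk: "degree (g ^ k) \<le> k * D" for k
      using order_trans[OF degree_power_le[of g k] mult_le_mono1[OF deg]] by (simp add: mult.commute)
    have Tk: "degree (T ^ k) \<le> k * p" for k using degree_power_le[of T k] degT by (simp add: mult.commute)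
    have t: "degree (C k * twisted_deriv g a k * g^(K-k) * T^k) \<le> K * D + (K - 1) * p" if "k < K" for k
    proof -
      have "degree (C k * twisted_deriv g a k * g^(K-k) * T^k) \<le> 0 + k * D + (K - k) * D + k * p"
        by (intro order_trans[OF degree_mult_le] add_mono gk Tk degree_twisted_deriv[OF deg]) (simp add: degC)
      also have "0 + k * D + (K - k) * D = K * D" using that by (simp flip: add_mult_distrib)
      also have "K * D + k * p \<le> K * D + (K - 1) * p" using that by (intro add_left_mono mult_le_mono1) auto
      finally show ?thesis .
    qed
    have 1: "degree S \<le> K * D + (K - 1) * p" unfolding S_def by (rule degree_sum_le) (use t in auto)
    have 2: "degree (of_int \<epsilon> * S) \<le> K * D + (K - 1) * p"
      by (rule order_trans[OF degree_mult_le]) (use 1 in simp)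
    have "a * D \<le> (K - 1) * p" using a K by (simp add: mult.commute mult_le_mono)
    hence 3: "0 + K * D + a * D \<le> K * D + (K - 1) * p" by simp
    have "degree (C 0 * g ^ K * g ^ a) \<le> 0 + K * D + a * D"
      by (intro order_trans[OF degree_mult_le] add_mono gk) (simp add: degC)
    hence 3: "degree (C 0 * g ^ K * g ^ a) \<le> K * D + (K - 1) * p" using 3 by (rule order_trans)
    show ?thesis unfolding F_def by (rule degree_diff_le[OF 3 2])
  qed
  have pF: "[:int p:] dvd F"
  proof (rule ccontr)
    assume nF: "\<not> ?thesis"
    have "card X * K \<le> degree F"
      by (rule vanishing_multiplicity_bound[OF p _ _ nF]) (use mult in \<open>auto simp: X_def\<close>)
    hence "card X * (2 * K) \<le> 2 * (K * D + (K - 1) * p)" using degF by simp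
    also have "\<dots> \<le> p * (2 * K - 1)" using large K by (simp add: algebra_simps)
    finally show False using contr by (simp add: X_def)
  qed
  \<comment> \<open>Once F is zero modulo p, the differential equation retains only its error term.
    All factors of that term other than \<open>twisted_deriv g a K\<close> are nonzero modulo
    p.\<close>
  then obtain F1 where F1: "F = [:int p:] * F1" by (auto simp: dvd_def)
  have "pderiv F = [:int p:] * pderiv F1" unfolding F1 by (simp add: pderiv_smult)
  hence "(of_int \<epsilon> * of_nat K) * (twisted_deriv g a K * g) * T ^ (K - 1) = [:int p:] * (of_nat (a+K) * pderiv g * F1 - of_int \<epsilon> * E - g * pderiv F1)"
    using ode unfolding F1 by (simp del: twisted_deriv.simps of_nat_add add: algebra_simps)
  hence d: "[:int p:] dvd (of_int \<epsilon> * of_nat K) * (twisted_deriv g a K * g) * T ^ (K - 1)" by (metis dvd_triv_left)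
  have "\<not> [:int p:] dvd T ^ (K - 1)" by (rule monic_not_pconst_dvd[OF p]) (use lcT in \<open>simp add: lead_coeff_power\<close>)
  moreover have "\<not> [:int p:] dvd of_int \<epsilon>" using eps by (simp add: of_int_poly)
  moreover have "\<not> [:int p:] dvd of_nat K" using Kp K by (auto simp: of_nat_poly dest: zdvd_imp_le)
  moreover have "\<not> [:int p:] dvd g"
  proof
    assume "[:int p:] dvd g"
    then obtain g1 where "g = [:int p:] * g1" by (auto simp: dvd_def)
    hence "pderiv g = [:int p:] * pderiv g1" by (simp add: pderiv_smult)
    hence "[:int p:] dvd pderiv g" by (metis dvd_triv_left)
    moreover have "pderiv g dvd pderiv g ^ K" using K by (intro dvd_power) auto
    ultimately have "[:int p:] dvd pderiv g ^ K - g * 0" by (auto intro: dvd_trans)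
    thus False using nd unfolding dvdm_def by blast
  qed
  ultimately have pv: "[:int p:] dvd twisted_deriv g a K" using d by (meson pconst_dvd_multD[OF p])
  define c where "c = (-1)^K * (\<Prod>i<K. int (a + i))"
  obtain C2 where C2: "twisted_deriv g a K = g * C2 + of_int c * pderiv g ^ K" using twisted_deriv_mod[of g a K] unfolding c_def by blast
  \<comment> \<open>Every a + i with i < K lies strictly below p, since 2a < p and 2K <= 2 K^2 <
    p.\<close>
  have "\<not> int p dvd c"
  proof
    assume "int p dvd c"
    hence "int p dvd (\<Prod>i<K. int (a + i))" unfolding c_def by (cases "even K") auto
    then obtain i where i: "i < K" "int p dvd int (a + i)" using prime_dvd_prod_iff[of "{..<K}" "int p"] pi by auto
    have "p dvd a + i" using i(2) by (simp only: int_dvd_int_iff)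
    hence "p \<le> a + i" using a by (intro dvd_imp_le) auto
    moreover have "2 * K \<le> 2 * K * K" using K by simp
    ultimately show False using a i(1) large by linarith
  qed
  hence "coprime c (int p)" using pi by (metis prime_imp_coprime coprime_commute)
  then obtain \<kappa> where "[c * \<kappa> = 1] (mod int p)" using cong_solve_coprime_int by blast
  then obtain m where m: "1 - \<kappa> * c = int p * m" by (metis cong_iff_dvd_diff dvd_def mult.commute cong_sym)
  have "pderiv g ^ K - g * (- of_int \<kappa> * C2) = of_int (1 - \<kappa> * c) * pderiv g ^ K + of_int \<kappa> * twisted_deriv g a K"
    unfolding C2 by (simp add: algebra_simps)
  moreover have "of_int (1 - \<kappa> * c) * pderiv g ^ K = [:int p:] * (of_int m * pderiv g ^ K)"
    unfolding m by (simp add: of_int_poly mult.commute)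
  hence "[:int p:] dvd of_int (1 - \<kappa> * c) * pderiv g ^ K" by (metis dvd_triv_left)
  ultimately have "[:int p:] dvd pderiv g ^ K - g * (- of_int \<kappa> * C2)" using pv by (metis dvd_add dvd_mult)
  thus False using nd unfolding dvdm_def by blast
qed

section \<open>Chebyshev estimates\<close>

definition prime_count :: "nat \<Rightarrow> nat" where
  "prime_count n = card {p. prime p \<and> p \<le> n}"

lemma finite_primes_le: "finite {p::nat. prime p \<and> p \<le> n}"
  by (rule finite_subset[of _ "{..n}"]) auto

lemma prime_count_mono: "m \<le> n \<Longrightarrow> prime_count m \<le> prime_count n"
  unfolding prime_count_def by (rule card_mono[OF finite_primes_le]) auto

lemma prod_primes_dvd:
  fixes A :: "nat set"
  assumes "finite A" "\<And>p. p \<in> A \<Longrightarrow> prime p \<and> p dvd n"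
  shows "\<Prod>A dvd n"
  using assms
proof (induction A rule: finite_induct)
  case (insert p A)
  have "coprime p (\<Prod>A)"
    using insert by (intro prod_coprime_right) (metis insert_iff primes_coprime)
  thus ?case using insert by (simp add: divides_mult)
qed simp

lemma central_binomial_le_four_power: "(2 * n) choose n \<le> 4 ^ n"
proof -
  have "(2 * n) choose n \<le> 2 ^ (2 * n)" by (rule binomial_le_pow2)
  thus ?thesis by (simp add: power_mult)
qed

lemma prime_count_double:
  assumes "n > 0"
  shows "n ^ (prime_count (2 * n) - prime_count n) \<le> 4 ^ n"
proof -
  define A where "A = {p. prime p \<and> n < p \<and> p \<le> 2 * n}"
  have fA: "finite A" unfolding A_def by (rule finite_subset[of _ "{..2*n}"]) auto
  have "{p. prime p \<and> p \<le> 2 * n} = {p. prime p \<and> p \<le> n} \<union> A" by (auto simp: A_def)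
  moreover have "{p. prime p \<and> p \<le> n} \<inter> A = {}" by (auto simp: A_def)
  ultimately have "prime_count (2 * n) = prime_count n + card A"
    unfolding prime_count_def using finite_primes_le fA by (simp add: card_Un_disjoint)
  hence cA: "prime_count (2 * n) - prime_count n = card A" by simp
  have dvd: "p dvd (2 * n) choose n" if p: "p \<in> A" for p
  proof -
    have pp: "prime p" "n < p" "p \<le> 2 * n" using p by (auto simp: A_def)
    have "fact n * fact n * ((2 * n) choose n) = (fact (2 * n) :: nat)"
      using binomial_fact_lemma[of n "2 * n"] by simp
    moreover have "p dvd fact (2 * n)" using pp by (simp add: prime_dvd_fact_iff)
    ultimately have "p dvd fact n * fact n * ((2 * n) choose n)" by simp
    moreover have "\<not> p dvd fact n" using pp by (simp add: prime_dvd_fact_iff)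
    ultimately show ?thesis using pp(1) by (simp add: prime_dvd_mult_iff)
  qed
  have "n ^ card A \<le> \<Prod>A"
    using prod_mono[of A "\<lambda>_. n" "\<lambda>x. x"] by (auto simp: A_def)
  also have "\<dots> \<le> (2 * n) choose n"
  proof (rule dvd_imp_le)
    show "\<Prod>A dvd (2 * n) choose n"
      by (rule prod_primes_dvd[OF fA]) (use dvd in \<open>auto simp: A_def\<close>)
  qed simp
  also have "\<dots> \<le> 4 ^ n" by (rule central_binomial_le_four_power)
  finally show ?thesis unfolding cA .
qed

text \<open>The constant comes from the induction: doubling adds 2 to a constant C, and (C + 2)(m +
  1)/m <= 2C holds for all m >= 2 exactly when C >= 6. The step from m = 1 is checked
  directly.\<close>

lemma prime_count_power_two:
  assumes "m > 0"
  shows "prime_count (2 ^ m) * m \<le> 6 * 2 ^ m"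
  using assms
proof (induction m rule: nat_induct_non_zero)
  case 1
  have "prime_count 2 \<le> card {..2::nat}" unfolding prime_count_def by (rule card_mono) auto
  thus ?case by simp
next
  case (Suc m)
  define q where "q = prime_count (2 ^ Suc m) - prime_count (2 ^ m)"
  have eq: "prime_count (2 ^ Suc m) = prime_count (2 ^ m) + q"
    using prime_count_mono[of "2^m" "2^Suc m"] by (simp add: q_def)
  have "(2 ^ m) ^ q \<le> (4::nat) ^ (2 ^ m)" using prime_count_double[of "2^m"] by (simp add: q_def)
  also have "(4::nat) ^ (2 ^ m) = 2 ^ (2 * 2 ^ m)" by (simp add: power_mult)
  finally have mq: "m * q \<le> 2 * 2 ^ m" by (simp flip: power_mult)
  show ?case
  proof (cases "m = 1")
    case True
    have "prime_count 4 \<le> card {..4::nat}" unfolding prime_count_def by (rule card_mono) auto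
    thus ?thesis using True by simp
  next
    case False
    have le: "prime_count (2 ^ Suc m) * m \<le> 8 * 2 ^ m" using Suc.IH mq unfolding eq by (simp add: algebra_simps)
    have "m * (prime_count (2 ^ Suc m) * Suc m) = (prime_count (2 ^ Suc m) * m) * Suc m" by (simp add: algebra_simps)
    also have "\<dots> \<le> 8 * 2 ^ m * Suc m" using le by (rule mult_le_mono1)
    also have "\<dots> \<le> 8 * 2 ^ m * m + 8 * 2 ^ m * 1" by simp
    also have "8 * 2 ^ m * 1 \<le> 4 * 2 ^ m * m" using False Suc.hyps by simp
    finally have "m * (prime_count (2 ^ Suc m) * Suc m) \<le> m * (6 * 2 ^ Suc m)" by simp
    thus ?thesis using Suc.hyps by simp
  qed
qed

lemma prime_count_sublinear:
  assumes "\<epsilon> > 0"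
  shows "\<exists>n0. \<forall>n\<ge>n0. real (prime_count n) \<le> \<epsilon> * real n"
proof -
  obtain m0 :: nat where m0: "12 / \<epsilon> < real m0" using reals_Archimedean2 by blast
  show ?thesis
  proof (intro exI[of _ "2 ^ m0"] allI impI)
    fix n :: nat assume n: "2 ^ m0 \<le> n"
    hence n0: "n > 0" by (meson less_le_trans zero_less_numeral zero_less_power)
    obtain m where m: "2 ^ m \<le> n" "n < 2 ^ Suc m"
      using ex_power_ivl1[of 2 n] n0 by auto
    have "2 ^ m0 < (2::nat) ^ Suc m" using n m by linarith
    hence "m0 < Suc m" by (rule power_less_imp_less_exp[rotated]) simp
    hence "12 / \<epsilon> < real (Suc m)" using m0 by simp
    hence e: "12 \<le> \<epsilon> * real (Suc m)" using assms by (simp add: field_simps)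
    have "prime_count n * Suc m \<le> prime_count (2 ^ Suc m) * Suc m"
      using m prime_count_mono[of n "2 ^ Suc m"] by (intro mult_le_mono1) simp
    also have "\<dots> \<le> 12 * 2 ^ m" using prime_count_power_two[of "Suc m"] by simp
    also have "\<dots> \<le> 12 * n" using m by simp
    finally have "real (prime_count n) * real (Suc m) \<le> 12 * real n"
      by (metis of_nat_le_iff of_nat_mult of_nat_numeral)
    also have "\<dots> \<le> \<epsilon> * real (Suc m) * real n" using e by (intro mult_right_mono) auto
    finally have "real (prime_count n) * real (Suc m) \<le> (\<epsilon> * real n) * real (Suc m)" by (simp add: mult_ac)
    thus "real (prime_count n) \<le> \<epsilon> * real n" by (rule mult_right_le_imp_le) simp
  qed
qed

lemma multiplicity_eq_card_powers:
  fixes p i M :: nat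
  assumes "prime p" "0 < i" "i < p ^ Suc M"
  shows "multiplicity p i = card {k\<in>{1..M}. p ^ k dvd i}"
proof -
  have iff: "p ^ k dvd i \<longleftrightarrow> k \<le> multiplicity p i" for k
    using assms by (intro power_dvd_iff_le_multiplicity) (auto dest: prime_gt_1_nat)
  have "p ^ multiplicity p i \<le> i" using assms by (intro dvd_imp_le) (auto simp: multiplicity_dvd)
  hence "p ^ multiplicity p i < p ^ Suc M" using assms(3) by linarith
  hence "multiplicity p i < Suc M" using prime_gt_1_nat[OF assms(1)] by (simp only: power_less_imp_less_exp)
  hence "{k\<in>{1..M}. p ^ k dvd i} = {1..multiplicity p i}" unfolding iff by auto
  thus ?thesis by simp
qed

lemma multiplicity_fact_eq:
  fixes p n M :: nat
  assumes p: "prime p" and "n < p ^ Suc M"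
  shows "multiplicity p (fact n) = (\<Sum>k=1..M. n div p ^ k)"
  using assms(2)
proof (induction n)
  case (Suc n)
  have "multiplicity p (fact (Suc n)) = multiplicity p (Suc n) + multiplicity p (fact n)"
    unfolding fact_Suc using p by (subst prime_elem_multiplicity_mult_distrib) auto
  also have "multiplicity p (Suc n) = card {k\<in>{1..M}. p ^ k dvd Suc n}"
    by (rule multiplicity_eq_card_powers[OF p _ Suc.prems]) simp
  also have "\<dots> = (\<Sum>k=1..M. if p ^ k dvd Suc n then 1 else 0)"
    by (simp add: sum.If_cases Int_def)
  also have "multiplicity p (fact n) = (\<Sum>k=1..M. n div p ^ k)" using Suc by simp
  also have "(\<Sum>k=1..M. if p ^ k dvd Suc n then 1 else 0) + (\<Sum>k=1..M. n div p ^ k) = (\<Sum>k=1..M. Suc n div p ^ k)"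
    unfolding sum.distrib[symmetric]
    by (intro sum.cong refl) (auto simp: div_Suc dvd_eq_mod_eq_0)
  finally show ?case .
qed simp

text \<open>In Legendre's formula each exponent k contributes floor(2n/p^k) - 2 floor(n/p^k), which
  is at most 1 and is 0 as soon as p^k > 2n.\<close>

lemma central_binomial_prime_power_le:
  fixes p n :: nat
  assumes p: "prime p" and n: "n > 0"
  shows "p ^ multiplicity p ((2 * n) choose n) \<le> 2 * n"
proof -
  define M where "M = 2 * n"
  have p2: "p \<ge> 2" by (rule prime_ge_2_nat[OF p])
  have M: "2 * n < p ^ Suc M"
  proof -
    have "2 * n < 2 ^ M" unfolding M_def by (rule less_exp)
    also have "\<dots> \<le> p ^ M" using p2 by (rule power_mono) simp
    also have "\<dots> \<le> p ^ Suc M" using p2 by (intro power_increasing) auto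
    finally show ?thesis .
  qed
  have "fact n * fact n * ((2 * n) choose n) = (fact (2 * n) :: nat)"
    using binomial_fact_lemma[of n "2 * n"] by simp
  hence "multiplicity p (fact (2 * n)) = multiplicity p (fact n * fact n * ((2 * n) choose n))" by simp
  also have "\<dots> = 2 * multiplicity p (fact n) + multiplicity p ((2 * n) choose n)"
    using p by (simp add: prime_elem_multiplicity_mult_distrib)
  finally have eq: "(\<Sum>k=1..M. (2 * n) div p ^ k) = 2 * (\<Sum>k=1..M. n div p ^ k) + multiplicity p ((2 * n) choose n)"
    using M by (simp add: multiplicity_fact_eq[OF p, of _ M])
  define J where "J = {k\<in>{1..M}. p ^ k \<le> 2 * n}"
  have "(\<Sum>k=1..M. (2 * n) div p ^ k) \<le> (\<Sum>k=1..M. 2 * (n div p ^ k) + (if p ^ k \<le> 2 * n then 1 else 0))"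
  proof (rule sum_mono)
    fix k assume "k \<in> {1..M}"
    have "0 < p ^ k" using p2 by simp
    show "(2 * n) div p ^ k \<le> 2 * (n div p ^ k) + (if p ^ k \<le> 2 * n then 1 else 0)"
    proof (cases "p ^ k \<le> 2 * n")
      case True
      have "(2 * n) div p ^ k < 2 * (n div p ^ k) + 2"
      proof (rule less_mult_imp_div_less)
        have "n < p ^ k * (n div p ^ k) + p ^ k"
          using \<open>0 < p ^ k\<close> by (metis add_less_cancel_left mod_less_divisor mult_div_mod_eq)
        thus "2 * n < (2 * (n div p ^ k) + 2) * p ^ k" by (simp add: algebra_simps)
      qed
      thus ?thesis using True by simp
    next
      case False
      thus ?thesis by simp
    qed
  qed
  also have "\<dots> = 2 * (\<Sum>k=1..M. n div p ^ k) + card J"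
    by (simp add: sum.distrib sum_distrib_left sum.If_cases J_def Int_def)
  finally have m: "multiplicity p ((2 * n) choose n) \<le> card J" using eq by simp
  show ?thesis
  proof (cases "J = {}")
    case True
    thus ?thesis using m n by simp
  next
    case False
    have fJ: "finite J" by (simp add: J_def)
    have "J \<subseteq> {1..Max J}" using fJ by (auto simp: J_def)
    hence "card J \<le> Max J" using card_mono[of "{1..Max J}" J] by simp
    hence "p ^ multiplicity p ((2 * n) choose n) \<le> p ^ Max J" using m p2 by (intro power_increasing) auto
    also have "\<dots> \<le> 2 * n" using Max_in[OF fJ False] by (auto simp: J_def)
    finally show ?thesis .
  qed
qed

text \<open>The central binomial coefficient is at least 4^n / (2n), and each prime up to 2n
  contributes a factor of at most 2n to it.\<close>

lemma prime_count_lower: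
  assumes n: "n > 0"
  shows "4 ^ n \<le> (2 * n) ^ Suc (prime_count (2 * n))"
proof -
  define c where "c = (2 * n) choose n"
  have c0: "c \<noteq> 0" by (simp add: c_def)
  have pf: "prime_factors c \<subseteq> {p. prime p \<and> p \<le> 2 * n}"
  proof
    fix p assume "p \<in> prime_factors c"
    hence p: "prime p" "p dvd c" by auto
    have "fact n * fact n * c = (fact (2 * n) :: nat)"
      using binomial_fact_lemma[of n "2 * n"] by (simp add: c_def)
    hence "p dvd fact (2 * n)" using p(2) by (metis dvd_mult)
    thus "p \<in> {p. prime p \<and> p \<le> 2 * n}" using p by (simp add: prime_dvd_fact_iff)
  qed
  have "c = (\<Prod>p\<in>prime_factors c. p ^ multiplicity p c)"
    using prod_prime_factors[OF c0] by simp
  also have "\<dots> \<le> (\<Prod>p\<in>prime_factors c. 2 * n)"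
    by (rule prod_mono) (use central_binomial_prime_power_le[OF _ n] in \<open>auto simp: c_def\<close>)
  also have "\<dots> = (2 * n) ^ card (prime_factors c)" by simp
  also have "\<dots> \<le> (2 * n) ^ prime_count (2 * n)"
    unfolding prime_count_def using card_mono[OF finite_primes_le pf] n by (intro power_increasing) auto
  finally have c: "c \<le> (2 * n) ^ prime_count (2 * n)" .
  have "4 ^ n / (2 * real n) \<le> real c" unfolding c_def using n by (rule central_binomial_lower_bound)
  hence "4 ^ n \<le> 2 * real n * real c" using n by (simp add: field_simps)
  hence "real (4 ^ n) \<le> real (2 * n * c)" by simp
  hence "4 ^ n \<le> 2 * n * c" by (simp only: of_nat_le_iff)
  also have "\<dots> \<le> 2 * n * (2 * n) ^ prime_count (2 * n)" using c by (rule mult_le_mono2)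
  finally show ?thesis by simp
qed

text \<open>These are the sieving primes for the dyadic range j. The sieve consumes sqrt j of them;
  three times as many are provided because up to sqrt j may divide n and as many again the index of
  a line. Being above j^2, they rarely divide anything; being below j^4, sqrt j of them have a
  product that is small against 2^(j/2).\<close>

lemma eventually_many_primes_between:
  "eventually (\<lambda>j. \<exists>A. finite A \<and> card A = 3 * nat \<lfloor>sqrt (real j)\<rfloor> \<and>
     (\<forall>l\<in>A. prime l \<and> j ^ 2 < l \<and> l \<le> j ^ 4)) at_top"
proof -
  have "eventually (\<lambda>j::nat. real j ^ 2 + 3 * sqrt (real j) + 1 \<le> (real j ^ 4 / 2 - 1) * ln 4 / ln (real j ^ 4) \<and> real j \<ge> 2) at_top"
    by (intro eventually_conj; real_asymp)
  thus ?thesis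
  proof (rule eventually_mono)
    fix j :: nat assume j: "real j ^ 2 + 3 * sqrt (real j) + 1 \<le> (real j ^ 4 / 2 - 1) * ln 4 / ln (real j ^ 4) \<and> real j \<ge> 2"
    define n where "n = j ^ 4 div 2"
    have j2: "j \<ge> 2" using j by linarith
    have j4: "j ^ 4 \<ge> 2 ^ 4" using j2 by (rule power_mono) simp
    have n0: "n > 0" using j4 by (simp add: n_def)
    have n2: "2 * n \<le> j ^ 4" by (simp add: n_def)
    have nl: "real n \<ge> real j ^ 4 / 2 - 1"
    proof -
      have "j ^ 4 \<le> 2 * n + 1" by (simp add: n_def)
      hence "real (j ^ 4) \<le> real (2 * n + 1)" by (simp only: of_nat_le_iff)
      thus ?thesis by simp
    qed
    define P where "P = prime_count (j ^ 4)"
    have "4 ^ n \<le> (2 * n) ^ Suc (prime_count (2 * n))" by (rule prime_count_lower[OF n0])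
    also have "\<dots> \<le> (2 * n) ^ Suc P" using n0 prime_count_mono[OF n2] by (intro power_increasing) (auto simp: P_def)
    also have "\<dots> \<le> (j ^ 4) ^ Suc P" using n2 by (rule power_mono) simp
    finally have "real (4 ^ n) \<le> real ((j ^ 4) ^ Suc P)" by (simp only: of_nat_le_iff)
    hence "ln (4 ^ n) \<le> ln ((real j ^ 4) ^ Suc P)" using j2 by (subst ln_le_cancel_iff) auto
    hence a: "real n * ln 4 \<le> real (Suc P) * ln (real j ^ 4)" using j2 by (simp add: ln_realpow del: of_nat_Suc power_Suc)
    have lnp: "ln (real j ^ 4) > 0" using j2 by (intro ln_gt_zero one_less_power) auto
    have "(real j ^ 4 / 2 - 1) * ln 4 \<le> real (Suc P) * ln (real j ^ 4)"
      using a nl by (meson ln_ge_zero mult_right_mono order_trans one_le_numeral)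
    hence "(real j ^ 4 / 2 - 1) * ln 4 / ln (real j ^ 4) \<le> real (Suc P)" using lnp by (simp add: field_simps)
    hence "real j ^ 2 + 3 * sqrt (real j) \<le> real P" using j by simp
    moreover have "real (3 * nat \<lfloor>sqrt (real j)\<rfloor>) \<le> 3 * sqrt (real j)" by simp
    ultimately have "real (j ^ 2 + 3 * nat \<lfloor>sqrt (real j)\<rfloor>) \<le> real P"
      unfolding of_nat_add of_nat_power by linarith
    hence P: "j ^ 2 + 3 * nat \<lfloor>sqrt (real j)\<rfloor> \<le> P" by (simp only: of_nat_le_iff)
    define B where "B = {p. prime p \<and> p \<le> j ^ 4} - {..j ^ 2} "
    have "card {p. prime p \<and> p \<le> j ^ 4} - card ({1..j ^ 2}) \<le> card ({p. prime p \<and> p \<le> j ^ 4} - {1..j ^ 2})"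
      by (rule diff_card_le_card_Diff) simp
    moreover have "{p. prime p \<and> p \<le> j ^ 4} - {1..j ^ 2} = B" by (auto simp: B_def dest: prime_gt_0_nat)
    ultimately have "3 * nat \<lfloor>sqrt (real j)\<rfloor> \<le> card B" using P by (simp add: P_def prime_count_def)
    then obtain A where "A \<subseteq> B" "card A = 3 * nat \<lfloor>sqrt (real j)\<rfloor>" "finite A"
      by (rule obtain_subset_with_card_n)
    thus "\<exists>A. finite A \<and> card A = 3 * nat \<lfloor>sqrt (real j)\<rfloor> \<and> (\<forall>l\<in>A. prime l \<and> j ^ 2 < l \<and> l \<le> j ^ 4)"
      by (intro exI[of _ A]) (auto simp: B_def)
  qed
qed

section \<open>Roots of an irreducible polynomial modulo varying moduli\<close>

text \<open>Row 0 of adj(M) M = det(M) I, applied to the vector of powers of w, expresses det M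
  itself as a combination of the given forms because w^0 = 1.\<close>

lemma linear_forms_dvd_det:
  fixes M :: "int mat"
  assumes M: "M \<in> carrier_mat D D" and D: "0 < D"
    and rows: "\<And>i. i < D \<Longrightarrow> n dvd (\<Sum>l<D. M $$ (i, l) * w ^ l)"
  shows "n dvd det M"
proof -
  have "(\<Sum>l<D. (adj_mat M * M) $$ (0, l) * w ^ l) = (\<Sum>l<D. (\<Sum>i<D. adj_mat M $$ (0, i) * M $$ (i, l)) * w ^ l)"
    using M D adj_mat(1)[OF M] by (intro sum.cong) (auto simp: scalar_prod_def lessThan_atLeast0)
  also have "\<dots> = (\<Sum>i<D. adj_mat M $$ (0, i) * (\<Sum>l<D. M $$ (i, l) * w ^ l))"
    unfolding sum_distrib_right sum_distrib_left by (subst sum.swap) (simp add: mult.assoc)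
  finally have eq: "(\<Sum>l<D. (adj_mat M * M) $$ (0, l) * w ^ l) = \<dots>" .
  have "(\<Sum>l<D. (adj_mat M * M) $$ (0, l) * w ^ l) = (\<Sum>l<D. if l = 0 then det M else 0)"
    unfolding adj_mat(3)[OF M] using D by (intro sum.cong) auto
  also have "\<dots> = det M" using D by simp
  finally have "det M = (\<Sum>i<D. adj_mat M $$ (0, i) * (\<Sum>l<D. M $$ (i, l) * w ^ l))" using eq by simp
  also have "n dvd \<dots>" by (rule dvd_sum, rule dvd_mult, rule rows) simp
  finally show ?thesis .
qed

text \<open>Replace row i of M by (-w, 1, 0, ..., 0), which also annihilates the powers of w. The
  determinant of the new matrix is divisible by n, and its expansion along that row is the stated
  combination of cofactors.\<close>

lemma adj_combination_dvd:
  fixes M :: "int mat"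
  assumes M: "M \<in> carrier_mat D D" and D: "2 \<le> D" and i: "i < D"
    and rows: "\<And>i. i < D \<Longrightarrow> n dvd (\<Sum>l<D. M $$ (i, l) * w ^ l)"
  shows "n dvd adj_mat M $$ (1, i) - w * adj_mat M $$ (0, i)"
proof -
  define v where "v l = (if l = 0 then - w else if l = 1 then 1 else 0)" for l :: nat
  define M' where "M' = mat D D (\<lambda>(r, l). if r = i then v l else M $$ (r, l))"
  have M': "M' \<in> carrier_mat D D" by (simp add: M'_def)
  have sv: "(\<Sum>l<D. v l * x l) = x 1 - w * x 0" for x :: "nat \<Rightarrow> int"
  proof -
    have "(\<Sum>l<D. v l * x l) = (\<Sum>l\<in>{0,1}. v l * x l)"
      by (rule sum.mono_neutral_right) (use D in \<open>auto simp: v_def\<close>)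
    thus ?thesis by (simp add: v_def)
  qed
  have "n dvd det M'"
  proof (rule linear_forms_dvd_det[OF M'])
    fix r assume r: "r < D"
    show "n dvd (\<Sum>l<D. M' $$ (r, l) * w ^ l)"
    proof (cases "r = i")
      case True
      have "(\<Sum>l<D. M' $$ (r, l) * w ^ l) = (\<Sum>l<D. v l * w ^ l)" using r True by (simp add: M'_def)
      also have "\<dots> = 0" by (subst sv) simp
      finally show ?thesis by simp
    next
      case False
      thus ?thesis using rows[OF r] r by (simp add: M'_def)
    qed
  qed (use D in auto)
  also have "det M' = (\<Sum>l<D. M' $$ (i, l) * cofactor M' i l)"
    by (rule laplace_expansion_row[OF M' i])
  also have "\<dots> = (\<Sum>l<D. v l * adj_mat M $$ (l, i))"
  proof (rule sum.cong[OF refl])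
    fix l assume l: "l \<in> {..<D}"
    have "mat_delete M' i l = mat_delete M i l"
      unfolding mat_delete_def using M l i by (intro eq_matI) (auto simp: M'_def)
    hence "cofactor M' i l = cofactor M i l" by (simp add: cofactor_def)
    thus "M' $$ (i, l) * cofactor M' i l = v l * adj_mat M $$ (l, i)"
      using l i M by (simp add: M'_def adj_mat_def)
  qed
  finally show ?thesis unfolding sv .
qed

text \<open>The root w makes the coefficients q_i divisible by n and the root w' makes the forms
  divisible by n. Their product sum equals det(M) (w' - w), so n^2 divides c n (w' - w).\<close>

lemma two_roots_det_dvd:
  fixes M :: "int mat"
  assumes M: "M \<in> carrier_mat D D" and D: "2 \<le> D" and n: "n \<noteq> 0" and det: "det M = c * n"
    and rows: "\<And>i. i < D \<Longrightarrow> n dvd (\<Sum>l<D. M $$ (i, l) * w ^ l)"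
    and rows': "\<And>i. i < D \<Longrightarrow> n dvd (\<Sum>l<D. M $$ (i, l) * w' ^ l)"
  shows "n dvd c * (w' - w)"
proof -
  define q where "q i = adj_mat M $$ (1, i) - w * adj_mat M $$ (0, i)" for i
  have row: "(\<Sum>i<D. adj_mat M $$ (k, i) * (\<Sum>l<D. M $$ (i, l) * w' ^ l)) = det M * w' ^ k" if k: "k < D" for k
  proof -
    have "(\<Sum>i<D. adj_mat M $$ (k, i) * (\<Sum>l<D. M $$ (i, l) * w' ^ l)) =
       (\<Sum>l<D. (\<Sum>i<D. adj_mat M $$ (k, i) * M $$ (i, l)) * w' ^ l)"
      unfolding sum_distrib_right sum_distrib_left by (subst sum.swap) (simp add: mult.assoc)
    also have "\<dots> = (\<Sum>l<D. (adj_mat M * M) $$ (k, l) * w' ^ l)"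
      using M k adj_mat(1)[OF M] by (intro sum.cong) (auto simp: scalar_prod_def lessThan_atLeast0)
    also have "\<dots> = (\<Sum>l<D. if l = k then det M * w' ^ k else 0)"
      unfolding adj_mat(3)[OF M] using k by (intro sum.cong) auto
    also have "\<dots> = det M * w' ^ k" using k by simp
    finally show ?thesis .
  qed
  have "(\<Sum>i<D. q i * (\<Sum>l<D. M $$ (i, l) * w' ^ l)) = det M * w' ^ 1 - w * (det M * w' ^ 0)"
    unfolding q_def left_diff_distrib sum_subtractf mult.assoc sum_distrib_left[symmetric] using row[of 0] row[of 1] D by simp
  hence eq: "c * n * (w' - w) = (\<Sum>i<D. q i * (\<Sum>l<D. M $$ (i, l) * w' ^ l))" by (simp add: det algebra_simps)
  have "n * n dvd (\<Sum>i<D. q i * (\<Sum>l<D. M $$ (i, l) * w' ^ l))"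
    by (rule dvd_sum, rule mult_dvd_mono) (use adj_combination_dvd[OF M D _ rows] rows' in \<open>auto simp: q_def\<close>)
  hence "n * n dvd n * (c * (w' - w))" unfolding eq[symmetric] by (simp add: mult_ac)
  thus ?thesis using n by simp
qed

lemma det_abs_le:
  fixes M :: "int mat"
  assumes M: "M \<in> carrier_mat D D" and b: "\<And>i l. i < D \<Longrightarrow> l < D \<Longrightarrow> \<bar>M $$ (i, l)\<bar> \<le> b"
  shows "\<bar>det M\<bar> \<le> fact D * b ^ D"
proof -
  have "\<bar>det M\<bar> \<le> (\<Sum>p\<in>{p. p permutes {0..<D}}. \<bar>signof p * (\<Prod>i = 0..<D. M $$ (i, p i))\<bar>)"
    unfolding det_def'[OF M] by (rule sum_abs)
  also have "\<dots> \<le> (\<Sum>p\<in>{p. p permutes {0..<D}}. b ^ D)"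
  proof (rule sum_mono)
    fix p assume "p \<in> {p. p permutes {0..<D}}"
    hence p: "p permutes {0..<D}" by simp
    have "\<bar>signof p * (\<Prod>i = 0..<D. M $$ (i, p i))\<bar> = (\<Prod>i = 0..<D. \<bar>M $$ (i, p i)\<bar>)"
      by (simp add: abs_mult abs_prod sign_def)
    also have "\<dots> \<le> (\<Prod>i = 0..<D. b)"
      by (rule prod_mono) (use b permutes_in_image[OF p] in auto)
    finally show "\<bar>signof p * (\<Prod>i = 0..<D. M $$ (i, p i))\<bar> \<le> b ^ D" by simp
  qed
  also have "\<dots> = fact D * b ^ D" by (simp add: card_permutations[of _ D] of_nat_fact)
  finally show ?thesis .
qed

text \<open>Thue's pigeonhole argument: there are more vectors with entries in 0..B than residues
  modulo n, and the difference of two colliding vectors is the relation.\<close>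

lemma small_linear_relation:
  fixes n B D :: nat and w :: int
  assumes n: "0 < n" "n < Suc B ^ D"
  shows "\<exists>f \<in> {..<D} \<rightarrow>\<^sub>E {-int B..int B}. (\<exists>k<D. f k \<noteq> 0) \<and> int n dvd (\<Sum>k<D. f k * w ^ k)"
proof -
  define F where "F = ({..<D} \<rightarrow>\<^sub>E {0..int B})"
  define h where "h f = (\<Sum>k<D. f k * w ^ k) mod int n" for f :: "nat \<Rightarrow> int"
  have fF: "finite F" unfolding F_def by (intro finite_PiE) auto
  have "card F = Suc B ^ D" unfolding F_def by (subst card_PiE) (simp_all add: nat_add_distrib)
  moreover have "h ` F \<subseteq> {0..<int n}" using n by (auto simp: h_def)
  hence "card (h ` F) \<le> n" using card_mono[of "{0..<int n}" "h ` F"] by simp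
  ultimately have "card (h ` F) < card F" using n by simp
  hence "\<not> inj_on h F" by (rule pigeonhole)
  then obtain f g where fg: "f \<in> F" "g \<in> F" "f \<noteq> g" "h f = h g" by (auto simp: inj_on_def)
  define e where "e = (\<lambda>k\<in>{..<D}. f k - g k)"
  have "f k = g k" if "\<forall>k<D. f k = g k" for k
    using that fg(1,2) by (cases "k < D") (auto simp: F_def PiE_def extensional_def)
  hence ne: "\<exists>k<D. f k \<noteq> g k" using fg(3) by blast
  have "e \<in> {..<D} \<rightarrow>\<^sub>E {-int B..int B}"
  proof (rule PiE_I)
    fix k assume k: "k \<in> {..<D}"
    have "f k \<in> {0..int B}" "g k \<in> {0..int B}" using fg(1,2) k unfolding F_def by (blast dest: PiE_mem)+
    thus "e k \<in> {-int B..int B}" using k by (simp add: e_def)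
  qed (simp add: e_def)
  moreover have "\<exists>k<D. e k \<noteq> 0" using ne by (auto simp: e_def)
  moreover have "int n dvd (\<Sum>k<D. f k * w ^ k) - (\<Sum>k<D. g k * w ^ k)"
    using fg(4) by (simp add: h_def mod_eq_dvd_iff)
  hence "int n dvd (\<Sum>k<D. e k * w ^ k)" by (simp add: e_def sum_subtractf left_diff_distrib)
  ultimately show ?thesis by blast
qed

lemma poly_eq_sum_less:
  assumes "degree p < D"
  shows "poly p x = (\<Sum>l<D. coeff p l * (x :: int) ^ l)"
proof -
  have "poly p x = (\<Sum>l\<le>degree p. coeff p l * x ^ l)" by (rule poly_altdef)
  also have "\<dots> = (\<Sum>l<D. coeff p l * x ^ l)"
    by (rule sum.mono_neutral_left) (use assms in \<open>auto simp: coeff_eq_0\<close>)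
  finally show ?thesis .
qed

text \<open>The restriction to X/2 < n <= X makes a norm of size O(X) divided by n bounded, so that
  few pairs share an element.\<close>

definition root_pairs :: "int poly \<Rightarrow> nat \<Rightarrow> (nat \<times> nat) set" where
  "root_pairs u X = {(n, w). X < 2 * n \<and> n \<le> X \<and> w < n \<and> int n dvd poly u (int w)}"

lemma finite_root_pairs: "finite (root_pairs u X)"
  by (rule finite_subset[of _ "{..X} \<times> {..X}"]) (auto simp: root_pairs_def)

text \<open>A pair \<open>(n, \<omega>)\<close> is an ideal of norm \<open>n\<close> in the order \<open>\<int>[\<theta>]\<close> given by \<open>u\<close>. By the pigeonhole principle it
  contains an element with coefficients at most \<open>X\<^sup>1\<^sup>/\<^sup>D\<close>, whose norm is a bounded multiple of \<open>n\<close>, and an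
  element lies in boundedly many such ideals.\<close>

lemma root_pairs_linear_bound:
  fixes u :: "int poly"
  assumes monic: "lead_coeff u = 1" and irr: "irreducible u" and D: "degree u = D" "2 \<le> D"
  shows "\<exists>C. \<forall>X\<ge>1. card (root_pairs u X) \<le> C * X"
proof -
  have "\<exists>r. \<forall>m. degree (r m) < D \<and> u dvd (monom 1 m - r m)"
  proof (rule choice, rule allI)
    fix m
    obtain Q R where QR: "monom 1 m = u * Q + R" "R = 0 \<or> degree R < degree u"
      using monic_division_exists[OF monic] by blast
    thus "\<exists>R. degree R < D \<and> u dvd monom 1 m - R" using D by (intro exI[of _ R]) auto
  qed
  then obtain r where r: "\<And>m. degree (r m) < D" "\<And>m. u dvd (monom 1 m - r m)" by blast
  define c where "c m l = coeff (r m) l" for m l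
  \<comment> \<open>Row i lists the coordinates of theta^i f(theta) modulo \<open>u\<close>, so
    \<open>M f\<close> represents multiplication by the element f and its determinant is the
    norm.\<close>
  define M where "M f = mat D D (\<lambda>(i, l). \<Sum>k<D. f k * c (i + k) l)" for f
  have M: "M f \<in> carrier_mat D D" for f by (simp add: M_def)
  obtain b where b: "\<And>m l. m < 2 * D \<Longrightarrow> l < D \<Longrightarrow> \<bar>c m l\<bar> \<le> int b"
  proof -
    define b where "b = (\<Sum>m<2*D. \<Sum>l<D. nat \<bar>c m l\<bar>)"
    have "\<bar>c m l\<bar> \<le> int b" if "m < 2 * D" "l < D" for m l
    proof -
      have "nat \<bar>c m l\<bar> \<le> (\<Sum>l<D. nat \<bar>c m l\<bar>)" using that by (intro member_le_sum) auto
      also have "\<dots> \<le> b" unfolding b_def using that by (intro member_le_sum[where f = "\<lambda>m. \<Sum>l<D. nat \<bar>c m l\<bar>"]) auto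
      finally show ?thesis by simp
    qed
    thus ?thesis using that by blast
  qed
  have eval: "int n dvd (\<Sum>l<D. M f $$ (i, l) * int w ^ l)"
    if f: "int n dvd (\<Sum>k<D. f k * int w ^ k)" and w: "int n dvd poly u (int w)" and i: "i < D" for f n w i
  proof -
    have rm: "int n dvd int w ^ m - (\<Sum>l<D. c m l * int w ^ l)" for m
    proof -
      have "poly u (int w) dvd poly (monom 1 m - r m) (int w)" using r(2)[of m] by (metis dvd_def poly_mult)
      also have "poly (monom 1 m - r m) (int w) = int w ^ m - (\<Sum>l<D. c m l * int w ^ l)"
        unfolding c_def poly_eq_sum_less[OF r(1), symmetric] by (simp add: poly_monom)
      finally show ?thesis using w by (rule dvd_trans[rotated])
    qed
    have "(\<Sum>l<D. M f $$ (i, l) * int w ^ l) = (\<Sum>l<D. \<Sum>k<D. f k * (c (i + k) l * int w ^ l))"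
      using i by (simp add: M_def sum_distrib_right mult.assoc)
    also have "\<dots> = (\<Sum>k<D. f k * (\<Sum>l<D. c (i + k) l * int w ^ l))"
      unfolding sum_distrib_left by (rule sum.swap)
    also have "\<dots> = int w ^ i * (\<Sum>k<D. f k * int w ^ k) - (\<Sum>k<D. f k * (int w ^ (i + k) - (\<Sum>l<D. c (i + k) l * int w ^ l)))"
      by (simp add: sum_distrib_left sum_subtractf right_diff_distrib power_add mult_ac)
    also have "int n dvd \<dots>" by (rule dvd_diff[OF dvd_mult[OF f] dvd_sum[OF dvd_mult[OF rm]]])
    finally show ?thesis .
  qed
  \<comment> \<open>A kernel vector of the transpose is a nonzero element annihilated by f. Modulo
    an irreducible \<open>u\<close> there are no zero divisors, so none exists.\<close>
  have det0: "det (M f) \<noteq> 0" if f: "\<exists>k<D. f k \<noteq> 0" for f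
  proof
    assume "det (M f) = 0"
    hence "det (transpose_mat (M f)) = 0" using det_transpose[OF M] by simp
    then obtain v where v: "v \<in> carrier_vec D" "v \<noteq> 0\<^sub>v D" "transpose_mat (M f) *\<^sub>v v = 0\<^sub>v D"
      using det_0_iff_vec_prod_zero[of "transpose_mat (M f)" D] M by auto
    define \<alpha> where "\<alpha> = (\<Sum>k<D. monom (f k) k)"
    define \<beta> where "\<beta> = (\<Sum>i<D. monom (v $ i) i)"
    have ca: "coeff \<alpha> k = (if k < D then f k else 0)" for k by (simp add: \<alpha>_def coeff_sum)
    have cb: "coeff \<beta> k = (if k < D then v $ k else 0)" for k by (simp add: \<beta>_def coeff_sum)
    have a0: "\<alpha> \<noteq> 0" using f ca by (metis coeff_0)
    have b0: "\<beta> \<noteq> 0"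
    proof
      assume "\<beta> = 0"
      hence "v $ k = 0" if "k < D" for k using cb[of k] that by simp
      hence "v = 0\<^sub>v D" using v(1) by (intro eq_vecI) auto
      thus False using v(2) by simp
    qed
    have da: "degree \<alpha> < D" using D ca by (intro degree_lessI) auto
    have db: "degree \<beta> < D" using D cb by (intro degree_lessI) auto
    have "\<beta> * \<alpha> = (\<Sum>i<D. \<Sum>k<D. smult (v $ i * f k) (monom 1 (i + k)))"
      by (simp add: \<alpha>_def \<beta>_def sum_product mult_monom smult_monom)
    also have "\<dots> = (\<Sum>i<D. \<Sum>k<D. smult (v $ i * f k) (monom 1 (i + k) - r (i + k)))
         + (\<Sum>i<D. \<Sum>k<D. smult (v $ i * f k) (r (i + k)))"
      by (simp add: smult_diff_right sum_subtractf)
    also have "(\<Sum>i<D. \<Sum>k<D. smult (v $ i * f k) (r (i + k))) = 0"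
    proof (rule poly_eqI)
      fix l
      show "coeff (\<Sum>i<D. \<Sum>k<D. smult (v $ i * f k) (r (i + k))) l = coeff 0 l"
      proof (cases "l < D")
        case True
        have "0 = (transpose_mat (M f) *\<^sub>v v) $ l" using v(3) True by simp
        also have "\<dots> = (\<Sum>i<D. M f $$ (i, l) * v $ i)"
          using True M[of f] v(1) by (auto simp: scalar_prod_def lessThan_atLeast0 intro!: sum.cong)
        also have "\<dots> = (\<Sum>i<D. \<Sum>k<D. v $ i * f k * coeff (r (i + k)) l)"
          using True by (simp add: M_def c_def sum_distrib_left mult_ac)
        finally show ?thesis by (simp add: coeff_sum)
      next
        case False
        hence "coeff (r m) l = 0" for m using r(1)[of m] by (intro coeff_eq_0) simp
        thus ?thesis by (simp add: coeff_sum)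
      qed
    qed
    finally have "u dvd \<beta> * \<alpha>" using r(2) by (auto intro!: dvd_sum dvd_smult)
    hence "u dvd \<beta> \<or> u dvd \<alpha>" using irr by (simp add: prime_elem_dvd_mult_iff irreducible_imp_prime_elem_gcd)
    thus False using dvd_imp_degree_le[of u \<alpha>] dvd_imp_degree_le[of u \<beta>] a0 b0 da db D by auto
  qed
  \<comment> \<open>Norms satisfy 2N <= K X by the determinant bound with entries at most D b B, and
    X < 2n then bounds the quotient N/n by K.\<close>
  define K where "K = 2 * fact D * (D * b) ^ D"
  have bound: "card (root_pairs u X) \<le> 3 ^ D * Suc K ^ 2 * X" if X: "1 \<le> X" for X
  proof -
    obtain B where B: "B ^ D \<le> X" "X < Suc B ^ D"
    proof -
      define m where "m = (LEAST m. X < m ^ D)"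
      have "X < Suc X ^ D"
        using D self_le_power[of "Suc X" D] by simp
      hence m: "X < m ^ D" unfolding m_def by (rule LeastI)
      hence "m \<noteq> 0" using D by (metis not_less0 power_0_left gr0I not_numeral_le_zero)
      then obtain B where "m = Suc B" by (cases m) auto
      moreover have "\<not> X < B ^ D" using not_less_Least[of B "\<lambda>m. X < m ^ D"] \<open>m = Suc B\<close> m_def by auto
      ultimately show ?thesis using m that[of B] by simp
    qed
    have B1: "B \<ge> 1" using B X D by (cases B) auto
    define A where "A = {f \<in> {..<D} \<rightarrow>\<^sub>E {-int B..int B}. \<exists>k<D. f k \<noteq> 0}"
    define S where "S f = {(n, w). (n, w) \<in> root_pairs u X \<and> int n dvd (\<Sum>k<D. f k * int w ^ k)}" for f
    have fA: "finite A" unfolding A_def by (intro finite_subset[OF _ finite_PiE[of "{..<D}" "\<lambda>_. {-int B..int B}"]]) auto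
    have cA: "card A \<le> 3 ^ D * X"
    proof -
      have "card A \<le> card ({..<D} \<rightarrow>\<^sub>E {-int B..int B})" unfolding A_def by (intro card_mono finite_PiE) auto
      also have "\<dots> = (2 * B + 1) ^ D" by (subst card_PiE) (simp_all add: nat_add_distrib nat_mult_distrib)
      also have "\<dots> \<le> (3 * B) ^ D" using B1 by (intro power_mono) auto
      also have "\<dots> \<le> 3 ^ D * X" using B by (simp add: power_mult_distrib)
      finally show ?thesis .
    qed
    have "root_pairs u X \<subseteq> (\<Union>f\<in>A. S f)"
    proof
      fix z assume z: "z \<in> root_pairs u X"
      obtain n w where nw: "z = (n, w)" by force
      have n: "0 < n" "n < Suc B ^ D" using z B by (auto simp: nw root_pairs_def)
      from small_linear_relation[OF n, of "int w"] obtain f where "f \<in> A" "int n dvd (\<Sum>k<D. f k * int w ^ k)"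
        unfolding A_def by blast
      thus "z \<in> (\<Union>f\<in>A. S f)" using z by (auto simp: S_def nw)
    qed
    hence "card (root_pairs u X) \<le> card (\<Union>f\<in>A. S f)"
      using fA by (intro card_mono) (auto simp: S_def intro: finite_subset[OF _ finite_root_pairs[of u X]])
    also have "\<dots> \<le> (\<Sum>f\<in>A. card (S f))" by (rule card_UN_le[OF fA])
    also have "\<dots> \<le> (\<Sum>f\<in>A. Suc K ^ 2)"
    proof (rule sum_mono)
      fix f assume f: "f \<in> A"
      define N where "N = nat \<bar>det (M f)\<bar>"
      have N0: "N > 0" using det0[of f] f by (auto simp: N_def A_def)
      have dN: "n dvd N" if "(n, w) \<in> S f" for n w
      proof -
        have a: "int n dvd poly u (int w)" "int n dvd (\<Sum>k<D. f k * int w ^ k)"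
          using that by (simp_all add: S_def root_pairs_def)
        have "int n dvd det (M f)"
          by (rule linear_forms_dvd_det[OF M _ eval[OF a(2) a(1)]]) (use D in simp)
        thus ?thesis by (simp add: N_def dvd_abs_iff flip: int_dvd_int_iff)
      qed
      have "\<bar>det (M f)\<bar> \<le> fact D * (int D * (int B * int b)) ^ D"
      proof (rule det_abs_le[OF M])
        fix i l assume il: "i < D" "l < D"
        have "\<bar>M f $$ (i, l)\<bar> \<le> (\<Sum>k<D. \<bar>f k * c (i + k) l\<bar>)" using il by (simp add: M_def sum_abs)
        also have "\<dots> \<le> (\<Sum>k<D. int B * int b)"
        proof (rule sum_mono)
          fix k assume k: "k \<in> {..<D}"
          moreover have "f \<in> {..<D} \<rightarrow>\<^sub>E {-int B..int B}" using f by (simp add: A_def)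
          ultimately have "f k \<in> {-int B..int B}" by (rule PiE_mem[rotated])
          hence "\<bar>f k\<bar> \<le> int B" by auto
          moreover have "\<bar>c (i + k) l\<bar> \<le> int b" using il k by (intro b) auto
          ultimately show "\<bar>f k * c (i + k) l\<bar> \<le> int B * int b" unfolding abs_mult by (intro mult_mono) auto
        qed
        finally show "\<bar>M f $$ (i, l)\<bar> \<le> int D * (int B * int b)" by simp
      qed
      hence "int N \<le> int (fact D * (D * (B * b)) ^ D)" by (simp add: N_def)
      hence "N \<le> fact D * (D * (B * b)) ^ D" by (simp only: of_nat_le_iff)
      also have "\<dots> = fact D * (D * b) ^ D * B ^ D" by (simp add: power_mult_distrib mult_ac)
      also have "\<dots> \<le> fact D * (D * b) ^ D * X" using B by (intro mult_le_mono2)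
      finally have NX: "2 * N \<le> K * X" by (simp add: K_def)
      \<comment> \<open>For a fixed element and fixed n, two roots satisfy n | d (w' - w) with d =
        N/n. The residue of d w modulo n is thus the same for all roots, and the quotient d w div n
        <= d identifies w.\<close>
      define h where "h = (\<lambda>(n, w). (N div n, (N div n) * w div n))"
      have inj: "inj_on h (S f)"
      proof (rule inj_onI, safe)
        fix n w n' w' assume a: "(n, w) \<in> S f" "(n', w') \<in> S f" "h (n, w) = h (n', w')"
        have n0: "n > 0" using a(1) by (auto simp: S_def root_pairs_def)
        have "N div n = N div n'" using a(3) by (simp add: h_def)
        moreover have "N div n * n = N" "N div n' * n' = N" using dN[OF a(1)] dN[OF a(2)] by simp_all
        ultimately have "N div n * n = N div n * n'" "N div n \<noteq> 0" using N0 by (auto intro!: Nat.gr0I)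
        hence nn: "n = n'" by simp
        show "n = n'" by (rule nn)
        define d where "d = N div n"
        have dn: "d * n = N" using dN[OF a(1)] by (simp add: d_def)
        define s where "s = sgn (det (M f))"
        have absd: "\<bar>det (M f)\<bar> = int d * int n" using dn by (simp add: N_def flip: of_nat_mult)
        have "det (M f) = s * \<bar>det (M f)\<bar>" by (simp add: s_def sgn_mult_abs)
        hence s1: "det (M f) = s * int d * int n" by (simp only: absd mult.assoc)
        have "det (M f) \<noteq> 0" using det0[of f] f by (simp add: A_def)
        hence s2: "s = 1 \<or> s = -1" by (auto simp: s_def sgn_if)
        have a1: "int n dvd poly u (int w)" "int n dvd (\<Sum>k<D. f k * int w ^ k)"
          using a(1) by (simp_all add: S_def root_pairs_def)
        have a2: "int n dvd poly u (int w')" "int n dvd (\<Sum>k<D. f k * int w' ^ k)"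
          using a(2) nn by (simp_all add: S_def root_pairs_def)
        have "int n dvd (s * int d) * (int w' - int w)"
          by (rule two_roots_det_dvd[OF M D(2) _ s1 eval[OF a1(2,1)] eval[OF a2(2,1)]]) (use n0 in simp)
        hence "int n dvd int d * int w' - int d * int w"
          using s2 by (auto simp: right_diff_distrib dvd_diff_commute)
        moreover have "d * w div n = d * w' div n" using a(3) nn by (simp add: h_def d_def)
        hence "int d * int w div int n = int d * int w' div int n" by (metis of_nat_mult zdiv_int)
        ultimately have "int d * int w = int d * int w'"
          by (metis mod_eq_dvd_iff div_mult_mod_eq)
        moreover have "d > 0" using dn N0 by (cases d) auto
        ultimately show "w = w'" by simp
      qed
      have "h ` S f \<subseteq> {..K} \<times> {..K}"
      proof safe
        fix n w x y assume a: "(n, w) \<in> S f" "(x, y) = h (n, w)"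
        have n: "X < 2 * n" "w < n" using a(1) by (auto simp: S_def root_pairs_def)
        define d where "d = N div n"
        have "d * n = N" using dN[OF a(1)] by (simp add: d_def)
        hence "d * (2 * n) \<le> K * X" using NX by simp
        also have "\<dots> \<le> K * (2 * n)" using n by (intro mult_le_mono2) simp
        finally have dK: "d \<le> K" using n by simp
        thus "x \<le> K" using a(2) by (simp add: h_def d_def)
        have "d * w div n \<le> d * n div n" using n by (intro div_le_mono mult_le_mono2) simp
        thus "y \<le> K" using a(2) dK n by (simp add: h_def d_def)
      qed
      hence "card (h ` S f) \<le> card ({..K} \<times> {..K})" by (intro card_mono) auto
      thus "card (S f) \<le> Suc K ^ 2" using card_image[OF inj] by (simp add: power2_eq_square)
    qed
    also have "\<dots> \<le> 3 ^ D * Suc K ^ 2 * X" using mult_le_mono1[OF cA, of "Suc K ^ 2"] by (simp add: mult_ac)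
    finally show ?thesis .
  qed
  thus ?thesis by blast
qed

section \<open>Binary forms\<close>

definition hform :: "int poly \<Rightarrow> int \<Rightarrow> int \<Rightarrow> int" where
  "hform p x y = (\<Sum>k\<le>degree p. coeff p k * x ^ k * y ^ (degree p - k))"

lemma hform_cong_args:
  assumes "[x = x'] (mod n)" "[y = y'] (mod n)"
  shows "[hform p x y = hform p x' y'] (mod n)"
  unfolding hform_def using assms by (intro cong_sum cong_mult cong_pow cong_refl)

lemma hform_scale: "hform p (s * y) y = y ^ degree p * poly p s"
proof -
  have "hform p (s * y) y = (\<Sum>k\<le>degree p. y ^ degree p * (coeff p k * s ^ k))"
    unfolding hform_def
  proof (rule sum.cong[OF refl])
    fix k assume "k \<in> {..degree p}"
    hence "y ^ degree p = y ^ k * y ^ (degree p - k)" by (simp flip: power_add)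
    thus "coeff p k * (s * y) ^ k * y ^ (degree p - k) = y ^ degree p * (coeff p k * s ^ k)"
      by (simp add: power_mult_distrib)
  qed
  thus ?thesis by (simp add: poly_altdef sum_distrib_left)
qed

lemma hform_cong_root:
  assumes "[x = s * y] (mod n)"
  shows "[hform p x y = y ^ degree p * poly p s] (mod n)"
  using hform_cong_args[OF assms cong_refl, of p y] by (simp add: hform_scale)

lemma hform_rat:
  assumes "y \<noteq> 0"
  shows "rat_of_int (hform p x y) = of_int y ^ degree p * poly (rat_poly_of p) (of_int x / of_int y)"
proof -
  have "rat_of_int (hform p x y) = (\<Sum>k\<le>degree p. of_int (coeff p k) * of_int x ^ k * of_int y ^ (degree p - k))"
    by (simp add: hform_def)
  also have "\<dots> = (\<Sum>k\<le>degree p. of_int y ^ degree p * (of_int (coeff p k) * (of_int x / of_int y) ^ k))"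
  proof (rule sum.cong[OF refl])
    fix k assume "k \<in> {..degree p}"
    hence "rat_of_int y ^ degree p = of_int y ^ k * of_int y ^ (degree p - k)" by (simp flip: power_add)
    thus "rat_of_int (coeff p k) * of_int x ^ k * of_int y ^ (degree p - k) =
      of_int y ^ degree p * (of_int (coeff p k) * (of_int x / of_int y) ^ k)"
      using assms by (simp add: power_divide)
  qed
  finally show ?thesis by (simp add: poly_altdef sum_distrib_left)
qed

lemma hform_mult:
  assumes "y \<noteq> 0" "p \<noteq> 0" "q \<noteq> 0"
  shows "hform (p * q) x y = hform p x y * hform q x y"
proof -
  have "rat_of_int (hform (p * q) x y) = rat_of_int (hform p x y * hform q x y)"
    using assms by (simp add: hform_rat degree_mult_eq power_add of_int_poly_hom.hom_mult)
  thus ?thesis by (simp only: of_int_eq_iff)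
qed

lemma hform_abs_bound: "\<exists>C. \<forall>N x y. \<bar>x\<bar> \<le> int N \<longrightarrow> \<bar>y\<bar> \<le> int N \<longrightarrow> \<bar>hform p x y\<bar> \<le> int C * int N ^ degree p"
proof (intro exI allI impI)
  fix N x y assume xy: "\<bar>x\<bar> \<le> int N" "\<bar>y\<bar> \<le> int N"
  have "\<bar>hform p x y\<bar> \<le> (\<Sum>k\<le>degree p. \<bar>coeff p k * x ^ k * y ^ (degree p - k)\<bar>)"
    unfolding hform_def by (rule sum_abs)
  also have "\<dots> \<le> (\<Sum>k\<le>degree p. \<bar>coeff p k\<bar> * int N ^ degree p)"
  proof (rule sum_mono)
    fix k assume "k \<in> {..degree p}"
    hence N: "int N ^ degree p = int N ^ k * int N ^ (degree p - k)" by (simp flip: power_add)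
    have "\<bar>x\<bar> ^ k \<le> int N ^ k" "\<bar>y\<bar> ^ (degree p - k) \<le> int N ^ (degree p - k)"
      using xy by (auto intro: power_mono)
    thus "\<bar>coeff p k * x ^ k * y ^ (degree p - k)\<bar> \<le> \<bar>coeff p k\<bar> * int N ^ degree p"
      unfolding N abs_mult power_abs mult.assoc by (intro mult_left_mono mult_mono) auto
  qed
  also have "\<dots> = int (\<Sum>k\<le>degree p. nat \<bar>coeff p k\<bar>) * int N ^ degree p"
    by (simp add: sum_distrib_right)
  finally show "\<bar>hform p x y\<bar> \<le> int (\<Sum>k\<le>degree p. nat \<bar>coeff p k\<bar>) * int N ^ degree p" .
qed

lemma hform_mod_second:
  assumes "lead_coeff p = 1"
  shows "[hform p x y = x ^ degree p] (mod y)"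
proof -
  have "hform p x y = (\<Sum>k<degree p. coeff p k * x ^ k * y ^ (degree p - k)) + x ^ degree p"
    unfolding hform_def using assms by (simp add: lessThan_Suc_atMost[symmetric])
  moreover have "y dvd (\<Sum>k<degree p. coeff p k * x ^ k * y ^ (degree p - k))"
    by (rule dvd_sum, rule dvd_mult, rule dvd_power) auto
  ultimately show ?thesis by (simp add: cong_iff_dvd_diff)
qed

lemma prime_dvd_hform_snd:
  assumes "lead_coeff p = 1" "prime q" "q dvd hform p x y" "q dvd y"
  shows "q dvd (x :: int)"
proof -
  have "[hform p x y = x ^ degree p] (mod q)"
    using hform_mod_second[OF assms(1)] assms(4) by (rule cong_dvd_modulus)
  hence "q dvd x ^ degree p" using assms(3) cong_dvd_iff by blast
  thus ?thesis using assms(2) prime_dvd_power by blast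
qed

lemma prime_dvd_hform_not_dvd_snd:
  fixes q :: int
  assumes "lead_coeff p = 1" "prime q" "q dvd hform p x y" "\<not> (q dvd x \<and> q dvd y)"
  shows "\<not> q dvd y"
  using prime_dvd_hform_snd[OF assms(1-3)] assms(4) by blast

section \<open>Sieving a line by quadratic residues\<close>

text \<open>A polynomial without root at x is coprime to X - x. After cancelling the linear powers
  it would have to divide the constant c, which its degree forbids.\<close>

lemma not_dvdm_linear_power:
  assumes p: "prime p" and P: "lead_coeff P = 1" "degree P \<ge> 1" and x: "\<not> int p dvd poly P x" and c: "\<not> int p dvd c"
  shows "\<not> dvdm p P (smult c ([:-x,1:] ^ N))"
proof
  define L where "L = [:-x,1::int:] ^ N"
  assume "dvdm p P (smult c ([:-x,1:] ^ N))"
  then obtain C where C: "[:int p:] dvd smult c L - P * C" by (auto simp: dvdm_def L_def)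
  have "[:int p:] dvd P * C - L * [:c:]" using C by (subst dvd_minus_iff[symmetric]) simp
  hence "dvdm p L (P * C)" unfolding dvdm_def by blast
  hence "dvdm p L C" unfolding L_def by (rule linear_power_dvdm_cancel[OF p x])
  then obtain C' where C': "[:int p:] dvd C - L * C'" by (auto simp: dvdm_def)
  have "L * ([:c:] - P * C') = (smult c L - P * C) + P * (C - L * C')" by (simp add: algebra_simps)
  hence "[:int p:] dvd L * ([:c:] - P * C')" using C C' by (metis dvd_add dvd_mult)
  moreover have "\<not> [:int p:] dvd L" unfolding L_def
    by (rule monic_not_pconst_dvd[OF p]) (simp add: degree_linear_power lead_coeff_power)
  ultimately have "[:int p:] dvd [:c:] - P * C'" using pconst_dvd_multD[OF p] by blast
  hence "dvdm p P [:c:]" by (auto simp: dvdm_def)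
  hence "[:int p:] dvd [:c:]" using P by (intro dvdm_degree_less) auto
  thus False using c by simp
qed

text \<open>A separable polynomial of degree at least two has two distinct roots over an algebraic
  closure, whereas a power of one linear form has at most one. The proof stays over F_p: if the root
  of the linear form is a root of u, it is simple and is divided out, leaving a nonconstant factor
  that does not vanish there.\<close>

lemma separable_not_dvdm_linear_power:
  fixes u A B :: "int poly"
  assumes p: "prime p" and u: "lead_coeff u = 1" "2 \<le> degree u"
    and bez: "A * u + B * pderiv u = [:R:]" and R: "\<not> int p dvd R"
    and ab: "\<not> (int p dvd a \<and> int p dvd b)" and c: "\<not> int p dvd c"
  shows "\<not> dvdm p u (smult c ([:a,-b:] ^ N))"
proof
  assume d: "dvdm p u (smult c ([:a,-b:] ^ N))"
  have pi: "prime (int p)" using p by simp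
  show False
  proof (cases "int p dvd b")
    case True
    hence na: "\<not> int p dvd a" using ab by blast
    obtain b' where b': "b = int p * b'" using True by (auto simp: dvd_def)
    have "[:a,-b:] = [:a:] * 1 + [:int p:] * [:0,-b':]" by (simp add: b')
    define Q where "Q = smult c ([:a,-b:] ^ N)"
    obtain C where C: "[:int p:] dvd Q - u * C" using d by (auto simp: dvdm_def Q_def)
    have "\<exists>E. [:a,-b:] ^ n = [:a ^ n:] + [:int p:] * E" for n
    proof (induction n)
      case (Suc n)
      then obtain E where E: "[:a,-b:] ^ n = [:a ^ n:] + [:int p:] * E" by blast
      have "[:a,-b:] ^ Suc n = [:a,-b:] * ([:a ^ n:] + [:int p:] * E)" by (simp only: power_Suc E)
      also have "\<dots> = [:a ^ Suc n:] + [:int p:] * ([:0, - b' * a ^ n:] + [:a,-b:] * E)"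
        by (simp add: b' algebra_simps)
      finally show ?case by blast
    qed (rule exI[of _ 0], simp)
    then obtain E where E: "[:a,-b:] ^ N = [:a ^ N:] + [:int p:] * E" by blast
    have "[:c * a ^ N:] - u * C = (Q - u * C) - [:int p:] * smult c E"
      unfolding Q_def E by (simp add: smult_add_right mult.commute)
    also have "[:int p:] dvd \<dots>" using C by (rule dvd_diff[OF _ dvd_triv_left])
    finally have "dvdm p u [:c * a ^ N:]" by (auto simp: dvdm_def)
    hence "[:int p:] dvd [:c * a ^ N:]" using u by (intro dvdm_degree_less) auto
    hence "int p dvd c * a ^ N" by simp
    thus False using c na pi by (metis prime_dvd_mult_iff prime_dvd_power)
  next
    case False
    hence "coprime b (int p)" using pi by (metis prime_imp_coprime coprime_commute)
    then obtain v where v: "[b * v = 1] (mod int p)" using cong_solve_coprime_int by blast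
    define s where "s = a * v"
    have "[b * v * a = 1 * a] (mod int p)" using v by (rule cong_scalar_right)
    hence "int p dvd b * s - a" by (simp add: s_def cong_iff_dvd_diff mult_ac)
    then obtain t where t: "b * s - a = int p * t" by (auto simp: dvd_def)
    define L where "L = [:-s,1::int:]"
    have Leq: "[:a,-b:] = [:-b:] * L - [:int p:] * [:t:]" using t by (simp add: L_def algebra_simps)
    have "\<exists>E. [:a,-b:] ^ n = smult ((-b) ^ n) (L ^ n) + [:int p:] * E" for n
    proof (induction n)
      case (Suc n)
      then obtain E where E: "[:a,-b:] ^ n = smult ((-b) ^ n) (L ^ n) + [:int p:] * E" by blast
      have "[:a,-b:] ^ Suc n = ([:-b:] * L - [:int p:] * [:t:]) * (smult ((-b) ^ n) (L ^ n) + [:int p:] * E)"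
        unfolding power_Suc E by (simp only: Leq)
      also have "\<dots> = smult ((-b) ^ Suc n) (L ^ Suc n) +
          [:int p:] * ([:-b:] * L * E - [:t:] * (smult ((-b) ^ n) (L ^ n) + [:int p:] * E))"
        by (simp add: algebra_simps smult_add_right smult_diff_right)
      finally show ?case by blast
    qed (auto intro: exI[of _ 0])
    then obtain E where E: "[:a,-b:] ^ N = smult ((-b) ^ N) (L ^ N) + [:int p:] * E" by blast
    define c' where "c' = c * (-b) ^ N"
    have c': "\<not> int p dvd c'" unfolding c'_def using c False pi
      by (metis prime_dvd_mult_iff prime_dvd_power dvd_minus_iff)
    obtain C where C: "[:int p:] dvd smult c ([:a,-b:] ^ N) - u * C" using d by (auto simp: dvdm_def)
    have "smult c' (L ^ N) - u * C = (smult c ([:a,-b:] ^ N) - u * C) - [:int p:] * smult c E"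
      unfolding E c'_def by (simp add: smult_add_right mult.commute)
    hence C2: "[:int p:] dvd smult c' (L ^ N) - u * C" using C by (metis dvd_diff dvd_triv_left)
    show False
    proof (cases "int p dvd poly u s")
      case False
      have "\<not> dvdm p u (smult c' ([:-s,1:] ^ N))"
        by (rule not_dvdm_linear_power[OF p u(1) _ False c']) (use u in simp)
      thus False using C2 by (auto simp: dvdm_def L_def)
    next
      case True
      define u1 where "u1 = synthetic_div u s"
      have ueq: "u = L * u1 + [:poly u s:]" using synthetic_div_correct'[of s u] by (simp only: u1_def L_def)
      obtain r where r: "poly u s = int p * r" using True by (auto simp: dvd_def)
      have du1: "degree u1 = degree u - 1" unfolding u1_def by (rule degree_synthetic_div)
      have lc1: "lead_coeff u1 = 1"
      proof -
        have u1n: "u1 \<noteq> 0" using du1 u by auto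
        have "degree (L * u1) = 1 + degree u1" using u1n by (subst degree_mult_eq) (auto simp: L_def)
        hence "degree [:poly u s:] < degree (L * u1)" by simp
        hence "lead_coeff u = lead_coeff (L * u1)" unfolding ueq[symmetric]
          using lead_coeff_add_le[of "[:poly u s:]" "L * u1"] ueq by (simp add: add.commute)
        hence "lead_coeff u = lead_coeff L * lead_coeff u1" by (simp only: lead_coeff_mult)
        thus ?thesis using u(1) by (simp add: L_def)
      qed
      have "pderiv L = 1" by (simp add: L_def pderiv_pCons)
      hence "pderiv u = u1 + L * pderiv u1"
        by (subst ueq) (simp add: pderiv_add pderiv_mult pderiv_pCons)
      hence "poly (pderiv u) s = poly u1 s" by (simp add: L_def)
      moreover have "poly A s * poly u s + poly B s * poly (pderiv u) s = R"
        using arg_cong[OF bez, of "\<lambda>q. poly q s"] by simp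
      ultimately have "poly A s * poly u s + poly B s * poly u1 s = R" by simp
      hence nu1: "\<not> int p dvd poly u1 s" using R True by (metis dvd_add dvd_mult)
      have "\<not> dvdm p u1 (smult c' ([:-s,1:] ^ N))"
        by (rule not_dvdm_linear_power[OF p lc1 _ nu1 c']) (use u du1 in simp)
      moreover have "smult c' (L ^ N) - u1 * (L * C) = (smult c' (L ^ N) - u * C) + [:int p:] * ([:r:] * C)"
        by (subst ueq) (simp add: r algebra_simps)
      hence "[:int p:] dvd smult c' (L ^ N) - u1 * (L * C)" using C2 by (metis dvd_add dvd_triv_left)
      ultimately show False by (auto simp: dvdm_def L_def)
    qed
  qed
qed

text \<open>This is the nondegeneracy hypothesis of Stepanov's method for w = Lambda^D u with a
  linear form Lambda. The Bezout identity gives B w' = R Lambda modulo u, so w | w'^K would force u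
  | R^K Lambda^(DK) modulo p. The case D = 0 covers u itself.\<close>

lemma twisted_not_dvdm_pderiv_power:
  fixes u A B :: "int poly"
  assumes p: "prime p" and u: "lead_coeff u = 1" "2 \<le> degree u"
    and bez: "A * u + B * pderiv u = [:R:]" and R: "\<not> int p dvd R"
    and ab: "\<not> (int p dvd a \<and> int p dvd b)"
  shows "\<not> dvdm p ([:a,-b:] ^ D * u) (pderiv ([:a,-b:] ^ D * u) ^ K)"
proof
  define \<Lambda> where "\<Lambda> = [:a,-b:] ^ D"
  assume "dvdm p ([:a,-b:] ^ D * u) (pderiv ([:a,-b:] ^ D * u) ^ K)"
  then obtain C where C: "[:int p:] dvd pderiv (\<Lambda> * u) ^ K - (\<Lambda> * u) * C" by (auto simp: dvdm_def \<Lambda>_def)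
  have pi: "prime (int p)" using p by simp
  have "u dvd B * pderiv (\<Lambda> * u) - [:R:] * \<Lambda>"
  proof -
    have "B * pderiv (\<Lambda> * u) - [:R:] * \<Lambda> = u * (B * pderiv \<Lambda> - \<Lambda> * A)"
      unfolding bez[symmetric] by (simp add: pderiv_mult algebra_simps)
    thus ?thesis by simp
  qed
  hence "u dvd (B * pderiv (\<Lambda> * u)) ^ K - ([:R:] * \<Lambda>) ^ K"
    by (rule dvd_trans) (simp add: power_diff_sumr2)
  then obtain F where F: "(B * pderiv (\<Lambda> * u)) ^ K - ([:R:] * \<Lambda>) ^ K = u * F" by (auto simp: dvd_def)
  have "([:R:] * \<Lambda>) ^ K - u * (B ^ K * \<Lambda> * C - F) = B ^ K * (pderiv (\<Lambda> * u) ^ K - (\<Lambda> * u) * C)"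
    using F by (simp add: power_mult_distrib algebra_simps)
  moreover have "([:R:] * \<Lambda>) ^ K = smult (R ^ K) ([:a,-b:] ^ (D * K))"
  proof -
    have "[:R:] ^ K = [:R ^ K:]" by (rule poly_const_pow)
    thus ?thesis by (simp add: power_mult_distrib \<Lambda>_def power_mult smult_power)
  qed
  ultimately have "[:int p:] dvd smult (R ^ K) ([:a,-b:] ^ (D * K)) - u * (B ^ K * \<Lambda> * C - F)"
    using C by (metis dvd_mult)
  hence "dvdm p u (smult (R ^ K) ([:a,-b:] ^ (D * K)))" by (auto simp: dvdm_def)
  moreover have "\<not> int p dvd R ^ K" using R pi prime_dvd_power by blast
  ultimately show False using separable_not_dvdm_linear_power[OF p u bez R ab] by blast
qed

lemma fermat_half_power:
  fixes z :: int
  assumes p: "prime p" "p > 2" and z: "\<not> int p dvd z"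
  shows "[z ^ (2 * ((p - 1) div 2)) = 1] (mod int p)"
    "[z ^ ((p - 1) div 2) = 1] (mod int p) \<or> [z ^ ((p - 1) div 2) = -1] (mod int p)"
proof -
  have pi: "prime (int p)" using p by simp
  have odd: "2 * ((p - 1) div 2) = p - 1" using prime_odd_nat[OF p(1)] p(2) by auto
  have "[z ^ (p - 1) = 1] (mod int p)"
  proof -
    have "coprime z (int p)" using z pi by (metis prime_imp_coprime coprime_commute)
    moreover have "totient p = p - 1" using p by (simp add: totient_prime)
    moreover have "residues (int p)" using p by unfold_locales auto
    ultimately show ?thesis using residues.euler_theorem[of "int p" z] by simp
  qed
  thus 1: "[z ^ (2 * ((p - 1) div 2)) = 1] (mod int p)" by (simp only: odd)
  have "int p dvd (z ^ ((p - 1) div 2) - 1) * (z ^ ((p - 1) div 2) + 1)"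
  proof -
    have "(z ^ ((p - 1) div 2) - 1) * (z ^ ((p - 1) div 2) + 1) = z ^ (2 * ((p - 1) div 2)) - 1"
      by (simp add: power_mult power2_eq_square power_mult_distrib algebra_simps mult_2 power_add del: odd)
    thus ?thesis using 1 by (simp add: cong_iff_dvd_diff)
  qed
  thus "[z ^ ((p - 1) div 2) = 1] (mod int p) \<or> [z ^ ((p - 1) div 2) = -1] (mod int p)"
    using pi by (simp add: prime_dvd_mult_iff cong_iff_dvd_diff)
qed

text \<open>The ratio s = x/y is a coordinate on the line, and (a - b s) y = m modulo l. Multiplying
  e U(x,y) by the square (a - b s)^(2D) turns it into e m^D w(s) with w = (a - b s)^D u(s), a
  polynomial in s to which Stepanov's method applies.\<close>

lemma line_nonresidues:
  fixes u A B :: "int poly"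
  assumes l: "prime l" and u: "lead_coeff u = 1" "2 \<le> degree u"
    and bez: "A * u + B * pderiv u = [:R:]" and R: "\<not> int l dvd R"
    and K: "K = Suc (2 * degree u)" and large: "8 * K * K < l"
    and det: "a * y1 - b * x1 = m" and m: "\<not> int l dvd m" and e: "\<not> int l dvd e"
  shows "l \<le> 4 * K * card {i\<in>{0..<int l}. [(e * hform u (x1 + i * a) (y1 + i * b)) ^ ((l - 1) div 2) = -1] (mod int l)}"
proof -
  define h where "h = (l - 1) div 2"
  define D where "D = degree u"
  define w where "w = [:a,-b:] ^ D * u"
  \<comment> \<open>This is the quadratic character of the constant e m^D, so the form is a
    nonresidue exactly when w(s) has character -\<kappa>. Stepanov's bound is therefore applied to
    the opposite value \<kappa>.\<close>
  define \<kappa> where "\<kappa> = (e * m ^ D) ^ h"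
  have li: "prime (int l)" using l by simp
  have l2: "l > 2" using large u K by simp
  have ab: "\<not> (int l dvd a \<and> int l dvd b)" using m det by (metis dvd_diff dvd_mult2)
  have wnd: "\<not> dvdm l w (pderiv w ^ K)" unfolding w_def
    by (rule twisted_not_dvdm_pderiv_power[OF l u bez R ab])
  have degw: "degree w \<le> 2 * D"
  proof -
    have "degree w \<le> D * 1 + D" unfolding w_def D_def
      by (intro order_trans[OF degree_mult_le] add_mono order_trans[OF degree_power_le]) (auto simp: mult.commute)
    thus ?thesis by simp
  qed
  have npw: "\<not> [:int l:] dvd w"
  proof
    assume "[:int l:] dvd w"
    then obtain g1 where "w = [:int l:] * g1" by (auto simp: dvd_def)
    hence "pderiv w = [:int l:] * pderiv g1" by (simp add: pderiv_smult)
    hence "[:int l:] dvd pderiv w" by (metis dvd_triv_left)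
    moreover have "pderiv w dvd pderiv w ^ K" using K by (intro dvd_power) auto
    ultimately have "[:int l:] dvd pderiv w ^ K - w * 0" by (auto intro: dvd_trans)
    thus False using wnd unfolding dvdm_def by blast
  qed
  have nem: "\<not> int l dvd e * m ^ D" using e m li by (metis prime_dvd_mult_iff prime_dvd_power)
  have \<kappa>: "\<not> int l dvd \<kappa>" "[\<kappa> = 1] (mod int l) \<or> [\<kappa> = -1] (mod int l)"
    using nem prime_dvd_power[OF li] fermat_half_power(2)[OF l l2 nem] unfolding \<kappa>_def h_def by blast+
  have \<kappa>2: "[\<kappa> * \<kappa> = 1] (mod int l)"
    using fermat_half_power(1)[OF l l2 nem] by (simp add: \<kappa>_def h_def mult_2 power_add)
  define S1 where "S1 = {s\<in>{0..<int l}. [poly w s ^ h = \<kappa>] (mod int l)}"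
  define S2 where "S2 = {s\<in>{0..<int l}. int l dvd poly w s}"
  define S where "S = {s\<in>{0..<int l}. [poly w s ^ h = - \<kappa>] (mod int l)}"
  define I where "I = {i\<in>{0..<int l}. [(e * hform u (x1 + i * a) (y1 + i * b)) ^ h = -1] (mod int l)}"
  have c1: "card S1 * (2 * K) \<le> l * (2 * K - 1)" unfolding S1_def
  proof (rule stepanov_power_residues[OF l degw _ _ _ _ \<kappa>(1) wnd])
    show "K = Suc (2 * D)" by (simp add: K D_def)
    show "2 * K * K < l" using large by simp
    show "1 \<le> h" "2 * h < l" using l2 by (auto simp: h_def)
  qed
  have c2: "card S2 \<le> 2 * D" unfolding S2_def using roots_mod_prime_le_degree[OF l npw] degw by linarith
  have "{0..<int l} \<subseteq> S1 \<union> S2 \<union> S"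
  proof
    fix s assume s: "s \<in> {0..<int l}"
    show "s \<in> S1 \<union> S2 \<union> S"
    proof (cases "int l dvd poly w s")
      case False
      have c: "[\<kappa> = 1] (mod int l) \<or> [\<kappa> = -1] (mod int l)" by (rule \<kappa>(2))
      have d: "[poly w s ^ h = 1] (mod int l) \<or> [poly w s ^ h = -1] (mod int l)"
        unfolding h_def by (rule fermat_half_power(2)[OF l l2 False])
      have "[poly w s ^ h = \<kappa>] (mod int l) \<or> [poly w s ^ h = - \<kappa>] (mod int l)"
        using c d by (auto simp: cong_iff_dvd_diff) (smt (verit) dvd_add dvd_diff)+
      thus ?thesis using s by (auto simp: S1_def S_def)
    qed (use s in \<open>simp add: S2_def\<close>)
  qed
  moreover have fin: "finite S1" "finite S2" "finite S" "finite I" unfolding S1_def S2_def S_def I_def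
    by (rule finite_Collect_conjI, simp)+
  ultimately have "card {0..<int l} \<le> card (S1 \<union> S2 \<union> S)" by (intro card_mono) auto
  also have "\<dots> \<le> card S1 + card S2 + card S"
    by (intro order_trans[OF card_Un_le] add_mono card_Un_le order_refl)
  finally have "l \<le> card S1 + 2 * D + card S" using c2 by simp
  hence "4 * K * l \<le> 2 * (card S1 * (2 * K)) + 8 * K * D + 4 * K * card S"
    using mult_le_mono2[of l "card S1 + 2 * D + card S" "4 * K"] by (simp add: algebra_simps)
  also have "\<dots> \<le> 2 * (l * (2 * K - 1)) + 8 * K * D + 4 * K * card S"
    by (intro add_right_mono mult_le_mono2 c1)
  finally have "4 * K * l \<le> 2 * (l * (2 * K - 1)) + 8 * K * D + 4 * K * card S" .
  moreover have "2 * (l * (2 * K - 1)) + 2 * l = 4 * K * l"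
  proof -
    obtain K' where "K = Suc K'" using K by blast
    thus ?thesis by (simp add: algebra_simps)
  qed
  \<comment> \<open>Stepanov leaves at least l/(2K) - 2D parameters; the 2D possible roots of w cost
    at most half of this.\<close>
  moreover have "8 * K * D \<le> l"
  proof -
    have "D \<le> K" using K by (simp add: D_def)
    hence "8 * K * D \<le> 8 * K * K" by (rule mult_le_mono2)
    thus ?thesis using large by linarith
  qed
  ultimately have lS: "l \<le> 4 * K * card S" by linarith
  have "card S \<le> card I"
  proof -
    have "\<exists>v. [(a - b * s) * v = 1] (mod int l)" if "s \<in> S" for s
    proof -
      have "\<not> int l dvd a - b * s"
      proof
        assume d: "int l dvd a - b * s"
        have "poly w s = (a - b * s) ^ D * poly u s" by (simp add: w_def poly_power mult.commute)
        moreover have "int l dvd (a - b * s) ^ D" using d u by (auto simp: D_def intro: dvd_trans[OF _ dvd_power])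
        ultimately have "int l dvd poly w s" by simp
        moreover have "h > 0" using l2 by (simp add: h_def)
        ultimately have "int l dvd poly w s ^ h" by (auto intro: dvd_trans[OF _ dvd_power])
        moreover have "[poly w s ^ h = - \<kappa>] (mod int l)" using that by (simp add: S_def)
        ultimately have "int l dvd - \<kappa>" by (meson cong_dvd_iff)
        thus False using \<kappa>(1) by simp
      qed
      hence "coprime (a - b * s) (int l)" using li by (metis prime_imp_coprime coprime_commute)
      thus ?thesis by (rule cong_solve_coprime_int)
    qed
    then obtain v where v: "\<And>s. s \<in> S \<Longrightarrow> [(a - b * s) * v s = 1] (mod int l)" by metis
    \<comment> \<open>This solves (x1 + i a) = s (y1 + i b) for i; the denominator is a unit because
      w(s) is nonzero.\<close>
    define f where "f s = ((s * y1 - x1) * v s) mod int l" for s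
    have main: "[x1 + f s * a = s * (y1 + f s * b)] (mod int l) \<and> [(a - b * s) * (y1 + f s * b) = m] (mod int l)"
      if s: "s \<in> S" for s
    proof -
      have fs: "[f s = (s * y1 - x1) * v s] (mod int l)" by (simp add: f_def)
      have "[(a - b * s) * f s = (a - b * s) * ((s * y1 - x1) * v s)] (mod int l)"
        using fs by (rule cong_scalar_left)
      moreover have "[(s * y1 - x1) * ((a - b * s) * v s) = (s * y1 - x1) * 1] (mod int l)"
        using v[OF s] by (rule cong_scalar_left)
      hence "[(a - b * s) * ((s * y1 - x1) * v s) = s * y1 - x1] (mod int l)" by (simp add: mult_ac)
      ultimately have lf: "[(a - b * s) * f s = s * y1 - x1] (mod int l)" by (rule cong_trans)
      have "[b * ((a - b * s) * f s) + (a - b * s) * y1 = b * (s * y1 - x1) + (a - b * s) * y1] (mod int l)"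
        by (intro cong_add cong_scalar_left lf cong_refl)
      hence 2: "[(a - b * s) * (y1 + f s * b) = m] (mod int l)" using det by (simp add: algebra_simps)
      have "[(a - b * s) * f s + (x1 - s * y1) = (s * y1 - x1) + (x1 - s * y1)] (mod int l)"
        by (intro cong_add lf cong_refl)
      hence 1: "[x1 + f s * a = s * (y1 + f s * b)] (mod int l)" by (simp add: cong_iff_dvd_diff algebra_simps)
      show ?thesis using 1 2 by blast
    qed
    have "f ` S \<subseteq> I"
    proof safe
      fix s assume s: "s \<in> S"
      define Y where "Y = y1 + f s * b"
      define H where "H = hform u (x1 + f s * a) (y1 + f s * b)"
      define \<mu> where "\<mu> = a - b * s"
      have H: "[H = Y ^ D * poly u s] (mod int l)" unfolding H_def Y_def D_def
        using main[OF s] by (intro hform_cong_root) blast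
      have lY: "[\<mu> * Y = m] (mod int l)" using main[OF s] by (simp add: \<mu>_def Y_def)
      have "[(\<mu> ^ D) ^ 2 * (e * H) = (\<mu> ^ D) ^ 2 * (e * (Y ^ D * poly u s))] (mod int l)"
        by (intro cong_scalar_left H)
      also have "(\<mu> ^ D) ^ 2 * (e * (Y ^ D * poly u s)) = e * (\<mu> * Y) ^ D * (\<mu> ^ D * poly u s)"
        by (simp add: power2_eq_square power_mult_distrib mult_ac)
      also have "[e * (\<mu> * Y) ^ D * (\<mu> ^ D * poly u s) = e * m ^ D * (\<mu> ^ D * poly u s)] (mod int l)"
        by (intro cong_mult cong_pow lY cong_refl)
      also have "\<mu> ^ D * poly u s = poly w s" by (simp add: w_def poly_power \<mu>_def mult.commute)
      finally have "[((\<mu> ^ D) ^ 2 * (e * H)) ^ h = (e * m ^ D * poly w s) ^ h] (mod int l)" by (rule cong_pow)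
      hence A1: "[(\<mu> ^ D) ^ (2 * h) * (e * H) ^ h = \<kappa> * poly w s ^ h] (mod int l)"
        by (simp add: power_mult_distrib \<kappa>_def power_mult)
      have "\<not> int l dvd \<mu>" using v[OF s] li by (metis \<mu>_def cong_dvd_iff dvd_mult2 not_prime_unit)
      hence "\<not> int l dvd \<mu> ^ D" using li prime_dvd_power by blast
      hence "[(\<mu> ^ D) ^ (2 * h) = 1] (mod int l)" unfolding h_def by (rule fermat_half_power(1)[OF l l2])
      hence A2: "[(\<mu> ^ D) ^ (2 * h) * (e * H) ^ h = 1 * (e * H) ^ h] (mod int l)" by (rule cong_scalar_right)
      have "[\<kappa> * poly w s ^ h = \<kappa> * (- \<kappa>)] (mod int l)" using s by (intro cong_scalar_left) (simp add: S_def)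
      moreover have "[\<kappa> * (- \<kappa>) = -1] (mod int l)" using \<kappa>2 by (simp add: cong_iff_dvd_diff) (metis dvd_diff_commute minus_diff_commute)
      ultimately have "[(e * H) ^ h = -1] (mod int l)" using A1 A2 by (simp) (meson cong_sym cong_trans)
      thus "f s \<in> I" using l2 by (simp add: I_def H_def f_def)
    qed
    moreover have "inj_on f S"
    proof (rule inj_onI)
      fix s t assume st: "s \<in> S" "t \<in> S" "f s = f t"
      define Y where "Y = y1 + f s * b"
      have "[s * Y = t * Y] (mod int l)"
        using main[OF st(1)] main[OF st(2)] st(3) by (auto simp: Y_def intro: cong_trans[OF cong_sym])
      hence "int l dvd (s - t) * Y" by (simp add: cong_iff_dvd_diff left_diff_distrib)
      moreover have "\<not> int l dvd Y"
      proof
        assume "int l dvd Y"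
        hence "int l dvd (a - b * s) * Y" by simp
        thus False using main[OF st(1)] m unfolding Y_def by (meson cong_dvd_iff)
      qed
      ultimately have "int l dvd s - t" using li by (simp add: prime_dvd_mult_iff)
      moreover have "\<bar>s - t\<bar> < int l" using st by (auto simp: S_def)
      ultimately have "s - t = 0" by (metis abs_of_nat dvd_imp_le_int not_le)
      thus "s = t" by simp
    qed
    ultimately show ?thesis using card_mono[OF fin(4)] card_image by metis
  qed
  hence "4 * K * card S \<le> 4 * K * card I" by simp
  thus ?thesis using lS unfolding I_def h_def by linarith
qed

text \<open>By the Chinese remainder theorem, a block of length equal to the product of the primes
  contains at most one integer with given residues.\<close>

lemma sieve_interval:
  fixes Ls :: "nat set" and A :: "nat \<Rightarrow> int set"
  assumes Ls: "finite Ls" "\<And>l. l \<in> Ls \<Longrightarrow> prime l"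
    and A: "\<And>l. l \<in> Ls \<Longrightarrow> A l \<subseteq> {0..<int l}"
    and I: "I \<subseteq> {c..c + int Y}" "\<And>i l. i \<in> I \<Longrightarrow> l \<in> Ls \<Longrightarrow> i mod int l \<in> A l"
  shows "card I \<le> Suc (Y div \<Prod>Ls) * (\<Prod>l\<in>Ls. card (A l))"
proof -
  define P where "P = \<Prod>Ls"
  have P0: "P > 0" unfolding P_def using Ls by (intro prod_pos) (auto dest: prime_gt_0_nat)
  define f where "f i = (nat (i - c) div P, \<lambda>l\<in>Ls. i mod int l)" for i
  have "f ` I \<subseteq> {..Y div P} \<times> (PiE Ls A)"
  proof (rule image_subsetI)
    fix i assume i: "i \<in> I"
    have "i \<in> {c..c + int Y}" using i I(1) by blast
    hence "nat (i - c) \<le> Y" by (simp add: nat_le_iff)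
    hence "nat (i - c) div P \<le> Y div P" by (rule div_le_mono)
    thus "f i \<in> {..Y div P} \<times> (PiE Ls A)" using I(2)[OF i] by (auto simp: f_def)
  qed
  moreover have "inj_on f I"
  proof (rule inj_onI)
    fix i j assume ij: "i \<in> I" "j \<in> I" "f i = f j"
    have m: "i mod int l = j mod int l" if "l \<in> Ls" for l
      using ij(3) that unfolding f_def by (metis prod.inject restrict_apply')
    have "int P dvd i - j"
    proof -
      have "(\<Prod>l\<in>L. int l) dvd i - j" if "L \<subseteq> Ls" for L
        using finite_subset[OF that Ls(1)] that
      proof (induction L rule: finite_induct)
        case (insert l L)
        have "coprime (int l) (\<Prod>l\<in>L. int l)"
        proof (rule prod_coprime_right)
          fix k assume "k \<in> L"
          thus "coprime (int l) (int k)" using insert Ls(2) by (metis coprime_int_iff insert_subset primes_coprime subsetD)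
        qed
        moreover have "int l dvd i - j" using m[of l] insert by (simp add: mod_eq_dvd_iff)
        ultimately show ?case using insert by (simp add: divides_mult)
      qed simp
      thus ?thesis by (simp add: P_def)
    qed
    moreover have "\<bar>i - j\<bar> < int P"
    proof -
      have "i \<in> {c..c + int Y}" "j \<in> {c..c + int Y}" using ij I(1) by blast+
      hence ge: "i - c \<ge> 0" "j - c \<ge> 0" by auto
      define q where "q = nat (i - c) div P"
      have q: "nat (i - c) div P = q" "nat (j - c) div P = q" using ij(3) by (auto simp: f_def q_def)
      have qq: "q * P \<le> x \<and> x < q * P + P" if "x div P = q" for x
        unfolding that[symmetric] using div_mult_mod_eq[of x P] mod_less_divisor[OF P0, of x] by linarith
      have "q * P \<le> nat (i - c)" "nat (i - c) < q * P + P" "q * P \<le> nat (j - c)" "nat (j - c) < q * P + P"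
        using qq[OF q(1)] qq[OF q(2)] by auto
      hence "\<bar>int (nat (i - c)) - int (nat (j - c))\<bar> < int P" by linarith
      thus ?thesis using ge by simp
    qed
    ultimately have "i - j = 0" by (metis abs_of_nat dvd_imp_le_int not_le)
    thus "i = j" by simp
  qed
  moreover have "finite (A l)" if "l \<in> Ls" for l using A[OF that] finite_subset by blast
  hence "finite ({..Y div P} \<times> (PiE Ls A))" using Ls by (intro finite_cartesian_product finite_PiE) auto
  ultimately have "card I \<le> card ({..Y div P} \<times> (PiE Ls A))" by (metis card_image card_mono)
  also have "\<dots> = Suc (Y div P) * (\<Prod>l\<in>Ls. card (A l))" using Ls by (simp add: card_cartesian_product card_PiE)
  finally show ?thesis unfolding P_def .
qed

text \<open>A square never has quadratic character -1, so each prime excludes at least a fraction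
  1/(4K) of its residue classes. The product of the primes is the rounding loss of the last
  block.\<close>

lemma line_square_count:
  fixes u A B :: "int poly" and Ls :: "nat set"
  assumes u: "lead_coeff u = 1" "2 \<le> degree u" and bez: "A * u + B * pderiv u = [:R:]"
    and K: "K = Suc (2 * degree u)"
    and Ls: "finite Ls" "\<And>l. l \<in> Ls \<Longrightarrow> prime l \<and> 8 * K * K < l \<and> \<not> int l dvd R \<and> \<not> int l dvd m \<and> \<not> int l dvd e"
    and det: "a * y1 - b * x1 = m"
    and I: "I \<subseteq> {c..c + int Y}" "\<And>i. i \<in> I \<Longrightarrow> \<exists>z. e * hform u (x1 + i * a) (y1 + i * b) = z ^ 2"
  shows "real (card I) \<le> (1 - 1 / (4 * real K)) ^ card Ls * (real Y + real (\<Prod>Ls))"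
proof -
  define bad where "bad l = {i\<in>{0..<int l}. [(e * hform u (x1 + i * a) (y1 + i * b)) ^ ((l - 1) div 2) = -1] (mod int l)}" for l
  define G where "G l = {0..<int l} - bad l" for l
  define P where "P = \<Prod>Ls"
  have P0: "P > 0" unfolding P_def using Ls by (intro prod_pos) (auto dest: prime_gt_0_nat)
  have K1: "K \<ge> 1" using K by simp
  have mem: "i mod int l \<in> G l" if i: "i \<in> I" and l: "l \<in> Ls" for i l
  proof -
    have pl: "prime l" "l > 2" using Ls(2)[OF l] K by auto
    define h where "h = (l - 1) div 2"
    have h0: "h > 0" using pl by (simp add: h_def)
    obtain z where z: "e * hform u (x1 + i * a) (y1 + i * b) = z ^ 2" using I(2)[OF i] by blast
    have "[x1 + (i mod int l) * a = x1 + i * a] (mod int l)" "[y1 + (i mod int l) * b = y1 + i * b] (mod int l)"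
      by (intro cong_add cong_mult cong_refl; simp)+
    hence "[hform u (x1 + (i mod int l) * a) (y1 + (i mod int l) * b) = hform u (x1 + i * a) (y1 + i * b)] (mod int l)"
      by (rule hform_cong_args)
    hence "[e * hform u (x1 + (i mod int l) * a) (y1 + (i mod int l) * b) = z ^ 2] (mod int l)"
      unfolding z[symmetric] by (rule cong_scalar_left)
    hence c: "[(e * hform u (x1 + (i mod int l) * a) (y1 + (i mod int l) * b)) ^ h = (z ^ 2) ^ h] (mod int l)"
      by (rule cong_pow)
    have "\<not> [(z ^ 2) ^ h = -1] (mod int l)"
    proof
      assume a: "[(z ^ 2) ^ h = -1] (mod int l)"
      show False
      proof (cases "int l dvd z")
        case True
        have "z dvd (z ^ 2) ^ h" unfolding power_mult[symmetric] using h0 by (intro dvd_power) auto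
        hence "int l dvd (z ^ 2) ^ h" by (rule dvd_trans[OF True])
        hence "int l dvd -1" using a cong_dvd_iff by blast
        thus False using pl by simp
      next
        case False
        have "[(z ^ 2) ^ h = 1] (mod int l)" unfolding power_mult[symmetric] h_def
          by (rule fermat_half_power(1)[OF pl False])
        hence "[1 = -1] (mod int l)" using a by (meson cong_sym cong_trans)
        hence "int l dvd 2" by (simp add: cong_iff_dvd_diff)
        hence "int l \<le> 2" by (rule zdvd_imp_le) simp
        thus False using pl by simp
      qed
    qed
    hence "i mod int l \<notin> bad l" using c unfolding bad_def h_def by (auto dest: cong_trans[OF cong_sym])
    thus ?thesis using pl by (simp add: G_def)
  qed
  have cG: "real (card (G l)) \<le> (1 - 1 / (4 * real K)) * real l" if l: "l \<in> Ls" for l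
  proof -
    have "l \<le> 4 * K * card (bad l)" unfolding bad_def
      by (rule line_nonresidues[OF _ u bez _ K _ det]) (use Ls(2)[OF l] in auto)
    hence "real l \<le> real (4 * K * card (bad l))" by (simp only: of_nat_le_iff)
    hence 1: "real l / (4 * real K) \<le> real (card (bad l))" using K1 by (simp add: field_simps)
    have sub: "bad l \<subseteq> {0..<int l}" by (auto simp: bad_def)
    have "card (bad l) \<le> l" using card_mono[OF _ sub] by simp
    moreover have "card (G l) = l - card (bad l)" unfolding G_def
      using sub by (subst card_Diff_subset) (auto intro: finite_subset)
    ultimately have "real (card (G l)) = real l - real (card (bad l))" by simp
    thus ?thesis using 1 by (simp add: algebra_simps)
  qed
  have "card I \<le> Suc (Y div P) * (\<Prod>l\<in>Ls. card (G l))" unfolding P_def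
    by (rule sieve_interval[OF Ls(1) _ _ I(1) mem]) (use Ls(2) in \<open>auto simp: G_def\<close>)
  hence "real (card I) \<le> real (Suc (Y div P) * (\<Prod>l\<in>Ls. card (G l)))" by (simp only: of_nat_le_iff)
  also have "\<dots> = real (Suc (Y div P)) * (\<Prod>l\<in>Ls. real (card (G l)))"
    by (simp add: algebra_simps)
  also have "\<dots> \<le> (real Y / real P + 1) * (\<Prod>l\<in>Ls. (1 - 1 / (4 * real K)) * real l)"
  proof (intro mult_mono)
    show "real (Suc (Y div P)) \<le> real Y / real P + 1" by (simp add: of_nat_div_le_of_nat)
    show "(\<Prod>l\<in>Ls. real (card (G l))) \<le> (\<Prod>l\<in>Ls. (1 - 1 / (4 * real K)) * real l)"
      by (rule prod_mono) (use cG in auto)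
  qed (auto intro: prod_nonneg)
  also have "(\<Prod>l\<in>Ls. (1 - 1 / (4 * real K)) * real l) = (1 - 1 / (4 * real K)) ^ card Ls * real P"
    by (simp add: prod.distrib P_def)
  also have "(real Y / real P + 1) * ((1 - 1 / (4 * real K)) ^ card Ls * real P) =
      (1 - 1 / (4 * real K)) ^ card Ls * (real Y + real P)"
  proof -
    have eq: "(y / q + 1) * (z * q) = z * (y + q)" if "q \<noteq> 0" for y z q :: real
      using that by (simp add: field_simps)
    show ?thesis by (rule eq) (use P0 in simp)
  qed
  finally show ?thesis unfolding P_def .
qed

section \<open>Points of a planar lattice\<close>

text \<open>Pigeonhole with two coefficients up to floor(sqrt n) gives a nonzero vector of the
  required size; choosing a minimal one in the maximum norm adds the last clause.\<close>

lemma short_vector: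
  fixes n :: nat and \<omega> :: int
  assumes n: "n > 0"
  shows "\<exists>a b. int n dvd a - \<omega> * b \<and> max \<bar>a\<bar> \<bar>b\<bar> > 0 \<and> (max \<bar>a\<bar> \<bar>b\<bar>)\<^sup>2 \<le> int n \<and>
    (\<forall>x y. int n dvd x - \<omega> * y \<longrightarrow> max \<bar>x\<bar> \<bar>y\<bar> < max \<bar>a\<bar> \<bar>b\<bar> \<longrightarrow> x = 0 \<and> y = 0)"
proof -
  define B where "B = nat \<lfloor>sqrt (real n)\<rfloor>"
  have B: "B\<^sup>2 \<le> n" "n < (Suc B)\<^sup>2"
  proof -
    have 1: "real B \<le> sqrt (real n)" "sqrt (real n) < real B + 1" by (auto simp: B_def)
    have "(real B)\<^sup>2 \<le> (sqrt (real n))\<^sup>2" using 1 by (intro power_mono) auto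
    hence "real (B\<^sup>2) \<le> real n" by simp
    thus "B\<^sup>2 \<le> n" by (simp only: of_nat_le_iff)
    have "(sqrt (real n))\<^sup>2 < (real B + 1)\<^sup>2" using 1 by (intro power_strict_mono) auto
    hence "real n < real ((Suc B)\<^sup>2)" by (simp add: add.commute)
    thus "n < (Suc B)\<^sup>2" by (simp only: of_nat_less_iff)
  qed
  obtain f where f: "f \<in> {..<2} \<rightarrow>\<^sub>E {-int B..int B}" "\<exists>k<2. f k \<noteq> 0" "int n dvd (\<Sum>k<2. f k * \<omega> ^ k)"
    using small_linear_relation[OF n, of B 2 \<omega>] B(2) by auto
  define good where "good = (\<lambda>(x, y). int n dvd x - \<omega> * y \<and> (x, y) \<noteq> (0, 0))"
  have f01: "f 0 \<in> {-int B..int B}" "f 1 \<in> {-int B..int B}" using PiE_mem[OF f(1), of 0] PiE_mem[OF f(1), of 1] by simp_all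
  have "good (f 0, - f 1)" using f(2,3) by (auto simp: good_def numeral_2_eq_2 less_Suc_eq mult.commute)
  from ex_has_least_nat[of good, OF this, of "\<lambda>(x, y). nat (max \<bar>x\<bar> \<bar>y\<bar>)"] obtain z where
    z: "good z" "\<And>z'. good z' \<Longrightarrow> (\<lambda>(x, y). nat (max \<bar>x\<bar> \<bar>y\<bar>)) z \<le> (\<lambda>(x, y). nat (max \<bar>x\<bar> \<bar>y\<bar>)) z'" by blast
  obtain a b where ab: "z = (a, b)" by force
  have min: "max \<bar>a\<bar> \<bar>b\<bar> \<le> max \<bar>x\<bar> \<bar>y\<bar>" if "int n dvd x - \<omega> * y" "(x, y) \<noteq> (0, 0)" for x y
  proof -
    have "good (x, y)" using that by (auto simp: good_def)
    from z(2)[OF this] have "nat (max \<bar>a\<bar> \<bar>b\<bar>) \<le> nat (max \<bar>x\<bar> \<bar>y\<bar>)" by (simp only: ab prod.case)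
    moreover have "0 < max \<bar>a\<bar> \<bar>b\<bar> \<or> 0 \<le> max \<bar>x\<bar> \<bar>y\<bar>" by (simp add: max_def)
    ultimately show ?thesis by (simp only: nat_le_eq_zle)
  qed
  have "max \<bar>a\<bar> \<bar>b\<bar> \<le> max \<bar>f 0\<bar> \<bar>- f 1\<bar>"
    by (rule min) (use \<open>good (f 0, - f 1)\<close> in \<open>simp_all only: good_def prod.case\<close>, simp_all)
  also have "\<dots> \<le> int B" using f01 by auto
  finally have le: "max \<bar>a\<bar> \<bar>b\<bar> \<le> int B" .
  hence "(max \<bar>a\<bar> \<bar>b\<bar>)\<^sup>2 \<le> (int B)\<^sup>2" by (intro power_mono) auto
  also have "\<dots> \<le> int n" using B(1) by (simp flip: of_nat_power)
  finally have sq: "(max \<bar>a\<bar> \<bar>b\<bar>)\<^sup>2 \<le> int n" .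
  show ?thesis
  proof (intro exI conjI allI impI)
    show "int n dvd a - \<omega> * b" using z(1) by (simp add: ab good_def)
    show "max \<bar>a\<bar> \<bar>b\<bar> > 0" using z(1) by (auto simp: ab good_def)
    show "(max \<bar>a\<bar> \<bar>b\<bar>)\<^sup>2 \<le> int n" by (rule sq)
    fix x y assume xy: "int n dvd x - \<omega> * y" "max \<bar>x\<bar> \<bar>y\<bar> < max \<bar>a\<bar> \<bar>b\<bar>"
    have "(x, y) = (0, 0)" using min[OF xy(1)] xy(2) by (meson not_less)
    thus "x = 0" "y = 0" by simp_all
  qed
qed

text \<open>Division by the larger coordinate of the minimal vector leaves a parallel vector that is
  shorter, hence zero.\<close>

lemma parallel_multiple_aux:
  fixes a b x y :: int
  assumes ba: "\<bar>b\<bar> \<le> \<bar>a\<bar>" "a \<noteq> 0" and par: "a * y = b * x"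
    and min: "\<And>i. max \<bar>x - i * a\<bar> \<bar>y - i * b\<bar> < \<bar>a\<bar> \<Longrightarrow> x - i * a = 0 \<and> y - i * b = 0"
  shows "\<exists>i. x = i * a \<and> y = i * b"
proof -
  define i where "i = x div a"
  have e1: "x - i * a = x mod a" by (simp add: i_def minus_div_mult_eq_mod)
  have l1: "\<bar>x - i * a\<bar> < \<bar>a\<bar>" unfolding e1 by (rule abs_mod_less[OF ba(2)])
  have "a * (y - i * b) = b * (x - i * a)" using par by (simp add: algebra_simps)
  hence "\<bar>a\<bar> * \<bar>y - i * b\<bar> = \<bar>b\<bar> * \<bar>x - i * a\<bar>" by (metis abs_mult)
  also have "\<dots> \<le> \<bar>a\<bar> * \<bar>x - i * a\<bar>" using ba by (intro mult_right_mono) auto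
  finally have "\<bar>y - i * b\<bar> \<le> \<bar>x - i * a\<bar>" using ba(2) by simp
  hence "x - i * a = 0 \<and> y - i * b = 0" using l1 by (intro min) auto
  thus ?thesis by (intro exI[of _ i]) auto
qed

lemma parallel_multiple:
  fixes a b x y n \<omega> :: int
  assumes ab: "n dvd a - \<omega> * b" "max \<bar>a\<bar> \<bar>b\<bar> > 0"
    and min: "\<And>x y. n dvd x - \<omega> * y \<Longrightarrow> max \<bar>x\<bar> \<bar>y\<bar> < max \<bar>a\<bar> \<bar>b\<bar> \<Longrightarrow> x = 0 \<and> y = 0"
    and xy: "n dvd x - \<omega> * y" and par: "a * y = b * x"
  shows "\<exists>i. x = i * a \<and> y = i * b"
proof -
  have L: "n dvd (x - i * a) - \<omega> * (y - i * b)" for i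
  proof -
    have eq: "(x - i * a) - \<omega> * (y - i * b) = (x - \<omega> * y) - i * (a - \<omega> * b)" by (simp add: algebra_simps)
    show ?thesis unfolding eq by (rule dvd_diff[OF xy dvd_mult[OF ab(1)]])
  qed
  show ?thesis
  proof (cases "\<bar>b\<bar> \<le> \<bar>a\<bar>")
    case True
    have "a \<noteq> 0" using True ab(2) by auto
    thus ?thesis using par min[OF L] True
      by (intro parallel_multiple_aux) (auto simp: max_def)
  next
    case False
    hence "\<exists>i. y = i * b \<and> x = i * a" using par min[OF L]
      by (intro parallel_multiple_aux) (auto simp: max_def split: if_splits)
    thus ?thesis by blast
  qed
qed

lemma card_multiples_le:
  fixes l \<tau> :: nat
  assumes "l > 0"
  shows "card {t. t \<noteq> 0 \<and> \<bar>t\<bar> \<le> int \<tau> \<and> int l dvd t} \<le> 2 * (\<tau> div l)"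
proof -
  have "{t. t \<noteq> 0 \<and> \<bar>t\<bar> \<le> int \<tau> \<and> int l dvd t} \<subseteq> (\<lambda>s. int l * s) ` ({- int (\<tau> div l)..int (\<tau> div l)} - {0})"
  proof
    fix t assume t: "t \<in> {t. t \<noteq> 0 \<and> \<bar>t\<bar> \<le> int \<tau> \<and> int l dvd t}"
    then obtain s where s: "t = int l * s" by (auto simp: dvd_def)
    have "int l * \<bar>s\<bar> \<le> int \<tau>" using t s by (simp add: abs_mult)
    hence "int (l * nat \<bar>s\<bar>) \<le> int \<tau>" by simp
    hence "l * nat \<bar>s\<bar> \<le> \<tau>" by (simp only: of_nat_le_iff)
    hence "nat \<bar>s\<bar> \<le> \<tau> div l" using assms by (simp add: less_eq_div_iff_mult_less_eq mult.commute)
    hence "\<bar>s\<bar> \<le> int (\<tau> div l)" by linarith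
    thus "t \<in> (\<lambda>s. int l * s) ` ({- int (\<tau> div l)..int (\<tau> div l)} - {0})"
      using t s by (intro image_eqI[of t _ s]) auto
  qed
  hence "card {t. t \<noteq> 0 \<and> \<bar>t\<bar> \<le> int \<tau> \<and> int l dvd t} \<le> card ((\<lambda>s. int l * s) ` ({- int (\<tau> div l)..int (\<tau> div l)} - {0}))"
    by (intro card_mono) auto
  also have "\<dots> \<le> card ({- int (\<tau> div l)..int (\<tau> div l)} - {0})" by (rule card_image_le) simp
  also have "\<dots> = 2 * (\<tau> div l)" by (subst card_Diff_subset) auto
  finally show ?thesis .
qed

text \<open>Markov's inequality by double counting. The bound is independent of k because the number
  of primes is proportional to the threshold.\<close>

lemma card_many_divisors_le:
  fixes Ls :: "nat set" and T :: "'a set"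
  assumes "finite Ls" "finite T" "k > 0" "card Ls = 3 * k"
    and c: "\<And>l. l \<in> Ls \<Longrightarrow> real (card {t\<in>T. Q l t}) \<le> c"
  shows "real (card {t\<in>T. k < card {l\<in>Ls. Q l t}}) \<le> 3 * c"
proof -
  define S where "S = {t\<in>T. k < card {l\<in>Ls. Q l t}}"
  have fS: "finite S" using assms by (simp add: S_def)
  have "k * card S = (\<Sum>t\<in>S. k)" by simp
  also have "\<dots> \<le> (\<Sum>t\<in>S. card {l\<in>Ls. Q l t})" by (rule sum_mono) (auto simp: S_def)
  also have "\<dots> = (\<Sum>t\<in>S. \<Sum>l\<in>Ls. if Q l t then 1 else 0)" using assms(1) by (simp add: sum.If_cases Int_def)
  also have "\<dots> = (\<Sum>l\<in>Ls. \<Sum>t\<in>S. if Q l t then 1 else 0)" by (rule sum.swap)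
  also have "\<dots> = (\<Sum>l\<in>Ls. card {t\<in>S. Q l t})" using fS by (simp add: sum.If_cases Int_def)
  also have "\<dots> \<le> (\<Sum>l\<in>Ls. card {t\<in>T. Q l t})"
    using assms(2) by (intro sum_mono card_mono) (auto simp: S_def)
  finally have "real (k * card S) \<le> real (\<Sum>l\<in>Ls. card {t\<in>T. Q l t})" by (simp only: of_nat_le_iff)
  also have "\<dots> \<le> (\<Sum>l\<in>Ls. c)" unfolding of_nat_sum by (rule sum_mono) (rule c)
  also have "\<dots> = real k * (3 * c)" using assms by simp
  finally have "real k * real (card S) \<le> real k * (3 * c)" by simp
  thus ?thesis using assms(3) unfolding S_def by simp
qed

text \<open>The lattice is cut into lines parallel to its shortest vector (a, b), indexed by t = (a
  y - b x)/n. With d the length of that vector there are O(dN/n) lines with O(N/d) points each, so d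
  cancels. Primes dividing n or t do not sieve the line; at most k divide n, and lines for which
  more than k divide t are rare and are counted trivially, which costs the term with
  \<open>B0\<close>.\<close>

lemma lattice_square_count:
  fixes u A B :: "int poly" and Ls :: "nat set" and N n k :: nat and \<omega> \<sigma> :: int
  assumes u: "lead_coeff u = 1" "2 \<le> degree u" and bez: "A * u + B * pderiv u = [:R:]"
    and K: "K = Suc (2 * degree u)" and n: "0 < n" "n \<le> N\<^sup>2" and k: "0 < k"
    and Ls: "finite Ls" "card Ls = 3 * k" "card {l\<in>Ls. l dvd n} \<le> k"
    and Lp: "\<And>l. l \<in> Ls \<Longrightarrow> prime l \<and> 8 * K * K < l \<and> \<not> int l dvd R \<and> B0 \<le> l \<and> l \<le> T"
    and B0: "0 < B0" and T: "(T ^ k)\<^sup>2 * n \<le> N\<^sup>2" and \<sigma>: "\<sigma> = 1 \<or> \<sigma> = -1"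
  shows "real (card {(x, y). x \<in> {1..int N} \<and> y \<in> {1..int N} \<and> coprime x y \<and> int n dvd x - \<omega> * y \<and>
           (\<exists>q. hform u x y = \<sigma> * int n * q\<^sup>2)})
         \<le> 1 + real N ^ 2 / real n * (24 / real B0 + 8 * (1 - 1 / (4 * real K)) ^ k)"
proof -
  define W where "W = {(x, y). x \<in> {1..int N} \<and> y \<in> {1..int N} \<and> coprime x y \<and> int n dvd x - \<omega> * y \<and>
           (\<exists>q. hform u x y = \<sigma> * int n * q\<^sup>2)}"
  define \<rho> where "\<rho> = 1 - 1 / (4 * real K)"
  have K1: "real K \<ge> 1" using K by simp
  have \<rho>0: "\<rho> \<ge> 0" using K1 by (simp add: \<rho>_def field_simps)
  have fW: "finite W" by (rule finite_subset[of _ "{1..int N} \<times> {1..int N}"]) (auto simp: W_def)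
  obtain a b where ab: "int n dvd a - \<omega> * b" "max \<bar>a\<bar> \<bar>b\<bar> > 0" "(max \<bar>a\<bar> \<bar>b\<bar>)\<^sup>2 \<le> int n"
    and min: "\<And>x y. int n dvd x - \<omega> * y \<Longrightarrow> max \<bar>x\<bar> \<bar>y\<bar> < max \<bar>a\<bar> \<bar>b\<bar> \<Longrightarrow> x = 0 \<and> y = 0"
    using short_vector[OF n(1), of \<omega>] by blast
  define d where "d = nat (max \<bar>a\<bar> \<bar>b\<bar>)"
  have d: "int d = max \<bar>a\<bar> \<bar>b\<bar>" using ab(2) by (simp add: d_def)
  have d0: "d > 0" using ab(2) by (simp add: d_def)
  have dn: "d\<^sup>2 \<le> n"
  proof -
    have "int (d\<^sup>2) \<le> int n" using ab(3) by (simp add: d)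
    thus ?thesis by (simp only: of_nat_le_iff)
  qed
  define Y where "Y = N div d"
  define \<tau> where "\<tau> = 2 * d * N div n"
  have dN: "d \<le> N"
  proof -
    have "d\<^sup>2 \<le> N\<^sup>2" using dn n(2) by (rule le_trans)
    thus ?thesis by (rule power2_le_imp_le) simp
  qed
  have Y1: "1 \<le> Y" using dN d0 by (simp add: Y_def div_greater_zero_iff Suc_le_eq)
  define t where "t = (\<lambda>(x, y). (a * y - b * x) div int n)"
  have tn: "a * y - b * x = int n * t (x, y)" if "int n dvd x - \<omega> * y" for x y
  proof -
    have "a * y - b * x = (a - \<omega> * b) * y - b * (x - \<omega> * y)" by (simp add: algebra_simps)
    also have "int n dvd \<dots>" by (rule dvd_diff[OF dvd_mult2[OF ab(1)] dvd_mult[OF that]])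
    finally show ?thesis by (simp add: t_def)
  qed
  define Wt where "Wt s = {w\<in>W. t w = s}" for s
  define TT where "TT = {s. s \<noteq> 0 \<and> \<bar>s\<bar> \<le> int \<tau>}"
  have fTT: "finite TT" by (rule finite_subset[of _ "{-int \<tau>..int \<tau>}"]) (auto simp: TT_def)
  have fWt: "finite (Wt s)" for s using fW by (simp add: Wt_def)
  have tb: "\<bar>t w\<bar> \<le> int \<tau>" if w: "w \<in> W" for w
  proof -
    obtain x y where xy: "w = (x, y)" by force
    have W: "x \<in> {1..int N}" "y \<in> {1..int N}" "int n dvd x - \<omega> * y" using w by (auto simp: W_def xy)
    have "int n * \<bar>t w\<bar> = \<bar>a * y - b * x\<bar>" using tn[OF W(3)] by (simp add: xy abs_mult)
    also have "\<dots> \<le> \<bar>a\<bar> * \<bar>y\<bar> + \<bar>b\<bar> * \<bar>x\<bar>" by (metis abs_mult abs_triangle_ineq4)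
    also have "\<dots> \<le> int d * int N + int d * int N" using W d by (intro add_mono mult_mono) auto
    also have "\<dots> = int (2 * d * N)" by simp
    finally have "int (n * nat \<bar>t w\<bar>) \<le> int (2 * d * N)" by simp
    hence "n * nat \<bar>t w\<bar> \<le> 2 * d * N" by (simp only: of_nat_le_iff)
    hence "nat \<bar>t w\<bar> \<le> \<tau>" using n(1) by (simp add: \<tau>_def less_eq_div_iff_mult_less_eq mult.commute)
    thus ?thesis by linarith
  qed
  \<comment> \<open>The line t = 0 passes through the origin. All its points are proportional, so at
    most one is coprime with positive coordinates; this is the summand 1 of the bound.\<close>
  have W0: "card (Wt 0) \<le> 1"
  proof (rule card_le_Suc0_iff_eq[THEN iffD2, unfolded One_nat_def[symmetric]])
    show "\<forall>w\<in>Wt 0. \<forall>w'\<in>Wt 0. w = w'"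
    proof safe
      fix x y x' y' assume w: "(x, y) \<in> Wt 0" "(x', y') \<in> Wt 0"
      have W: "1 \<le> x" "1 \<le> y" "coprime x y" "int n dvd x - \<omega> * y" "t (x, y) = 0"
        and W': "1 \<le> x'" "1 \<le> y'" "coprime x' y'" "int n dvd x' - \<omega> * y'" "t (x', y') = 0"
        using w by (auto simp: Wt_def W_def)
      have e: "a * y = b * x" "a * y' = b * x'" using tn[OF W(4)] tn[OF W'(4)] W(5) W'(5) by auto
      have "a \<noteq> 0 \<or> b \<noteq> 0" using ab(2) by auto
      moreover have "a * (x * y') = a * (x' * y)" using e by (metis mult.assoc mult.commute mult.left_commute)
      moreover have "b * (x * y') = b * (x' * y)" using e by (metis mult.assoc mult.commute mult.left_commute)
      ultimately have eq: "x * y' = x' * y" by auto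
      have "x dvd x' * y" "x' dvd x * y'" using eq by (metis dvd_triv_left)+
      hence "x dvd x'" "x' dvd x" using W(3) W'(3) by (auto simp: coprime_dvd_mult_left_iff)
      hence xx: "x = x'" using W(1) W'(1) by (auto intro: zdvd_antisym_nonneg)
      thus "x = x'" by simp
      show "y = y'" using eq xx W(1) by simp
    qed
  qed (rule fWt)
  have line: "\<exists>x1 y1 I. int n dvd x1 - \<omega> * y1 \<and> t (x1, y1) = s \<and> (\<exists>c. I \<subseteq> {c..c + int Y}) \<and> card I = card (Wt s) \<and>
      (\<forall>i\<in>I. (x1 + i * a, y1 + i * b) \<in> W)" if ne: "Wt s \<noteq> {}" for s
  proof -
    obtain x1 y1 where w1: "(x1, y1) \<in> Wt s" using ne by (metis ex_in_conv surj_pair)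
    have L1: "int n dvd x1 - \<omega> * y1" "t (x1, y1) = s" using w1 by (auto simp: Wt_def W_def)
    define I where "I = {i. (x1 + i * a, y1 + i * b) \<in> Wt s}"
    have im: "(\<lambda>i. (x1 + i * a, y1 + i * b)) ` I = Wt s"
    proof
      show "Wt s \<subseteq> (\<lambda>i. (x1 + i * a, y1 + i * b)) ` I"
      proof
        fix w assume w: "w \<in> Wt s"
        obtain x y where xy: "w = (x, y)" by force
        have L: "int n dvd x - \<omega> * y" "t (x, y) = s" using w by (auto simp: Wt_def W_def xy)
        have "a * y - b * x = a * y1 - b * x1" using tn[OF L(1)] tn[OF L1(1)] L(2) L1(2) by simp
        hence par: "a * (y - y1) = b * (x - x1)" by (simp add: algebra_simps)
        have "(x - x1) - \<omega> * (y - y1) = (x - \<omega> * y) - (x1 - \<omega> * y1)" by (simp add: algebra_simps)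
        hence "int n dvd (x - x1) - \<omega> * (y - y1)" using L(1) L1(1) by (metis dvd_diff)
        from parallel_multiple[OF ab(1,2) min this par] obtain i where "x - x1 = i * a \<and> y - y1 = i * b" by blast
        hence "w = (x1 + i * a, y1 + i * b)" by (auto simp: xy)
        thus "w \<in> (\<lambda>i. (x1 + i * a, y1 + i * b)) ` I" using w by (auto simp: I_def)
      qed
    qed (auto simp: I_def)
    have inj: "inj_on (\<lambda>i. (x1 + i * a, y1 + i * b)) I" using ab(2) by (auto simp: inj_on_def)
    have cI: "card I = card (Wt s)" using card_image[OF inj] im by simp
    have fI: "finite I" using fWt[of s] im inj by (metis finite_image_iff)
    have I0: "I \<noteq> {}" using im ne by auto
    have "I \<subseteq> {Min I..Min I + int Y}"
    proof
      fix i assume i: "i \<in> I"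
      have m: "Min I \<in> I" "Min I \<le> i" using fI I0 i by auto
      have pos: "x1 + i * a \<in> {1..int N}" "y1 + i * b \<in> {1..int N}" "x1 + Min I * a \<in> {1..int N}" "y1 + Min I * b \<in> {1..int N}"
        using i m(1) by (auto simp: I_def Wt_def W_def)
      have "(i - Min I) * \<bar>a\<bar> \<le> int N"
      proof -
        have "(i - Min I) * \<bar>a\<bar> = \<bar>(x1 + i * a) - (x1 + Min I * a)\<bar>" using m(2)
          by (simp add: abs_mult left_diff_distrib[symmetric])
        thus ?thesis using pos by auto
      qed
      moreover have "(i - Min I) * \<bar>b\<bar> \<le> int N"
      proof -
        have "(i - Min I) * \<bar>b\<bar> = \<bar>(y1 + i * b) - (y1 + Min I * b)\<bar>" using m(2)
          by (simp add: abs_mult left_diff_distrib[symmetric])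
        thus ?thesis using pos by auto
      qed
      ultimately have "(i - Min I) * int d \<le> int N" unfolding d by (simp add: max_def)
      hence "int (nat (i - Min I) * d) \<le> int N" using m(2) by simp
      hence "nat (i - Min I) * d \<le> N" by (simp only: of_nat_le_iff)
      hence "nat (i - Min I) \<le> Y" using d0 by (simp add: Y_def less_eq_div_iff_mult_less_eq)
      thus "i \<in> {Min I..Min I + int Y}" using m(2) by auto
    qed
    moreover have "\<forall>i\<in>I. (x1 + i * a, y1 + i * b) \<in> W" by (auto simp: I_def Wt_def)
    ultimately show ?thesis using L1 cI by blast
  qed
  have any: "card (Wt s) \<le> 2 * Y" for s
  proof (cases "Wt s = {}")
    case False
    from line[OF this] obtain I c where "I \<subseteq> {c..c + int Y}" "card I = card (Wt s)" by blast
    thus ?thesis using card_mono[of "{c..c + int Y}" I] Y1 by simp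
  qed simp
  have good: "real (card (Wt s)) \<le> \<rho> ^ k * (2 * real Y)" if s: "s \<noteq> 0" "card {l\<in>Ls. int l dvd s} \<le> k" for s
  proof (cases "Wt s = {}")
    case True
    thus ?thesis using \<rho>0 by simp
  next
    case False
    from line[OF this] obtain x1 y1 I c where I: "int n dvd x1 - \<omega> * y1" "t (x1, y1) = s" "I \<subseteq> {c..c + int Y}"
      "card I = card (Wt s)" "\<And>i. i \<in> I \<Longrightarrow> (x1 + i * a, y1 + i * b) \<in> W" by blast
    define L1 where "L1 = Ls - {l\<in>Ls. l dvd n} - {l\<in>Ls. int l dvd s}"
    have "card (Ls - {l\<in>Ls. l dvd n}) \<ge> 2 * k"
      using Ls diff_card_le_card_Diff[of "{l\<in>Ls. l dvd n}" Ls] by simp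
    hence "card L1 \<ge> k" unfolding L1_def
      using Ls(1) s(2) diff_card_le_card_Diff[of "{l\<in>Ls. int l dvd s}" "Ls - {l\<in>Ls. l dvd n}"] by simp
    then obtain L2 where L2: "L2 \<subseteq> L1" "card L2 = k" "finite L2" by (rule obtain_subset_with_card_n)
    have L2s: "L2 \<subseteq> Ls" using L2(1) by (auto simp: L1_def)
    have "\<Prod>L2 \<le> (\<Prod>l\<in>L2. T)" by (rule prod_mono) (use Lp L2s in auto)
    hence PT: "\<Prod>L2 \<le> T ^ k" using L2(2) by simp
    have "(T ^ k * d)\<^sup>2 \<le> N\<^sup>2"
    proof -
      \<comment> \<open>The size condition on \<open>T\<close> enters here: with d^2 <= n it makes
        the product of k sieving primes at most Y, so the rounding loss of the sieve only doubles
        its main term.\<close>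
      have "(T ^ k * d)\<^sup>2 \<le> (T ^ k)\<^sup>2 * n" using dn by (simp add: power_mult_distrib)
      thus ?thesis using T by (rule le_trans)
    qed
    hence "T ^ k * d \<le> N" by (rule power2_le_imp_le) simp
    hence "T ^ k \<le> Y" using d0 by (simp add: Y_def less_eq_div_iff_mult_less_eq)
    hence PY: "\<Prod>L2 \<le> Y" using PT by simp
    have "real (card I) \<le> (1 - 1 / (4 * real K)) ^ card L2 * (real Y + real (\<Prod>L2))"
    proof (rule line_square_count[OF u bez K L2(3) _ tn[OF I(1)] I(3)])
      fix l assume l: "l \<in> L2"
      have p: "prime (int l)" using Lp L2s l by auto
      have "\<not> int l dvd int n" "\<not> int l dvd s" using l L2(1) by (auto simp: L1_def)
      hence "\<not> int l dvd int n * t (x1, y1)" "\<not> int l dvd \<sigma> * int n"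
        using p \<sigma> by (auto simp: prime_dvd_mult_iff I(2))
      thus "prime l \<and> 8 * K * K < l \<and> \<not> int l dvd R \<and> \<not> int l dvd int n * t (x1, y1) \<and> \<not> int l dvd \<sigma> * int n"
        using Lp L2s l by blast
    next
      fix i assume "i \<in> I"
      from I(5)[OF this] obtain q where "hform u (x1 + i * a) (y1 + i * b) = \<sigma> * int n * q\<^sup>2" by (auto simp: W_def)
      hence "\<sigma> * int n * hform u (x1 + i * a) (y1 + i * b) = (int n * q)\<^sup>2"
        using \<sigma> by (auto simp: power2_eq_square)
      thus "\<exists>z. \<sigma> * int n * hform u (x1 + i * a) (y1 + i * b) = z\<^sup>2" by blast
    qed
    also have "\<dots> \<le> \<rho> ^ k * (2 * real Y)" unfolding L2(2) \<rho>_def[symmetric]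
    proof (rule mult_left_mono)
      have "real (\<Prod>L2) \<le> real Y" using PY by (simp only: of_nat_le_iff)
      thus "real Y + real (\<Prod>L2) \<le> 2 * real Y" by linarith
    qed (use \<rho>0 in simp)
    finally show ?thesis unfolding I(4) .
  qed
  define Bd where "Bd = {s\<in>TT. k < card {l\<in>Ls. int l dvd s}}"
  have fBd: "finite Bd" using fTT by (simp add: Bd_def)
  have cBd: "real (card Bd) \<le> 3 * (2 * real \<tau> / real B0)" unfolding Bd_def
  proof (rule card_many_divisors_le[OF Ls(1) fTT k Ls(2)])
    fix l assume l: "l \<in> Ls"
    have l0: "l > 0" "B0 \<le> l" using Lp[OF l] by (auto dest: prime_gt_0_nat)
    have "card {s\<in>TT. int l dvd s} \<le> 2 * (\<tau> div l)"
      using card_multiples_le[OF l0(1), of \<tau>] by (simp add: TT_def conj_assoc)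
    hence "real (card {s\<in>TT. int l dvd s}) \<le> real (2 * (\<tau> div l))" by (simp only: of_nat_le_iff)
    also have "\<dots> \<le> 2 * (real \<tau> / real l)"
      unfolding of_nat_mult of_nat_numeral by (intro mult_left_mono of_nat_div_le_of_nat) simp
    also have "\<dots> \<le> 2 * (real \<tau> / real B0)" using l0 B0 by (intro mult_left_mono divide_left_mono) auto
    finally show "real (card {s\<in>TT. int l dvd s}) \<le> 2 * real \<tau> / real B0" by simp
  qed
  have cTT: "card TT \<le> 2 * \<tau>" using card_multiples_le[of 1 \<tau>] by (simp add: TT_def)
  have "W \<subseteq> Wt 0 \<union> (\<Union>s\<in>TT. Wt s)" using tb by (auto simp: Wt_def TT_def)
  hence "card W \<le> card (Wt 0 \<union> (\<Union>s\<in>TT. Wt s))" using fTT fWt by (intro card_mono) auto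
  also have "\<dots> \<le> card (Wt 0) + card (\<Union>s\<in>TT. Wt s)" by (rule card_Un_le)
  also have "\<dots> \<le> 1 + (\<Sum>s\<in>TT. card (Wt s))" by (intro add_mono W0 card_UN_le fTT)
  finally have "real (card W) \<le> real (1 + (\<Sum>s\<in>TT. card (Wt s)))" by (simp only: of_nat_le_iff)
  also have "\<dots> = 1 + (\<Sum>s\<in>TT. real (card (Wt s)))" by simp
  also have "(\<Sum>s\<in>TT. real (card (Wt s))) \<le> (\<Sum>s\<in>TT. (if s \<in> Bd then 2 * real Y else 0) + \<rho> ^ k * (2 * real Y))"
  proof (rule sum_mono)
    fix s assume s: "s \<in> TT"
    show "real (card (Wt s)) \<le> (if s \<in> Bd then 2 * real Y else 0) + \<rho> ^ k * (2 * real Y)"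
    proof (cases "s \<in> Bd")
      case True
      have "real (card (Wt s)) \<le> 2 * real Y" using any[of s] by linarith
      moreover have "0 \<le> \<rho> ^ k * (2 * real Y)" using \<rho>0 by simp
      ultimately show ?thesis unfolding if_P[OF True] by linarith
    next
      case False
      thus ?thesis using s good[of s] by (simp add: Bd_def TT_def)
    qed
  qed
  also have "\<dots> = real (card Bd) * (2 * real Y) + real (card TT) * (\<rho> ^ k * (2 * real Y))"
  proof -
    have "TT \<inter> Bd = Bd" by (auto simp: Bd_def)
    thus ?thesis using fTT by (simp add: sum.distrib sum.If_cases)
  qed
  also have "\<dots> \<le> 3 * (2 * real \<tau> / real B0) * (2 * real Y) + real (2 * \<tau>) * (\<rho> ^ k * (2 * real Y))"
    using cBd cTT \<rho>0 by (intro add_mono mult_right_mono) (simp_all only: of_nat_le_iff, simp_all)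
  also have "\<dots> = real \<tau> * real Y * (12 / real B0 + 4 * \<rho> ^ k)" by (simp add: algebra_simps)
  also have "\<dots> \<le> (2 * real N ^ 2 / real n) * (12 / real B0 + 4 * \<rho> ^ k)"
  proof (intro mult_right_mono)
    have "real \<tau> \<le> real (2 * d * N) / real n" unfolding \<tau>_def by (rule of_nat_div_le_of_nat)
    moreover have "real Y \<le> real N / real d" unfolding Y_def by (rule of_nat_div_le_of_nat)
    ultimately have "real \<tau> * real Y \<le> (real (2 * d * N) / real n) * (real N / real d)" by (intro mult_mono) auto
    also have "\<dots> = 2 * real N ^ 2 / real n" using d0 by (simp add: power2_eq_square)
    finally show "real \<tau> * real Y \<le> 2 * real N ^ 2 / real n" .
  qed (use \<rho>0 in simp)
  also have "\<dots> = real N ^ 2 / real n * (24 / real B0 + 8 * \<rho> ^ k)" by (simp add: algebra_simps)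
  finally show ?thesis unfolding W_def \<rho>_def by simp
qed

section \<open>Large square divisors of a binary form\<close>

text \<open>For each y the form is monic in x, so x lies in at most deg u classes modulo l. As l <=
  N, the rounding term is absorbed by the factor 2.\<close>

lemma card_form_divisible_le:
  fixes l N :: nat
  assumes l: "prime l" "l \<le> N" and u: "lead_coeff u = 1"
  shows "real (card {(x, y). x \<in> {1..int N} \<and> y \<in> {1..int N} \<and> int l dvd hform u x y})
    \<le> 2 * real (degree u) * real N ^ 2 / real l"
proof -
  define D where "D = degree u"
  define I where "I y = {x\<in>{1..int N}. int l dvd hform u x y}" for y
  have l0: "l > 0" using l(1) by (rule prime_gt_0_nat)
  have cI: "real (card (I y)) \<le> 2 * real D * real N / real l" for y
  proof -
    define P where "P = (\<Sum>k\<le>D. monom (coeff u k * y ^ (D - k)) k)"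
    have cP: "coeff P k = (if k \<le> D then coeff u k * y ^ (D - k) else 0)" for k
      by (simp add: P_def coeff_sum)
    have eval: "poly P x = hform u x y" for x
      by (simp add: P_def poly_sum poly_monom hform_def D_def mult_ac)
    have "coeff P D = 1" using u by (simp add: cP D_def)
    moreover have dP: "degree P \<le> D" by (rule degree_le) (auto simp: cP)
    moreover have "degree P \<ge> D" using \<open>coeff P D = 1\<close> by (intro le_degree) simp
    ultimately have lc: "lead_coeff P = 1" by simp
    define S where "S = {x\<in>{0..<int l}. int l dvd poly P x}"
    have cS: "card S \<le> D" unfolding S_def
      using roots_mod_prime_le_degree[OF l(1) monic_not_pconst_dvd[OF l(1) lc]] dP by linarith
    have "card (I y) \<le> Suc (N div \<Prod>{l}) * (\<Prod>l\<in>{l}. card S)"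
    proof (rule sieve_interval[where c = 1])
      show "I y \<subseteq> {1..1 + int N}" by (auto simp: I_def)
      fix i l' assume i: "i \<in> I y" and l': "l' \<in> {l}"
      have "[poly P (i mod int l) = poly P i] (mod int l)" unfolding eval by (intro hform_cong_args) auto
      hence "int l dvd poly P (i mod int l)" using i by (simp add: I_def eval) (metis cong_dvd_iff eval)
      thus "i mod int l' \<in> S" using l0 l' by (simp add: S_def)
    qed (use l in \<open>auto simp: S_def\<close>)
    hence "card (I y) \<le> Suc (N div l) * card S" by simp
    also have "\<dots> \<le> Suc (N div l) * D" using cS by (rule mult_le_mono2)
    finally have "card (I y) \<le> Suc (N div l) * D" .
    hence "real (card (I y)) \<le> real (Suc (N div l) * D)" by (simp only: of_nat_le_iff)
    also have "\<dots> = (real (N div l) + 1) * real D" by (simp add: algebra_simps)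
    also have "\<dots> \<le> (real N / real l + real N / real l) * real D"
      using l l0 by (intro mult_right_mono add_mono of_nat_div_le_of_nat) (auto simp: field_simps)
    finally show ?thesis by (simp add: field_simps)
  qed
  have "{(x, y). x \<in> {1..int N} \<and> y \<in> {1..int N} \<and> int l dvd hform u x y} = (\<Union>y\<in>{1..int N}. (\<lambda>x. (x, y)) ` I y)"
    by (auto simp: I_def)
  also have "card \<dots> \<le> (\<Sum>y\<in>{1..int N}. card ((\<lambda>x. (x, y)) ` I y))" by (rule card_UN_le) simp
  also have "\<dots> = (\<Sum>y\<in>{1..int N}. card (I y))" by (intro sum.cong refl card_image) (auto simp: inj_on_def)
  finally have "real (card {(x, y). x \<in> {1..int N} \<and> y \<in> {1..int N} \<and> int l dvd hform u x y})
     \<le> real (\<Sum>y\<in>{1..int N}. card (I y))" by (simp only: of_nat_le_iff)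
  also have "\<dots> \<le> (\<Sum>y\<in>{1..int N}. 2 * real D * real N / real l)" unfolding of_nat_sum by (rule sum_mono) (rule cI)
  also have "\<dots> = 2 * real D * real N ^ 2 / real l" by (simp add: power2_eq_square)
  finally show ?thesis by (simp add: D_def)
qed

lemma sum_inverse_squares_le:
  assumes "2 \<le> J"
  shows "(\<Sum>j=J..M. 1 / real j ^ 2) \<le> 1 / (real J - 1)"
proof -
  have main: "J \<le> Suc M \<Longrightarrow> (\<Sum>j=J..M. 1 / real j ^ 2) \<le> 1 / (real J - 1) - 1 / real M"
  proof (induction M)
    case (Suc M)
    show ?case
    proof (cases "J \<le> Suc M")
      case True
      have M: "M > 0" using assms True by simp
      have "1 / (real M + 1) ^ 2 \<le> 1 / (real M * (real M + 1))"
        using M by (intro divide_left_mono) (auto simp: power2_eq_square)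
      also have "\<dots> = 1 / real M - 1 / (real M + 1)" using M by (simp add: field_simps)
      finally have "1 / real (Suc M) ^ 2 \<le> 1 / real M - 1 / real (Suc M)" by (simp add: add.commute)
      thus ?thesis using Suc.IH[OF True] True by simp
    next
      case False
      hence "J = Suc (Suc M)" using Suc.prems by simp
      thus ?thesis by simp
    qed
  qed (use assms in simp)
  show ?thesis
  proof (cases "J \<le> Suc M")
    case True
    have "0 \<le> 1 / real M" by simp
    thus ?thesis using main[OF True] by linarith
  qed (use assms in simp)
qed

text \<open>Taking k about sqrt j, the saving \<rho>^k beats 1/j^2, while the square of a product of
  k primes below j^4 is at most exp(8 sqrt j log j), which stays below 2^j.\<close>

lemma sieve_parameters_eventually:
  fixes \<rho> :: real
  assumes "0 < \<rho>" "\<rho> < 1"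
  shows "eventually (\<lambda>j::nat. 1 \<le> nat \<lfloor>sqrt (real j)\<rfloor> \<and> \<rho> ^ nat \<lfloor>sqrt (real j)\<rfloor> \<le> 1 / real j ^ 2 \<and>
    ((j ^ 4) ^ nat \<lfloor>sqrt (real j)\<rfloor>)\<^sup>2 \<le> 2 ^ j \<and> 1 / 2 ^ j \<le> 1 / real j ^ 2) at_top"
proof -
  have "eventually (\<lambda>j::nat. real j \<ge> 2 \<and> ln \<rho> * (sqrt (real j) - 1) \<le> - 2 * ln (real j)) at_top"
    using assms by (intro eventually_conj; real_asymp)
  moreover have "eventually (\<lambda>j::nat. 8 * sqrt (real j) * ln (real j) \<le> real j * ln 2 \<and> 1 / 2 ^ j \<le> 1 / real j ^ 2) at_top"
    by (intro eventually_conj; real_asymp)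
  ultimately show ?thesis
  proof eventually_elim
    case (elim j)
    define k where "k = nat \<lfloor>sqrt (real j)\<rfloor>"
    have j: "real j \<ge> 2" using elim by simp
    have s1: "1 \<le> sqrt (real j)" using j by simp
    have k: "real k \<le> sqrt (real j)" "sqrt (real j) - 1 \<le> real k" using s1 unfolding k_def by linarith+
    have k1: "1 \<le> k" using s1 by (simp add: k_def le_nat_iff)
    have "ln (\<rho> ^ k) = real k * ln \<rho>" using assms by (simp add: ln_realpow)
    also have "\<dots> \<le> (sqrt (real j) - 1) * ln \<rho>" using k(2) assms by (intro mult_right_mono_neg) auto
    also have "\<dots> \<le> - 2 * ln (real j)" using elim by (simp add: mult.commute)
    also have "\<dots> = ln (1 / real j ^ 2)" using j by (simp add: ln_div ln_realpow)
    finally have r: "\<rho> ^ k \<le> 1 / real j ^ 2" using assms j by (subst (asm) ln_le_cancel_iff) auto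
    have "ln (((real j ^ 4) ^ k)\<^sup>2) = 8 * real k * ln (real j)" using j by (simp add: ln_realpow)
    also have "\<dots> \<le> 8 * sqrt (real j) * ln (real j)" using k(1) j by (intro mult_right_mono) auto
    also have "\<dots> \<le> real j * ln 2" using elim by simp
    also have "\<dots> = ln (2 ^ j)" by (simp add: ln_realpow)
    finally have "((real j ^ 4) ^ k)\<^sup>2 \<le> 2 ^ j" using j by (subst (asm) ln_le_cancel_iff) auto
    hence "real (((j ^ 4) ^ k)\<^sup>2) \<le> real (2 ^ j)" by simp
    hence "((j ^ 4) ^ k)\<^sup>2 \<le> 2 ^ j" by (simp only: of_nat_le_iff)
    thus ?case using k1 r elim unfolding k_def by blast
  qed
qed

text \<open>In a range that occurs, j is at most logarithmic in N, so the sieving primes up to j^4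
  do not exceed N and \<open>card_form_divisible_le\<close> applies to them.\<close>

lemma log_power_bound: "\<exists>N1. \<forall>N\<ge>N1. \<forall>j::nat. 2 ^ j \<le> N\<^sup>2 \<longrightarrow> j ^ 4 \<le> (N :: nat)"
proof -
  have "eventually (\<lambda>N::nat. real N \<ge> 1 \<and> (2 * ln (real N) / ln 2) ^ 4 \<le> real N) at_top"
    by (intro eventually_conj; real_asymp)
  then obtain N1 where N1: "\<And>N. N \<ge> N1 \<Longrightarrow> real N \<ge> 1 \<and> (2 * ln (real N) / ln 2) ^ 4 \<le> real N"
    by (auto simp: eventually_at_top_linorder)
  show ?thesis
  proof (intro exI allI impI)
    fix N j :: nat assume N: "N1 \<le> N" and j: "2 ^ j \<le> N\<^sup>2"
    have "real (2 ^ j) \<le> real (N\<^sup>2)" using j by (simp only: of_nat_le_iff)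
    hence "ln (2 ^ j) \<le> ln (real N ^ 2)" using N1[OF N] by (subst ln_le_cancel_iff) auto
    hence "real j * ln 2 \<le> 2 * ln (real N)" using N1[OF N] by (simp add: ln_realpow)
    hence "real j \<le> 2 * ln (real N) / ln 2" by (simp add: field_simps)
    hence "real j ^ 4 \<le> (2 * ln (real N) / ln 2) ^ 4" by (intro power_mono) auto
    also have "\<dots> \<le> real N" using N1[OF N] by simp
    finally have "real (j ^ 4) \<le> real N" by simp
    thus "j ^ 4 \<le> N" by (simp only: of_nat_le_iff)
  qed
qed

section \<open>Points of a monic form as roots modulo n\<close>

lemma coprime_second_of_dvd_hform:
  fixes n :: nat
  assumes u: "lead_coeff u = 1" and n: "n > 0" and d: "int n dvd hform u x y" and cop: "coprime x y"
  shows "coprime y (int n)"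
proof (rule ccontr)
  assume "\<not> coprime y (int n)"
  hence "\<not> is_unit (gcd y (int n))" by (simp only: is_unit_gcd not_False_eq_True)
  moreover have "gcd y (int n) \<noteq> 0" using n by simp
  ultimately obtain q where "q dvd gcd y (int n)" "prime q" using prime_divisor_exists by blast
  hence q: "prime q" "q dvd y" "q dvd int n" by simp_all
  hence "q dvd x" using prime_dvd_hform_snd[OF u q(1) dvd_trans[OF q(3) d] q(2)] by blast
  thus False using q(1,2) cop by (meson coprime_common_divisor not_prime_unit)
qed

lemma form_ratio_root_coprime:
  fixes n :: nat
  assumes n: "n > 0" and d: "int n dvd hform u x y" and cop: "coprime y (int n)"
  shows "\<exists>w::nat. w < n \<and> int n dvd poly u (int w) \<and> int n dvd x - int w * y"
proof -
  obtain v where v: "[y * v = 1] (mod int n)" using cop cong_solve_coprime_int by blast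
  define w where "w = (x * v) mod int n"
  have w: "0 \<le> w" "w < int n" using n by (auto simp: w_def)
  have "[w * y = x * v * y] (mod int n)" by (intro cong_mult cong_refl) (simp add: w_def)
  also have "x * v * y = x * (y * v)" by (simp add: mult_ac)
  also have "[x * (y * v) = x * 1] (mod int n)" using v by (rule cong_scalar_left)
  finally have wy: "[x = w * y] (mod int n)" by (simp add: cong_sym)
  have "[hform u x y = y ^ degree u * poly u w] (mod int n)" by (rule hform_cong_root[OF wy])
  hence "int n dvd y ^ degree u * poly u w" using d cong_dvd_iff by blast
  hence "int n dvd poly u w" using cop
    by (simp add: coprime_dvd_mult_right_iff coprime_commute)
  moreover have "int n dvd x - w * y" using wy by (simp add: cong_iff_dvd_diff)
  ultimately show ?thesis using w by (intro exI[of _ "nat w"]) auto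
qed

lemma form_ratio_root:
  fixes n :: nat
  assumes "lead_coeff u = 1" "n > 0" "int n dvd hform u x y" "coprime x y"
  shows "\<exists>w::nat. w < n \<and> int n dvd poly u (int w) \<and> int n dvd x - int w * y"
  by (rule form_ratio_root_coprime[OF assms(2,3) coprime_second_of_dvd_hform[OF assms]])

text \<open>For a monic form, U(x,y) = 0 makes y a divisor of a power of x; coprimality leaves y = 1
  and the integer roots of u.\<close>

lemma card_form_zero_le:
  assumes u: "lead_coeff u = 1"
  shows "card {(x, y). x \<in> {1..int N} \<and> y \<in> {1..int N} \<and> coprime x y \<and> hform u x y = 0} \<le> degree u"
proof -
  have u0: "u \<noteq> 0" using u by auto
  have "{(x, y). x \<in> {1..int N} \<and> y \<in> {1..int N} \<and> coprime x y \<and> hform u x y = 0} \<subseteq> (\<lambda>x. (x, 1)) ` {x. poly u x = 0}"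
  proof safe
    fix x y assume xy: "x \<in> {1..int N}" "y \<in> {1..int N}" "coprime x y" "hform u x y = 0"
    have "[0 = x ^ degree u] (mod y)" using hform_mod_second[OF u, of x y] xy(4) by simp
    hence "y dvd x ^ degree u" by (simp add: cong_iff_dvd_diff)
    moreover have "coprime (x ^ degree u) y" using xy(3) by simp
    ultimately have "is_unit y" by (meson coprime_common_divisor dvd_refl)
    hence y1: "y = 1" using xy(2) by auto
    have "hform u (x * 1) 1 = 1 ^ degree u * poly u x" by (rule hform_scale)
    hence "poly u x = 0" using xy(4) y1 by simp
    thus "(x, y) \<in> (\<lambda>x. (x, 1)) ` {x. poly u x = 0}" using y1 by simp
  qed
  hence "card {(x, y). x \<in> {1..int N} \<and> y \<in> {1..int N} \<and> coprime x y \<and> hform u x y = 0} \<le> card ((\<lambda>x. (x, 1::int)) ` {x. poly u x = 0})"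
    using poly_roots_finite[OF u0] by (intro card_mono finite_imageI) 
  also have "\<dots> \<le> card {x. poly u x = 0}" using poly_roots_finite[OF u0] by (rule card_image_le)
  also have "\<dots> \<le> degree u" by (rule card_poly_roots_bound[OF u0])
  finally show ?thesis .
qed

text \<open>Write \<open>U(x,y) = \<plusminus>n q\<^sup>2\<close>. Degree at most six makes \<open>n\<close> small compared with \<open>N\<^sup>2\<close>, and each dyadic range of \<open>n\<close>
  contributes few points: the number of lattices \<open>x \<equiv> \<omega>y (mod n)\<close> is linear in the range, and the
  quadratic residue sieve saves a summable factor on each of them.\<close>

lemma large_square_divisors:
  fixes u A B :: "int poly"
  assumes u: "lead_coeff u = 1" "irreducible u" "1 \<le> degree u" "degree u \<le> 6"
    and bez: "A * u + B * pderiv u = [:R:]" and R: "R \<noteq> 0" and \<epsilon>: "\<epsilon> > 0"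
  shows "\<exists>\<Lambda> N0 :: nat. \<forall>N\<ge>N0. real (card {(x, y). x \<in> {1..int N} \<and> y \<in> {1..int N} \<and> coprime x y \<and>
     (\<exists>q. \<Lambda> * N\<^sup>2 < q \<and> int (q\<^sup>2) dvd hform u x y)}) \<le> \<epsilon> * real N ^ 2"
proof -
  define D where "D = degree u"
  define Z where "Z N = {(x, y). x \<in> {1..int N} \<and> y \<in> {1..int N} \<and> coprime x y \<and> hform u x y = 0}" for N
  define Bad where "Bad \<Lambda> N = {(x, y). x \<in> {1..int N} \<and> y \<in> {1..int N} \<and> coprime x y \<and>
     (\<exists>q. \<Lambda> * N\<^sup>2 < q \<and> int (q\<^sup>2) dvd hform u x y)}" for \<Lambda> N :: nat
  have cZ: "card (Z N) \<le> D" for N unfolding Z_def D_def by (rule card_form_zero_le[OF u(1)])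
  have fZ: "finite (Z N)" for N by (rule finite_subset[of _ "{1..int N} \<times> {1..int N}"]) (auto simp: Z_def)
  obtain C0 where C0: "\<And>N x y. \<bar>x\<bar> \<le> int N \<Longrightarrow> \<bar>y\<bar> \<le> int N \<Longrightarrow> \<bar>hform u x y\<bar> \<le> int C0 * int N ^ D"
    using hform_abs_bound[of u] unfolding D_def by blast
  have small: "n * \<Lambda>\<^sup>2 * N ^ 4 \<le> C0 * N ^ D"
    if h: "\<bar>hform u x y\<bar> = int n * int (q\<^sup>2)" "x \<in> {1..int N}" "y \<in> {1..int N}" "\<Lambda> * N\<^sup>2 < q" for x y n q \<Lambda> N
  proof -
    have "n * \<Lambda>\<^sup>2 * N ^ 4 = n * (\<Lambda> * N\<^sup>2)\<^sup>2" by (simp add: power_mult_distrib flip: power_mult)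
    also have "\<dots> \<le> n * q\<^sup>2" using h(4) by (intro mult_le_mono2 power_mono) auto
    finally have 1: "n * \<Lambda>\<^sup>2 * N ^ 4 \<le> n * q\<^sup>2" .
    have "int (n * q\<^sup>2) \<le> int (C0 * N ^ D)" using C0[of x N y] h by simp
    hence "n * q\<^sup>2 \<le> C0 * N ^ D" by (simp only: of_nat_le_iff)
    thus ?thesis using 1 by (rule le_trans[rotated])
  qed
  show ?thesis
  \<comment> \<open>Up to degree four the values are O(N^4), too small for a square of a q > (C0 +
    1) N^2 unless they vanish. This also disposes of linear factors, for which roots modulo n are
    not counted.\<close>
  proof (cases "D \<le> 4")
    case True
    obtain N0 :: nat where N0: "real D / \<epsilon> < real N0" using reals_Archimedean2 by blast
    have "real (card (Bad (Suc C0) N)) \<le> \<epsilon> * real N ^ 2" if N: "N \<ge> Suc N0" for N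
    proof -
      have "Bad (Suc C0) N \<subseteq> Z N"
      proof safe
        fix x y assume xy: "(x, y) \<in> Bad (Suc C0) N"
        then obtain q where q: "Suc C0 * N\<^sup>2 < q" "int (q\<^sup>2) dvd hform u x y"
          and b: "x \<in> {1..int N}" "y \<in> {1..int N}" "coprime x y" by (auto simp: Bad_def)
        have "hform u x y = 0"
        proof (rule ccontr)
          assume nz: "hform u x y \<noteq> 0"
          obtain c where c: "hform u x y = int (q\<^sup>2) * c" using q(2) by (auto simp: dvd_def)
          define n where "n = nat \<bar>c\<bar>"
          have n: "n > 0" using nz c by (auto simp: n_def)
          have "n * (Suc C0)\<^sup>2 * N ^ 4 \<le> C0 * N ^ D"
            by (rule small[OF _ b(1,2) q(1)]) (simp add: c n_def abs_mult)
          also have "\<dots> \<le> C0 * N ^ 4" using True N by (intro mult_le_mono2 power_increasing) auto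
          finally have "n * (Suc C0)\<^sup>2 \<le> C0" using N by simp
          moreover have "1 * (Suc C0 * 1) \<le> n * (Suc C0)\<^sup>2"
            unfolding power2_eq_square using n by (intro mult_le_mono) auto
          ultimately show False by simp
        qed
        thus "(x, y) \<in> Z N" using b by (auto simp: Z_def)
      qed
      hence "card (Bad (Suc C0) N) \<le> D" using card_mono[OF fZ] cZ le_trans by blast
      hence "real (card (Bad (Suc C0) N)) \<le> real D" by simp
      also have "\<dots> \<le> \<epsilon> * real N0" using N0 \<epsilon> by (simp add: field_simps)
      also have "\<dots> \<le> \<epsilon> * real N ^ 2"
      proof (intro mult_left_mono)
        have "N0 \<le> N * N" using N by (metis Suc_leD le_trans le_square)
        hence "real N0 \<le> real (N * N)" by (simp only: of_nat_le_iff)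
        thus "real N0 \<le> real N ^ 2" by (simp add: power2_eq_square)
      qed (use \<epsilon> in simp)
      finally show ?thesis .
    qed
    thus ?thesis unfolding Bad_def by blast
  next
    case False
    have D2: "2 \<le> degree u" using False by (simp add: D_def)
    define K where "K = Suc (2 * degree u)"
    define \<rho> where "\<rho> = 1 - 1 / (4 * real K)"
    have \<rho>: "0 < \<rho>" "\<rho> < 1" by (auto simp: \<rho>_def K_def field_simps)
    define k where "k j = nat \<lfloor>sqrt (real j)\<rfloor>" for j :: nat
    obtain C1 where C1: "\<And>X. X \<ge> 1 \<Longrightarrow> card (root_pairs u X) \<le> C1 * X"
      using root_pairs_linear_bound[OF u(1,2) refl D2] by blast
    define good where "good j Ls \<longleftrightarrow> finite Ls \<and> card Ls = 3 * k j \<and> (\<forall>l\<in>Ls. prime l \<and> j\<^sup>2 < l \<and> l \<le> j ^ 4)" for j Ls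
    have "eventually (\<lambda>j. (\<exists>Ls. good j Ls) \<and> (1 \<le> k j \<and> \<rho> ^ k j \<le> 1 / real j ^ 2 \<and>
       ((j ^ 4) ^ k j)\<^sup>2 \<le> 2 ^ j \<and> 1 / 2 ^ j \<le> 1 / real j ^ 2) \<and> j \<ge> 2 + 8 * K * K + nat \<bar>R\<bar>) at_top"
      unfolding good_def k_def
      by (rule eventually_conj[OF eventually_many_primes_between
            eventually_conj[OF sieve_parameters_eventually[OF \<rho>] eventually_ge_at_top]])
    then obtain J1 where J1: "\<And>j. j \<ge> J1 \<Longrightarrow> (\<exists>Ls. good j Ls) \<and> (1 \<le> k j \<and> \<rho> ^ k j \<le> 1 / real j ^ 2 \<and>
       ((j ^ 4) ^ k j)\<^sup>2 \<le> 2 ^ j \<and> 1 / 2 ^ j \<le> 1 / real j ^ 2) \<and> j \<ge> 2 + 8 * K * K + nat \<bar>R\<bar>"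
      by (auto simp: eventually_at_top_linorder)
    then obtain Ls where Ls: "\<And>j. j \<ge> J1 \<Longrightarrow> good j (Ls j)" by metis
    \<comment> \<open>The part 6D comes from \<open>E\<close>. The part 130 = 2 + 128 comes from C1
      N^2 / 2^j pairs (n, w) with two signs each, at most 1 + 2 * 2^j * 32/j^2 points apiece,
      together with 1/2^j <= 1/j^2.\<close>
    define C2 where "C2 = 6 * real D + 130 * real C1"
    obtain J2 :: nat where J2: "2 * C2 / \<epsilon> < real J2" using reals_Archimedean2 by blast
    define J where "J = max (J1 + 2) (J2 + 2)"
    obtain N1 where N1: "\<And>N j. N \<ge> N1 \<Longrightarrow> 2 ^ j \<le> N\<^sup>2 \<Longrightarrow> j ^ 4 \<le> N" using log_power_bound by blast
    obtain N2 :: nat where N2: "2 * real D / \<epsilon> < real N2" using reals_Archimedean2 by blast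
    \<comment> \<open>The factor 2^J makes every surviving cofactor satisfy n 2^J <= N^2, so only
      ranges j >= J occur. There the tail of the sum of 1/j^2 is at most 1/(J - 1), and
      \<open>J2\<close> makes its contribution less than \<epsilon>/2.\<close>
    define \<Lambda> where "\<Lambda> = Suc (C0 * 2 ^ J)"
    \<comment> \<open>Points at which too many sieving primes divide the form are discarded in
      advance. Elsewhere at most \<open>k j\<close> of them divide n, because n divides the value of
      the form.\<close>
    define E where "E j N = {z \<in> {1..int N} \<times> {1..int N}. k j < card {l\<in>Ls j. int l dvd hform u (fst z) (snd z)}}" for j N
    define W where "W n w \<sigma> N = {(x, y). x \<in> {1..int N} \<and> y \<in> {1..int N} \<and> coprime x y \<and> int n dvd x - int w * y \<and>
           (\<exists>q. hform u x y = \<sigma> * int n * q\<^sup>2)}" for n w :: nat and \<sigma> :: int and N :: nat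
    define RP where "RP j N = {z\<in>root_pairs u (N\<^sup>2 div 2 ^ j). N\<^sup>2 < fst z * 2 ^ Suc j \<and> card {l\<in>Ls j. l dvd fst z} \<le> k j}" for j N
    define S where "S j N = E j N \<union> (\<Union>z\<in>RP j N. W (fst z) (snd z) 1 N \<union> W (fst z) (snd z) (-1) N)" for j N
    have fE: "finite (E j N)" for j N unfolding E_def by simp
    have fRP: "finite (RP j N)" for j N unfolding RP_def using finite_root_pairs by simp
    have fW: "finite (W n w \<sigma> N)" for n w \<sigma> N
      by (rule finite_subset[of _ "{1..int N} \<times> {1..int N}"]) (auto simp: W_def)
    have cE: "real (card (E j N)) \<le> 6 * real D * real N ^ 2 * (1 / real j ^ 2)"
      if j: "j \<ge> J1" "j ^ 4 \<le> N" for j N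
    proof -
      have "real (card (E j N)) \<le> 3 * (2 * real D * real N ^ 2 / real (j\<^sup>2))" unfolding E_def
      proof (rule card_many_divisors_le)
        show "finite (Ls j)" "card (Ls j) = 3 * k j" using Ls[OF j(1)] by (auto simp: good_def)
        show "k j > 0" using J1[OF j(1)] by simp
        fix l assume l: "l \<in> Ls j"
        have lp: "prime l" "j\<^sup>2 < l" "l \<le> j ^ 4" using Ls[OF j(1)] l by (auto simp: good_def)
        have j0: "j > 0" using J1[OF j(1)] by simp
        have "{z \<in> {1..int N} \<times> {1..int N}. int l dvd hform u (fst z) (snd z)} =
          {(x, y). x \<in> {1..int N} \<and> y \<in> {1..int N} \<and> int l dvd hform u x y}" by auto
        hence "real (card {z \<in> {1..int N} \<times> {1..int N}. int l dvd hform u (fst z) (snd z)}) \<le> 2 * real D * real N ^ 2 / real l"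
          using card_form_divisible_le[OF lp(1) _ u(1), of N] lp(3) j(2) by (simp add: D_def)
        also have "\<dots> \<le> 2 * real D * real N ^ 2 / real (j\<^sup>2)"
          using lp(2) j0 by (intro divide_left_mono) (auto simp flip: of_nat_power)
        finally show "real (card {z \<in> {1..int N} \<times> {1..int N}. int l dvd hform u (fst z) (snd z)}) \<le> 2 * real D * real N ^ 2 / real (j\<^sup>2)" .
      qed simp
      thus ?thesis by simp
    qed
    have cW: "real (card (W n w \<sigma> N)) \<le> 1 + 2 * 2 ^ j * (32 / real j ^ 2)"
      if j: "j \<ge> J1" "2 ^ j \<le> N\<^sup>2" and nw: "(n, w) \<in> RP j N" and \<sigma>: "\<sigma> = 1 \<or> \<sigma> = -1" for j N n w \<sigma>
    proof -
      have j0: "j \<ge> 2 + 8 * K * K + nat \<bar>R\<bar>" and r: "\<rho> ^ k j \<le> 1 / real j ^ 2" and k1: "1 \<le> k j"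
        and T: "((j ^ 4) ^ k j)\<^sup>2 \<le> 2 ^ j" using J1[OF j(1)] by auto
      have jj: "j \<le> j\<^sup>2" by (simp add: power2_eq_square)
      have n0: "0 < n" "n \<le> N\<^sup>2 div 2 ^ j" "N\<^sup>2 < n * 2 ^ Suc j" "card {l\<in>Ls j. l dvd n} \<le> k j"
        using nw by (auto simp: RP_def root_pairs_def)
      have n2j: "2 ^ j * n \<le> N\<^sup>2" using n0(2) by (simp add: less_eq_div_iff_mult_less_eq mult.commute)
      have nN: "n \<le> N\<^sup>2" using n0(2) by (meson div_le_dividend le_trans)
      have "real (card (W n w \<sigma> N)) \<le> 1 + real N ^ 2 / real n * (24 / real (j\<^sup>2) + 8 * (1 - 1 / (4 * real K)) ^ k j)"
        unfolding W_def
      proof (rule lattice_square_count[OF u(1) D2 bez K_def n0(1) nN _ _ _ n0(4) _ _ _ \<sigma>])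
        show "0 < k j" using k1 by simp
        show "finite (Ls j)" "card (Ls j) = 3 * k j" using Ls[OF j(1)] by (auto simp: good_def)
        show "0 < j\<^sup>2" using j0 by simp
        show "((j ^ 4) ^ k j)\<^sup>2 * n \<le> N\<^sup>2" by (rule le_trans[OF mult_le_mono1[OF T] n2j])
        fix l assume l: "l \<in> Ls j"
        have lp: "prime l" "j\<^sup>2 < l" "l \<le> j ^ 4" using Ls[OF j(1)] l by (auto simp: good_def)
        have "\<not> int l dvd R"
        proof
          assume "int l dvd R"
          hence "\<bar>int l\<bar> \<le> \<bar>R\<bar>" using R by (rule dvd_imp_le_int[rotated])
          thus False using lp(2) jj j0 by linarith
        qed
        thus "prime l \<and> 8 * K * K < l \<and> \<not> int l dvd R \<and> j\<^sup>2 \<le> l \<and> l \<le> j ^ 4" using lp jj j0 by auto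
      qed
      also have "\<dots> \<le> 1 + 2 * 2 ^ j * (24 / real j ^ 2 + 8 * (1 / real j ^ 2))"
      proof (intro add_left_mono mult_mono add_mono)
        have "real (N\<^sup>2) \<le> real (n * 2 ^ Suc j)" using n0(3) by (simp only: of_nat_le_iff less_imp_le)
        thus "real N ^ 2 / real n \<le> 2 * 2 ^ j" using n0(1) by (simp add: field_simps)
        show "(1 - 1 / (4 * real K)) ^ k j \<le> 1 / real j ^ 2" using r by (simp add: \<rho>_def)
      qed (use \<rho> in \<open>auto simp: \<rho>_def\<close>)
      finally show ?thesis by simp
    qed
    have cS: "real (card (S j N)) \<le> C2 * real N ^ 2 * (1 / real j ^ 2)"
      if j: "j \<ge> J1" "2 ^ j \<le> N\<^sup>2" "N \<ge> N1" for j N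
    proof -
      have p2: "1 / 2 ^ j \<le> 1 / real j ^ 2" and j2: "j \<ge> 2" using J1[OF j(1)] by auto
      have "card (S j N) \<le> card (E j N) + card (\<Union>z\<in>RP j N. W (fst z) (snd z) 1 N \<union> W (fst z) (snd z) (-1) N)"
        unfolding S_def by (rule card_Un_le)
      also have "\<dots> \<le> card (E j N) + (\<Sum>z\<in>RP j N. card (W (fst z) (snd z) 1 N) + card (W (fst z) (snd z) (-1) N))"
        by (intro add_left_mono order_trans[OF card_UN_le[OF fRP]] sum_mono card_Un_le)
      finally have "real (card (S j N)) \<le> real (card (E j N) + (\<Sum>z\<in>RP j N. card (W (fst z) (snd z) 1 N) + card (W (fst z) (snd z) (-1) N)))"
        by (simp only: of_nat_le_iff)
      also have "\<dots> = real (card (E j N)) + (\<Sum>z\<in>RP j N. real (card (W (fst z) (snd z) 1 N)) + real (card (W (fst z) (snd z) (-1) N)))"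
        by simp
      also have "(\<Sum>z\<in>RP j N. real (card (W (fst z) (snd z) 1 N)) + real (card (W (fst z) (snd z) (-1) N)))
          \<le> (\<Sum>z\<in>RP j N. 2 * (1 + 2 * 2 ^ j * (32 / real j ^ 2)))"
      proof (rule sum_mono)
        fix z assume z: "z \<in> RP j N"
        hence z': "(fst z, snd z) \<in> RP j N" by simp
        show "real (card (W (fst z) (snd z) 1 N)) + real (card (W (fst z) (snd z) (-1) N)) \<le> 2 * (1 + 2 * 2 ^ j * (32 / real j ^ 2))"
          using cW[OF j(1,2) z', of 1] cW[OF j(1,2) z', of "-1"] by simp
      qed
      also have "\<dots> = real (card (RP j N)) * (2 * (1 + 2 * 2 ^ j * (32 / real j ^ 2)))" by simp
      also have "\<dots> \<le> (real C1 * (real N ^ 2 / 2 ^ j)) * (2 * (1 + 2 * 2 ^ j * (32 / real j ^ 2)))"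
      proof (rule mult_right_mono)
        have "card (RP j N) \<le> card (root_pairs u (N\<^sup>2 div 2 ^ j))"
          unfolding RP_def by (rule card_mono[OF finite_root_pairs]) auto
        also have "\<dots> \<le> C1 * (N\<^sup>2 div 2 ^ j)" using j(2) by (intro C1) (simp add: Suc_le_eq div_greater_zero_iff)
        finally have "real (card (RP j N)) \<le> real (C1 * (N\<^sup>2 div 2 ^ j))" by (simp only: of_nat_le_iff)
        also have "\<dots> \<le> real C1 * (real (N\<^sup>2) / real (2 ^ j))"
          unfolding of_nat_mult by (intro mult_left_mono of_nat_div_le_of_nat) simp
        finally show "real (card (RP j N)) \<le> real C1 * (real N ^ 2 / 2 ^ j)" by simp
      qed simp
      also have "\<dots> = real C1 * real N ^ 2 * (2 * (1 / 2 ^ j) + 128 * (1 / real j ^ 2))"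
        by (simp add: field_simps)
      also have "\<dots> \<le> real C1 * real N ^ 2 * (2 * (1 / real j ^ 2) + 128 * (1 / real j ^ 2))"
        using p2 by (intro mult_left_mono add_right_mono) auto
      also have "real (card (E j N)) \<le> 6 * real D * real N ^ 2 * (1 / real j ^ 2)"
        by (rule cE[OF j(1) N1[OF j(3,2)]])
      finally show ?thesis by (simp add: C2_def algebra_simps)
    qed
    have cov: "Bad \<Lambda> N \<subseteq> Z N \<union> (\<Union>j\<in>{j\<in>{J..N\<^sup>2}. 2 ^ j \<le> N\<^sup>2}. S j N)" if N: "N \<ge> 1" for N
    proof safe
      fix x y assume xy: "(x, y) \<in> Bad \<Lambda> N" and ns: "(x, y) \<notin> (\<Union>j\<in>{j\<in>{J..N\<^sup>2}. 2 ^ j \<le> N\<^sup>2}. S j N)"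
      obtain q where q: "\<Lambda> * N\<^sup>2 < q" "int (q\<^sup>2) dvd hform u x y"
        and b: "x \<in> {1..int N}" "y \<in> {1..int N}" "coprime x y" using xy by (auto simp: Bad_def)
      show "(x, y) \<in> Z N"
      proof (rule ccontr)
        assume "(x, y) \<notin> Z N"
        hence nz: "hform u x y \<noteq> 0" using b by (auto simp: Z_def)
        obtain c where c: "hform u x y = int (q\<^sup>2) * c" using q(2) by (auto simp: dvd_def)
        define n where "n = nat \<bar>c\<bar>"
        have n: "n > 0" using nz c by (auto simp: n_def)
        define \<sigma> where "\<sigma> = sgn c"
        have \<sigma>: "\<sigma> = 1 \<or> \<sigma> = -1" using nz c by (auto simp: \<sigma>_def sgn_if)
        have h: "hform u x y = \<sigma> * int n * (int q)\<^sup>2" unfolding c by (simp add: \<sigma>_def n_def sgn_mult_abs)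
        have nd: "int n dvd hform u x y" unfolding h by simp
        have "n * \<Lambda>\<^sup>2 * N ^ 4 \<le> C0 * N ^ D"
          by (rule small[OF _ b(1,2) q(1)]) (simp add: c n_def abs_mult)
        also have "\<dots> \<le> C0 * N ^ 6" using u(4) N by (intro mult_le_mono2 power_increasing) (auto simp: D_def)
        also have "\<dots> = C0 * N\<^sup>2 * N ^ 4" by (simp add: mult.assoc flip: power_add)
        finally have n1: "n * \<Lambda>\<^sup>2 \<le> C0 * N\<^sup>2" using N by simp
        have "C0 * 2 ^ J \<le> \<Lambda>\<^sup>2"
        proof -
          have "C0 * 2 ^ J \<le> \<Lambda> * 1" by (simp add: \<Lambda>_def)
          also have "\<dots> \<le> \<Lambda> * \<Lambda>" by (intro mult_le_mono2) (simp add: \<Lambda>_def)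
          finally show ?thesis by (simp add: power2_eq_square)
        qed
        hence "n * (C0 * 2 ^ J) \<le> C0 * N\<^sup>2" using n1 by (meson le_trans mult_le_mono2)
        moreover have "C0 > 0"
        proof (rule ccontr)
          assume "\<not> C0 > 0"
          thus False using n1 n by (simp add: \<Lambda>_def)
        qed
        ultimately have nJ: "n * 2 ^ J \<le> N\<^sup>2" by (simp add: mult.left_commute)
        define j where "j = (GREATEST j. n * 2 ^ j \<le> N\<^sup>2)"
        have bd: "i \<le> N\<^sup>2" if "n * 2 ^ i \<le> N\<^sup>2" for i
        proof -
          have "i \<le> 2 ^ i" by (simp add: less_exp less_imp_le)
          also have "\<dots> \<le> n * 2 ^ i" using n by simp
          finally show ?thesis using that by simp
        qed
        have j1: "n * 2 ^ j \<le> N\<^sup>2" unfolding j_def by (rule GreatestI_nat[where P = "\<lambda>j. n * 2 ^ j \<le> N\<^sup>2", OF nJ]) (use bd in blast)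
        have jJ: "J \<le> j" unfolding j_def by (rule Greatest_le_nat[where P = "\<lambda>j. n * 2 ^ j \<le> N\<^sup>2", OF nJ]) (use bd in blast)
        have j2: "N\<^sup>2 < n * 2 ^ Suc j"
        proof (rule ccontr)
          assume "\<not> ?thesis"
          hence "n * 2 ^ Suc j \<le> N\<^sup>2" by simp
          hence "Suc j \<le> j" unfolding j_def by (rule Greatest_le_nat[where P = "\<lambda>j. n * 2 ^ j \<le> N\<^sup>2"]) (use bd in blast)
          thus False by simp
        qed
        have "2 ^ j \<le> n * 2 ^ j" using n by simp
        hence j3: "2 ^ j \<le> N\<^sup>2" using j1 by (rule le_trans)
        have jm: "j \<in> {j\<in>{J..N\<^sup>2}. 2 ^ j \<le> N\<^sup>2}" using jJ bd[OF j1] j3 by simp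
        have "(x, y) \<in> S j N"
        proof (cases "(x, y) \<in> E j N")
          case False
          obtain w where w: "w < n" "int n dvd poly u (int w)" "int n dvd x - int w * y"
            using form_ratio_root[OF u(1) n nd b(3)] by blast
          have Wm: "(x, y) \<in> W n w \<sigma> N" using b w(3) h by (auto simp: W_def)
          have Lf: "finite (Ls j)" using Ls[of j] jJ by (simp add: good_def J_def)
          have "card {l\<in>Ls j. l dvd n} \<le> card {l\<in>Ls j. int l dvd hform u x y}"
            using Lf nd by (intro card_mono) (auto intro: dvd_trans[of "int _" "int n"])
          also have "\<dots> \<le> k j" using False b by (simp add: E_def)
          finally have cl: "card {l\<in>Ls j. l dvd n} \<le> k j" .
          have "N\<^sup>2 div 2 ^ j < 2 * n" using j2 by (intro less_mult_imp_div_less) (simp add: mult_ac)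
          moreover have "n \<le> N\<^sup>2 div 2 ^ j" using j1 by (simp add: less_eq_div_iff_mult_less_eq)
          ultimately have "(n, w) \<in> RP j N" using w j2 cl by (simp add: RP_def root_pairs_def)
          moreover have "(x, y) \<in> W n w 1 N \<union> W n w (-1) N" using Wm \<sigma> by blast
          ultimately show ?thesis unfolding S_def by (intro UnI2[OF UN_I[of "(n, w)"]]) simp_all
        qed (simp add: S_def)
        thus False using ns jm by blast
      qed
    qed
    have "real (card (Bad \<Lambda> N)) \<le> \<epsilon> * real N ^ 2" if N: "N \<ge> N1 + N2 + 1" for N
    proof -
      define Js where "Js = {j\<in>{J..N\<^sup>2}. 2 ^ j \<le> N\<^sup>2}"
      have fS: "finite (S j N)" for j unfolding S_def using fE fRP fW by auto
      have "card (Bad \<Lambda> N) \<le> card (Z N \<union> (\<Union>j\<in>Js. S j N))"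
        unfolding Js_def using N fZ fS by (intro card_mono cov) auto
      also have "\<dots> \<le> card (Z N) + card (\<Union>j\<in>Js. S j N)" by (rule card_Un_le)
      also have "\<dots> \<le> D + (\<Sum>j\<in>Js. card (S j N))" by (intro add_mono cZ card_UN_le) (simp add: Js_def)
      finally have "real (card (Bad \<Lambda> N)) \<le> real (D + (\<Sum>j\<in>Js. card (S j N)))" by (simp only: of_nat_le_iff)
      also have "\<dots> = real D + (\<Sum>j\<in>Js. real (card (S j N)))" by simp
      also have "(\<Sum>j\<in>Js. real (card (S j N))) \<le> (\<Sum>j\<in>Js. C2 * real N ^ 2 * (1 / real j ^ 2))"
      proof (rule sum_mono)
        fix j assume "j \<in> Js"
        thus "real (card (S j N)) \<le> C2 * real N ^ 2 * (1 / real j ^ 2)"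
          using N by (intro cS) (auto simp: Js_def J_def)
      qed
      also have "\<dots> = C2 * real N ^ 2 * (\<Sum>j\<in>Js. 1 / real j ^ 2)" by (simp add: sum_distrib_left)
      also have "\<dots> \<le> C2 * real N ^ 2 * (1 / (real J - 1))"
      proof (rule mult_left_mono)
        have "(\<Sum>j\<in>Js. 1 / real j ^ 2) \<le> (\<Sum>j=J..N\<^sup>2. 1 / real j ^ 2)"
          by (rule sum_mono2) (auto simp: Js_def)
        also have "\<dots> \<le> 1 / (real J - 1)" by (rule sum_inverse_squares_le) (simp add: J_def)
        finally show "(\<Sum>j\<in>Js. 1 / real j ^ 2) \<le> 1 / (real J - 1)" .
      qed (simp add: C2_def)
      also have "C2 * (1 / (real J - 1)) \<le> \<epsilon> / 2"
      proof -
        have "2 * C2 / \<epsilon> < real J - 1" using J2 by (simp add: J_def)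
        moreover have "0 < real J - 1" by (simp add: J_def)
        ultimately show ?thesis using \<epsilon> by (simp add: field_simps)
      qed
      hence "C2 * real N ^ 2 * (1 / (real J - 1)) \<le> \<epsilon> / 2 * real N ^ 2"
        using mult_right_mono[of "C2 * (1 / (real J - 1))" "\<epsilon> / 2" "real N ^ 2"] by (simp add: mult_ac)
      also have "real D \<le> \<epsilon> / 2 * real N ^ 2"
      proof -
        have "real D \<le> \<epsilon> / 2 * real N2" using N2 \<epsilon> by (simp add: field_simps)
        also have "\<dots> \<le> \<epsilon> / 2 * real N ^ 2"
        proof (intro mult_left_mono)
          have "N2 \<le> N" using N by simp
          also have "N \<le> N * N" by (rule le_square)
          finally have "real N2 \<le> real (N * N)" by (simp only: of_nat_le_iff)
          thus "real N2 \<le> real N ^ 2" by (simp add: power2_eq_square)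
        qed (use \<epsilon> in simp)
        finally show ?thesis .
      qed
      finally show ?thesis by (simp add: algebra_simps)
    qed
    thus ?thesis unfolding Bad_def by blast
  qed
qed

section \<open>Local conditions\<close>

lemma poly_taylor_square:
  fixes v :: "int poly"
  shows "h\<^sup>2 dvd poly v (x + h) - poly v x - h * poly (pderiv v) x"
proof (induction v)
  case (pCons a v)
  have "poly (pCons a v) (x + h) - poly (pCons a v) x - h * poly (pderiv (pCons a v)) x
     = (x + h) * (poly v (x + h) - poly v x - h * poly (pderiv v) x) + h\<^sup>2 * poly (pderiv v) x"
    by (simp add: pderiv_pCons power2_eq_square algebra_simps)
  thus ?case using pCons by simp
qed simp

text \<open>Newton iteration towards the value \<tau> instead of 0; since q divides \<tau>, the root
  s is also an approximate solution of v = \<tau>.\<close>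

lemma hensel_value:
  fixes v :: "int poly" and q :: int
  assumes q: "prime q" and root: "q dvd poly v s" and simple: "\<not> q dvd poly (pderiv v) s" and \<tau>: "q dvd \<tau>"
  shows "\<exists>\<xi>. [\<xi> = s] (mod q) \<and> q ^ Suc n dvd poly v \<xi> - \<tau>"
proof (induction n)
  case 0
  show ?case using root \<tau> by (intro exI[of _ s]) simp
next
  case (Suc n)
  then obtain \<xi> where \<xi>: "[\<xi> = s] (mod q)" "q ^ Suc n dvd poly v \<xi> - \<tau>" by blast
  obtain c where c: "poly v \<xi> - \<tau> = q ^ Suc n * c" using \<xi>(2) by (auto simp: dvd_def)
  have "[poly (pderiv v) \<xi> = poly (pderiv v) s] (mod q)"
    unfolding poly_altdef by (intro cong_sum cong_mult cong_pow cong_refl \<xi>(1))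
  hence "\<not> q dvd poly (pderiv v) \<xi>" using simple cong_dvd_iff by blast
  hence "coprime (poly (pderiv v) \<xi>) q" using q by (metis prime_imp_coprime coprime_commute)
  then obtain w where w: "[poly (pderiv v) \<xi> * w = 1] (mod q)" using cong_solve_coprime_int by blast
  define h where "h = q ^ Suc n * (- c * w)"
  have "[poly (pderiv v) \<xi> * w * c = 1 * c] (mod q)" using w by (rule cong_scalar_right)
  hence "q dvd c - c * w * poly (pderiv v) \<xi>" by (simp add: cong_iff_dvd_diff mult_ac dvd_diff_commute)
  hence 1: "q ^ Suc (Suc n) dvd q ^ Suc n * (c - c * w * poly (pderiv v) \<xi>)"
    by (simp add: mult.commute[of q])
  have "q ^ Suc (Suc n) dvd (q ^ Suc n)\<^sup>2" unfolding power_mult[symmetric] by (rule le_imp_power_dvd) simp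
  hence "q ^ Suc (Suc n) dvd h\<^sup>2" unfolding h_def power_mult_distrib by (rule dvd_mult2)
  hence 2: "q ^ Suc (Suc n) dvd poly v (\<xi> + h) - poly v \<xi> - h * poly (pderiv v) \<xi>"
    using poly_taylor_square dvd_trans by blast
  have "poly v (\<xi> + h) - \<tau> = (poly v (\<xi> + h) - poly v \<xi> - h * poly (pderiv v) \<xi>)
      + q ^ Suc n * (c - c * w * poly (pderiv v) \<xi>)"
    using c by (simp add: h_def algebra_simps)
  hence "q ^ Suc (Suc n) dvd poly v (\<xi> + h) - \<tau>" using 1 2 by (metis dvd_add)
  moreover have "[\<xi> + h = s + 0] (mod q)" by (intro cong_add \<xi>(1)) (simp add: h_def cong_0_iff)
  ultimately show ?case by (intro exI[of _ "\<xi> + h"]) simp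
qed

text \<open>For such \<open>m\<close>, with \<open>R\<close> a multiple of the discriminant of \<open>v\<close>, Hensel's lemma provides values of \<open>v\<close>
  that are divisible by \<open>m\<^sup>2\<close> with a quotient prime to \<open>m\<close>.\<close>

definition admissible_modulus :: "int poly \<Rightarrow> int \<Rightarrow> int \<Rightarrow> bool" where
  "admissible_modulus v R m \<longleftrightarrow> m \<noteq> 0 \<and> (\<forall>q. prime q \<longrightarrow> q dvd m \<longrightarrow> \<not> q dvd R \<and> (\<exists>s. q dvd poly v s))"

lemma admissible_modulus_1: "admissible_modulus v R 1"
  by (auto simp: admissible_modulus_def)

lemma admissible_modulus_mult:
  "admissible_modulus v R m \<Longrightarrow> admissible_modulus v R m' \<Longrightarrow> admissible_modulus v R (m * m')"
  by (auto simp: admissible_modulus_def prime_dvd_mult_iff)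

text \<open>This supplies the admissible moduli. With y = R and x = 1 modulo R the value is prime to
  R, and each of its prime divisors q has the root x/R of v modulo q.\<close>

lemma admissible_modulus_hform:
  assumes v: "lead_coeff v = 1" and nz: "hform v (1 + R * s) R \<noteq> 0"
  shows "admissible_modulus v R (hform v (1 + R * s) R)"
  unfolding admissible_modulus_def
proof (intro conjI allI impI nz)
  fix q :: int assume q: "prime q" "q dvd hform v (1 + R * s) R"
  show nR: "\<not> q dvd R"
  proof
    assume d: "q dvd R"
    hence "q dvd 1 + R * s" by (rule prime_dvd_hform_snd[OF v q])
    hence "q dvd 1" using d by (metis add_diff_cancel_right' dvd_diff dvd_mult2)
    thus False using q(1) not_prime_unit by blast
  qed
  hence "coprime R q" using q(1) by (metis prime_imp_coprime coprime_commute)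
  then obtain w where w: "[R * w = 1] (mod q)" using cong_solve_coprime_int by blast
  have "[(1 + R * s) * (R * w) = (1 + R * s) * 1] (mod q)" using w by (rule cong_scalar_left)
  hence "[1 + R * s = ((1 + R * s) * w) * R] (mod q)" by (simp add: mult_ac cong_sym)
  hence "[hform v (1 + R * s) R = R ^ degree v * poly v ((1 + R * s) * w)] (mod q)" by (rule hform_cong_root)
  hence "q dvd R ^ degree v * poly v ((1 + R * s) * w)" using q(2) cong_dvd_iff by blast
  moreover have "\<not> q dvd R ^ degree v" using nR q(1) prime_dvd_power by blast
  ultimately show "\<exists>s. q dvd poly v s" using q(1) by (auto simp: prime_dvd_mult_iff)
qed

text \<open>Stepanov's bound p (1 - 1/(2K)) together with the at most deg v roots does not exhaust
  the residues.\<close>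

lemma power_residue_not_constant:
  fixes v A B :: "int poly"
  assumes p: "prime p" and v: "lead_coeff v = 1" "2 \<le> degree v" and bez: "A * v + B * pderiv v = [:R:]"
    and R: "\<not> int p dvd R" and K: "K = Suc (degree v)" and large: "2 * K * K < p"
    and a: "1 \<le> a" "2 * a < p" and \<epsilon>: "\<not> int p dvd \<epsilon>"
  shows "\<exists>x. \<not> int p dvd poly v x \<and> \<not> [poly v x ^ a = \<epsilon>] (mod int p)"
proof (rule ccontr)
  assume "\<not> ?thesis"
  hence all: "int p dvd poly v x \<or> [poly v x ^ a = \<epsilon>] (mod int p)" for x by blast
  define S1 where "S1 = {x\<in>{0..<int p}. [poly v x ^ a = \<epsilon>] (mod int p)}"
  define S2 where "S2 = {x\<in>{0..<int p}. int p dvd poly v x}"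
  have nd: "\<not> dvdm p v (pderiv v ^ K)"
    using twisted_not_dvdm_pderiv_power[OF p v bez R, of 1 0 0 K] prime_gt_1_nat[OF p] by simp
  have c1: "card S1 * (2 * K) \<le> p * (2 * K - 1)" unfolding S1_def
    by (rule stepanov_power_residues[OF p order_refl K large a \<epsilon> nd])
  have c2: "card S2 \<le> degree v" unfolding S2_def
    by (rule roots_mod_prime_le_degree[OF p monic_not_pconst_dvd[OF p v(1)]])
  have fin: "finite S1" "finite S2" unfolding S1_def S2_def by (rule finite_Collect_conjI, simp)+
  have "{0..<int p} \<subseteq> S1 \<union> S2" using all by (auto simp: S1_def S2_def)
  hence "card {0..<int p} \<le> card (S1 \<union> S2)" using fin by (intro card_mono) auto
  also have "\<dots> \<le> card S1 + card S2" by (rule card_Un_le)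
  finally have "p \<le> card S1 + degree v" using c2 by simp
  hence "p * (2 * K) \<le> (card S1 + degree v) * (2 * K)" by (rule mult_le_mono1)
  also have "\<dots> \<le> p * (2 * K - 1) + degree v * (2 * K)" using c1 by (simp add: add_mult_distrib)
  finally have "p * (2 * K) \<le> p * (2 * K - 1) + degree v * (2 * K)" .
  moreover have "p * (2 * K) = p * (2 * K - 1) + p"
  proof -
    have "2 * K = Suc (2 * K - 1)" using K by simp
    thus ?thesis by (metis add.commute mult_Suc_right)
  qed
  moreover have "degree v * (2 * K) \<le> K * (2 * K)" using K by (intro mult_le_mono1) simp
  ultimately have "p \<le> K * (2 * K)" by linarith
  thus False using large by (simp add: mult_ac)
qed

text \<open>Such an H is a subgroup of the units modulo p, written with representatives. The two
  claims are Lagrange's theorem: the order is an exponent, and a proper subgroup has a coset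
  disjoint from it.\<close>

lemma residue_subset_power_card:
  fixes H :: "int set" and p :: nat
  assumes p: "prime p" and H: "H \<subseteq> {1..<int p}" "1 \<in> H" and mult: "\<And>x y. x \<in> H \<Longrightarrow> y \<in> H \<Longrightarrow> (x * y) mod int p \<in> H"
  shows "\<And>h. h \<in> H \<Longrightarrow> [h ^ card H = 1] (mod int p)" "H \<noteq> {1..<int p} \<Longrightarrow> 2 * card H < p"
proof -
  have fH: "finite H" using H finite_subset by blast
  have pi: "prime (int p)" using p by simp
  have nd: "\<not> int p dvd x" if "x \<in> {1..<int p}" for x using that by (auto dest: zdvd_imp_le)
  have inj: "inj_on (\<lambda>y. (x * y) mod int p) {1..<int p}" if x: "x \<in> {1..<int p}" for x
  proof (rule inj_onI)
    fix y z assume yz: "y \<in> {1..<int p}" "z \<in> {1..<int p}" "(x * y) mod int p = (x * z) mod int p"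
    hence "int p dvd x * (y - z)" by (simp add: mod_eq_dvd_iff right_diff_distrib)
    hence "int p dvd y - z" using nd[OF x] pi by (simp add: prime_dvd_mult_iff)
    moreover have "\<bar>y - z\<bar> < int p" using yz by auto
    ultimately have "y - z = 0" by (metis abs_of_nat dvd_imp_le_int not_le)
    thus "y = z" by simp
  qed
  have perm: "(\<lambda>y. (x * y) mod int p) ` H = H" if x: "x \<in> H" for x
  proof (rule endo_inj_surj[OF fH])
    show "(\<lambda>y. (x * y) mod int p) ` H \<subseteq> H" using mult[OF x] by auto
    show "inj_on (\<lambda>y. (x * y) mod int p) H" using inj_on_subset[OF inj[of x] H(1)] x H(1) by auto
  qed
  show "[h ^ card H = 1] (mod int p)" if h: "h \<in> H" for h
  proof -
    have "(\<Prod>y\<in>H. y) = (\<Prod>y\<in>(\<lambda>y. (h * y) mod int p) ` H. y)" using perm[OF h] by simp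
    also have "\<dots> = (\<Prod>y\<in>H. (h * y) mod int p)"
      using inj_on_subset[OF inj[of h] H(1)] h H(1) by (subst prod.reindex) auto
    finally have "[(\<Prod>y\<in>H. h * y) = (\<Prod>y\<in>H. y)] (mod int p)"
      by (simp only:) (intro cong_prod, simp)
    hence "int p dvd (h ^ card H - 1) * (\<Prod>y\<in>H. y)"
      by (simp add: prod.distrib cong_iff_dvd_diff left_diff_distrib)
    moreover have "\<not> int p dvd (\<Prod>y\<in>H. y)"
      using nd H prime_dvd_prod_iff[OF fH pi, of "\<lambda>y. y"] by blast
    ultimately show ?thesis using pi by (simp add: prime_dvd_mult_iff cong_iff_dvd_diff)
  qed
  assume "H \<noteq> {1..<int p}"
  then obtain r where r: "r \<in> {1..<int p}" "r \<notin> H" using H by blast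
  define G where "G = (\<lambda>y. (r * y) mod int p) ` H"
  have cG: "card G = card H" unfolding G_def by (rule card_image[OF inj_on_subset[OF inj[OF r(1)] H(1)]])
  have "G \<inter> H = {}"
  proof (rule ccontr)
    assume "G \<inter> H \<noteq> {}"
    then obtain y where y: "y \<in> H" "(r * y) mod int p \<in> H" by (auto simp: G_def)
    have "1 \<in> (\<lambda>z. (y * z) mod int p) ` H" unfolding perm[OF y(1)] by (rule H(2))
    then obtain z where z: "z \<in> H" "(y * z) mod int p = 1" by (elim imageE) simp
    have "((r * y) mod int p * z) mod int p \<in> H" by (rule mult[OF y(2) z(1)])
    also have "((r * y) mod int p * z) mod int p = (r * ((y * z) mod int p)) mod int p"
      by (simp add: mod_mult_left_eq mod_mult_right_eq mult.assoc)
    also have "\<dots> = r" using r(1) z(2) by simp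
    finally show False using r(2) by simp
  qed
  moreover have "G \<subseteq> {1..<int p}"
  proof
    fix g assume "g \<in> G"
    then obtain y where y: "y \<in> H" "g = (r * y) mod int p" by (auto simp: G_def)
    have "\<not> int p dvd r * y" using nd r(1) y(1) H pi by (meson prime_dvd_mult_iff subsetD)
    hence "g \<noteq> 0" using y(2) by (simp add: dvd_eq_mod_eq_0)
    moreover have "0 \<le> g" "g < int p" using y(2) prime_gt_0_nat[OF p] by auto
    ultimately show "g \<in> {1..<int p}" by simp
  qed
  hence "card (G \<union> H) \<le> card {1..<int p}" using H(1) by (intro card_mono) auto
  moreover have "finite G" using fH by (simp add: G_def)
  ultimately have "card G + card H \<le> p - 1" using fH by (simp add: card_Un_disjoint)
  thus "2 * card H < p" using cG prime_gt_0_nat[OF p] by simp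
qed

text \<open>The classes of admissible moduli form a subgroup containing all unit values of the form
  at y = R. If it were proper, its order a < p/2 would make v(x)^a constant on nonroots,
  contradicting \<open>power_residue_not_constant\<close>.\<close>

lemma admissible_modulus_residues:
  fixes v A B :: "int poly"
  assumes p: "prime p" and v: "lead_coeff v = 1" "2 \<le> degree v" and bez: "A * v + B * pderiv v = [:R:]"
    and R: "\<not> int p dvd R" and K: "K = Suc (degree v)" and large: "2 * K * K < p"
    and s: "\<not> int p dvd s"
  shows "\<exists>m. admissible_modulus v R m \<and> [m = s] (mod int p)"
proof -
  have pi: "prime (int p)" using p by simp
  have p0: "p > 0" by (rule prime_gt_0_nat[OF p])
  define H where "H = {h\<in>{1..<int p}. \<exists>m. admissible_modulus v R m \<and> [m = h] (mod int p)}"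
  have Hmem: "m mod int p \<in> H" if m: "admissible_modulus v R m" "\<not> int p dvd m" for m
  proof -
    have "m mod int p \<noteq> 0" using m(2) by (simp add: dvd_eq_mod_eq_0)
    moreover have "0 \<le> m mod int p" "m mod int p < int p" using p0 by auto
    ultimately have "m mod int p \<in> {1..<int p}" by simp
    thus ?thesis using m(1) unfolding H_def by (auto intro!: exI[of _ m])
  qed
  have H1: "1 \<in> H" using Hmem[OF admissible_modulus_1] prime_gt_1_nat[OF p] by simp
  have Hsub: "H \<subseteq> {1..<int p}" by (auto simp: H_def)
  have Hmult: "(x * y) mod int p \<in> H" if xy: "x \<in> H" "y \<in> H" for x y
  proof -
    obtain m m' where m: "admissible_modulus v R m" "[m = x] (mod int p)" "admissible_modulus v R m'" "[m' = y] (mod int p)"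
      using xy by (auto simp: H_def)
    have c: "[m * m' = x * y] (mod int p)" using m by (intro cong_mult)
    have "\<not> int p dvd x" "\<not> int p dvd y" using xy by (auto simp: H_def dest: zdvd_imp_le)
    hence "\<not> int p dvd x * y" using pi by (simp add: prime_dvd_mult_iff)
    hence "\<not> int p dvd m * m'" using c cong_dvd_iff by blast
    hence "(m * m') mod int p \<in> H" using m by (intro Hmem admissible_modulus_mult)
    moreover have "(x * y) mod int p = (m * m') mod int p" using cong_sym[OF c] unfolding unique_euclidean_semiring_class.cong_def .
    ultimately show ?thesis by (simp only:)
  qed
  have "H = {1..<int p}"
  proof (rule ccontr)
    assume ne: "H \<noteq> {1..<int p}"
    define a where "a = card H"
    have fH: "finite H" using Hsub finite_subset by blast
    have a1: "1 \<le> a" using H1 fH by (simp add: a_def Suc_le_eq card_gt_0_iff) blast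
    have a2: "2 * a < p" unfolding a_def by (rule residue_subset_power_card(2)[OF p Hsub H1 Hmult ne])
    define c where "c = (R ^ degree v) ^ a"
    have "\<not> int p dvd c" unfolding c_def using R pi prime_dvd_power by blast
    hence "coprime c (int p)" using pi by (metis prime_imp_coprime coprime_commute)
    then obtain \<epsilon> where \<epsilon>: "[c * \<epsilon> = 1] (mod int p)" using cong_solve_coprime_int by blast
    have n\<epsilon>: "\<not> int p dvd \<epsilon>"
    proof
      assume "int p dvd \<epsilon>"
      hence "int p dvd c * \<epsilon>" by simp
      hence "int p dvd 1" using \<epsilon> cong_dvd_iff by blast
      thus False using pi not_prime_unit by blast
    qed
    obtain x where x: "\<not> int p dvd poly v x" "\<not> [poly v x ^ a = \<epsilon>] (mod int p)"
      using power_residue_not_constant[OF p v bez R K large a1 a2 n\<epsilon>] by blast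
    have "coprime R (int p)" using R pi by (metis prime_imp_coprime coprime_commute)
    then obtain w where w: "[R * w = 1] (mod int p)" using cong_solve_coprime_int by blast
    \<comment> \<open>With this t the first argument 1 + R t equals x R modulo p, so the admissible
      value realises the ratio x.\<close>
    define t where "t = w * (x * R - 1)"
    have "[R * w * (x * R - 1) = 1 * (x * R - 1)] (mod int p)" using w by (rule cong_scalar_right)
    hence "[1 + R * t = x * R] (mod int p)" by (simp add: t_def cong_iff_dvd_diff algebra_simps)
    hence h: "[hform v (1 + R * t) R = R ^ degree v * poly v x] (mod int p)" by (rule hform_cong_root)
    have "\<not> int p dvd R ^ degree v * poly v x" using x(1) R pi
      by (metis prime_dvd_mult_iff prime_dvd_power)
    hence nh: "\<not> int p dvd hform v (1 + R * t) R" using h cong_dvd_iff by blast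
    hence "hform v (1 + R * t) R \<noteq> 0" by auto
    hence "hform v (1 + R * t) R mod int p \<in> H" using nh by (intro Hmem admissible_modulus_hform v(1))
    hence "[(hform v (1 + R * t) R mod int p) ^ a = 1] (mod int p)"
      unfolding a_def using residue_subset_power_card(1)[OF p Hsub H1 Hmult] by blast
    moreover have "[hform v (1 + R * t) R mod int p = hform v (1 + R * t) R] (mod int p)" by simp
    hence "[(hform v (1 + R * t) R mod int p) ^ a = hform v (1 + R * t) R ^ a] (mod int p)" by (rule cong_pow)
    ultimately have "[hform v (1 + R * t) R ^ a = 1] (mod int p)" by (meson cong_sym cong_trans)
    moreover have "[hform v (1 + R * t) R ^ a = (R ^ degree v * poly v x) ^ a] (mod int p)" using h by (rule cong_pow)
    ultimately have "[c * poly v x ^ a = 1] (mod int p)"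
      unfolding c_def power_mult_distrib[symmetric] by (meson cong_sym cong_trans)
    hence "[c * poly v x ^ a = c * \<epsilon>] (mod int p)" using \<epsilon> by (meson cong_sym cong_trans)
    hence "[poly v x ^ a = \<epsilon>] (mod int p)" using \<open>coprime c (int p)\<close> by (simp add: cong_mult_lcancel)
    thus False using x(2) by simp
  qed
  moreover have "s mod int p \<in> {1..<int p}"
  proof -
    have "s mod int p \<noteq> 0" using s by (simp add: dvd_eq_mod_eq_0)
    moreover have "0 \<le> s mod int p" "s mod int p < int p" using p0 by auto
    ultimately show ?thesis by simp
  qed
  ultimately have "s mod int p \<in> H" by simp
  then obtain m where "admissible_modulus v R m" "[m = s mod int p] (mod int p)" unfolding H_def by blast
  thus ?thesis by (auto simp: cong_def)
qed

text \<open>The values c v(x) need not reach r, but some c r v(x) is a nonzero square y^2. Then m =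
  y/r solves c v(x) = r m^2, and its class contains an admissible modulus.\<close>

lemma target_residue:
  fixes v A B :: "int poly"
  assumes p: "prime p" and v: "lead_coeff v = 1" "2 \<le> degree v" and bez: "A * v + B * pderiv v = [:R:]"
    and R: "\<not> int p dvd R" and K: "K = Suc (degree v)" and large: "2 * K * K < p"
    and c: "\<not> int p dvd c" and r: "\<not> int p dvd r"
  shows "\<exists>x m. admissible_modulus v R m \<and> \<not> int p dvd m \<and> [c * poly v x = r * m\<^sup>2] (mod int p)"
proof -
  have pi: "prime (int p)" using p by simp
  have p2: "p > 2" using K large v by (simp add: mult_eq_if)
  define h where "h = (p - 1) div 2"
  have h: "1 \<le> h" "2 * h < p" using p2 by (auto simp: h_def)
  define \<kappa> where "\<kappa> = (c * r) ^ h"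
  have ncr: "\<not> int p dvd c * r" using c r pi by (simp add: prime_dvd_mult_iff)
  hence n\<kappa>: "\<not> int p dvd - \<kappa>" unfolding \<kappa>_def dvd_minus_iff using pi prime_dvd_power by blast
  obtain x where x: "\<not> int p dvd poly v x" "\<not> [poly v x ^ h = - \<kappa>] (mod int p)"
    using power_residue_not_constant[OF p v bez R K large h n\<kappa>] by blast
  have k: "[\<kappa> = 1] (mod int p) \<or> [\<kappa> = -1] (mod int p)"
    unfolding \<kappa>_def h_def by (rule fermat_half_power(2)[OF p p2 ncr])
  have px: "[poly v x ^ h = 1] (mod int p) \<or> [poly v x ^ h = -1] (mod int p)"
    unfolding h_def by (rule fermat_half_power(2)[OF p p2 x(1)])
  have "[\<kappa> * poly v x ^ h = 1] (mod int p)"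
    using k
  proof
    assume a: "[\<kappa> = 1] (mod int p)"
    hence "[- \<kappa> = -1] (mod int p)" by (simp add: cong_minus_minus_iff)
    hence "[poly v x ^ h = 1] (mod int p)" using px x(2) by (meson cong_sym cong_trans)
    thus ?thesis using cong_mult[OF a] by fastforce
  next
    assume a: "[\<kappa> = -1] (mod int p)"
    hence "[- \<kappa> = - (-1)] (mod int p)" by (simp only: cong_minus_minus_iff)
    hence "[- \<kappa> = 1] (mod int p)" by simp
    hence "[poly v x ^ h = -1] (mod int p)" using px x(2) by (meson cong_sym cong_trans)
    thus ?thesis using cong_mult[OF a] by fastforce
  qed
  hence e: "[(c * r * poly v x) ^ h = 1] (mod int p)" by (simp add: \<kappa>_def power_mult_distrib)
  have leg: "[Legendre (c * r * poly v x) (int p) = (c * r * poly v x) ^ h] (mod int p)"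
    unfolding h_def by (rule euler_criterion[OF p p2])
  have "QuadRes (int p) (c * r * poly v x)"
  proof (rule ccontr)
    assume nq: "\<not> ?thesis"
    have "\<not> [c * r * poly v x = 0] (mod int p)" using ncr x(1) pi by (simp add: cong_0_iff prime_dvd_mult_iff)
    hence "Legendre (c * r * poly v x) (int p) = -1" using nq by (simp add: Legendre_def)
    hence "[-1 = 1] (mod int p)" using leg e by (metis cong_trans)
    hence "int p dvd 2" by (simp add: cong_iff_dvd_diff)
    hence "int p \<le> 2" by (rule zdvd_imp_le) simp
    thus False using p2 by simp
  qed
  then obtain y where y: "[y\<^sup>2 = c * r * poly v x] (mod int p)" by (auto simp: QuadRes_def)
  have "coprime r (int p)" using r pi by (metis prime_imp_coprime coprime_commute)
  then obtain w where w: "[r * w = 1] (mod int p)" using cong_solve_coprime_int by blast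
  have ny: "\<not> int p dvd y"
  proof
    assume "int p dvd y"
    hence "int p dvd y\<^sup>2" by (simp add: power2_eq_square)
    hence "int p dvd c * r * poly v x" using y cong_dvd_iff by blast
    thus False using ncr x(1) pi by (simp add: prime_dvd_mult_iff)
  qed
  have nw: "\<not> int p dvd w"
  proof
    assume "int p dvd w"
    hence "int p dvd r * w" by simp
    hence "int p dvd 1" using w cong_dvd_iff by blast
    thus False using pi not_prime_unit by blast
  qed
  have nyw: "\<not> int p dvd y * w" using ny nw pi by (simp add: prime_dvd_mult_iff)
  obtain m where m: "admissible_modulus v R m" "[m = y * w] (mod int p)"
    using admissible_modulus_residues[OF p v bez R K large nyw] by blast
  have "[r * m\<^sup>2 = r * (y * w)\<^sup>2] (mod int p)" by (intro cong_scalar_left cong_pow m(2))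
  also have "r * (y * w)\<^sup>2 = (r * w) * w * y\<^sup>2" by (simp add: power2_eq_square)
  also have "[(r * w) * w * y\<^sup>2 = 1 * w * (c * r * poly v x)] (mod int p)"
    by (intro cong_mult w y cong_refl)
  also have "1 * w * (c * r * poly v x) = (r * w) * (c * poly v x)" by simp
  also have "[(r * w) * (c * poly v x) = 1 * (c * poly v x)] (mod int p)" by (intro cong_mult w cong_refl)
  finally have "[c * poly v x = r * m\<^sup>2] (mod int p)" by (simp add: cong_sym)
  moreover have "\<not> int p dvd m" using m(2) nyw cong_dvd_iff by blast
  ultimately show ?thesis using m(1) by blast
qed

text \<open>Agreement with m^2 modulo m^3, rather than mere divisibility by m^2, makes the cofactor
  congruent to 1 modulo m.\<close>

lemma admissible_modulus_square_value:
  fixes v A B :: "int poly" and m :: nat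
  assumes bez: "A * v + B * pderiv v = [:R:]" and m: "admissible_modulus v R (int m)"
  shows "\<exists>\<xi>. int m ^ 3 dvd poly v \<xi> - (int m)\<^sup>2"
proof -
  define P where "P = prime_factors m"
  define e where "e q = 3 * multiplicity q m" for q
  have m0: "m \<noteq> 0" using m by (simp add: admissible_modulus_def)
  have "\<exists>\<xi>::nat. int (q ^ e q) dvd poly v (int \<xi>) - (int m)\<^sup>2" if q: "q \<in> P" for q
  proof -
    have qp: "prime q" "q dvd m" using q by (auto simp: P_def)
    have qi: "prime (int q)" "int q dvd int m" using qp by auto
    have "\<not> int q dvd R \<and> (\<exists>s. int q dvd poly v s)" using m qi unfolding admissible_modulus_def by blast
    then obtain s where s: "int q dvd poly v s" "\<not> int q dvd R" by blast
    have "\<not> int q dvd poly (pderiv v) s"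
    proof
      assume d: "int q dvd poly (pderiv v) s"
      have "poly A s * poly v s + poly B s * poly (pderiv v) s = R"
        using arg_cong[OF bez, of "\<lambda>q. poly q s"] by simp
      hence "int q dvd R" using s(1) d by (metis dvd_add dvd_mult)
      thus False using s(2) by simp
    qed
    from hensel_value[OF qi(1) s(1) this, of "(int m)\<^sup>2" "e q"] obtain \<xi> where
      \<xi>: "int q ^ Suc (e q) dvd poly v \<xi> - (int m)\<^sup>2" using qi(2) by (auto simp: power2_eq_square)
    define x where "x = nat (\<xi> mod int (q ^ e q))"
    have q0: "q ^ e q > 0" using qp(1) prime_gt_0_nat by simp
    have x: "int x = \<xi> mod int (q ^ e q)" using q0 by (simp add: x_def del: of_nat_power)
    have "[poly v (int x) = poly v \<xi>] (mod int (q ^ e q))"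
      unfolding poly_altdef x by (intro cong_sum cong_mult cong_pow cong_refl) (simp del: of_nat_power)
    hence "[poly v (int x) - (int m)\<^sup>2 = poly v \<xi> - (int m)\<^sup>2] (mod int (q ^ e q))" by (intro cong_diff cong_refl)
    moreover have "int (q ^ e q) dvd poly v \<xi> - (int m)\<^sup>2" using \<xi> by (auto intro: dvd_trans[rotated])
    ultimately have "int (q ^ e q) dvd poly v (int x) - (int m)\<^sup>2" using cong_dvd_iff by blast
    thus ?thesis by blast
  qed
  then obtain u :: "nat \<Rightarrow> nat" where u: "\<And>q. q \<in> P \<Longrightarrow> int (q ^ e q) dvd poly v (int (u q)) - (int m)\<^sup>2" by metis
  have cop: "coprime (q ^ e q) (q' ^ e q')" if "q \<in> P" "q' \<in> P" "q \<noteq> q'" for q q'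
  proof -
    have "coprime q q'" using that by (intro primes_coprime) (auto simp: P_def in_prime_factors_iff)
    thus ?thesis by simp
  qed
  obtain x where x: "\<forall>q\<in>P. [x = u q] (mod q ^ e q)"
    using chinese_remainder_nat[of P "\<lambda>q. q ^ e q" u] cop by (auto simp: P_def)
  have d: "int (q ^ e q) dvd poly v (int x) - (int m)\<^sup>2" if q: "q \<in> P" for q
  proof -
    have "[int x = int (u q)] (mod int (q ^ e q))" using x q by (simp only: cong_int_iff)
    hence "[poly v (int x) = poly v (int (u q))] (mod int (q ^ e q))"
      unfolding poly_altdef by (intro cong_sum cong_mult cong_pow cong_refl)
    hence "[poly v (int x) - (int m)\<^sup>2 = poly v (int (u q)) - (int m)\<^sup>2] (mod int (q ^ e q))" by (intro cong_diff cong_refl)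
    thus ?thesis using u[OF q] cong_dvd_iff by blast
  qed
  have "(\<Prod>q\<in>L. int (q ^ e q)) dvd poly v (int x) - (int m)\<^sup>2" if "L \<subseteq> P" for L
  proof -
    have "finite L" using that by (rule finite_subset) (simp add: P_def)
    thus ?thesis using that
    proof (induction L rule: finite_induct)
      case (insert l L)
      have "coprime (int (l ^ e l)) (\<Prod>q\<in>L. int (q ^ e q))"
      proof (rule prod_coprime_right)
        fix k assume "k \<in> L"
        hence "coprime (l ^ e l) (k ^ e k)" using insert by (intro cop) auto
        thus "coprime (int (l ^ e l)) (int (k ^ e k))" by (simp only: coprime_int_iff)
      qed
      moreover have "int (l ^ e l) dvd poly v (int x) - (int m)\<^sup>2" using d insert by auto
      ultimately show ?case using insert by (simp add: divides_mult del: of_nat_power)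
    qed simp
  qed
  from this[OF order_refl] have "(\<Prod>q\<in>P. int (q ^ e q)) dvd poly v (int x) - (int m)\<^sup>2" .
  also have "(\<Prod>q\<in>P. int (q ^ e q)) = int ((\<Prod>q\<in>P. q ^ multiplicity q m) ^ 3)"
    by (simp add: e_def prod_power_distrib power_mult[symmetric] mult.commute)
  also have "(\<Prod>q\<in>P. q ^ multiplicity q m) = m" unfolding P_def using prod_prime_factors[OF m0] by simp
  finally show ?thesis by auto
qed

text \<open>Three independent conditions are glued: modulo m^3 the form equals m^2, modulo p it
  equals r m^2 / c, and at the remaining primes up to z it is a unit. The square m^2 is fixed before
  z, so z may later be taken as large as required.\<close>

lemma local_conditions:
  fixes v A B :: "int poly"
  assumes p: "prime p" and v: "lead_coeff v = 1" "2 \<le> degree v" and bez: "A * v + B * pderiv v = [:R:]"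
    and R: "\<not> int p dvd R" and K: "K = Suc (degree v)" and large: "2 * K * K < p"
    and c: "\<not> int p dvd c" and r: "\<not> int p dvd r"
  shows "\<exists>m::nat. m > 0 \<and> (\<forall>z::nat. \<exists>Q x0 y0. Q > 0 \<and> (\<forall>q. prime q \<longrightarrow> q \<le> z \<longrightarrow> q dvd Q) \<and>
     (\<forall>x y. [x = x0] (mod int Q) \<longrightarrow> [y = y0] (mod int Q) \<longrightarrow>
        (\<forall>q. prime q \<longrightarrow> q dvd Q \<longrightarrow> \<not> (int q dvd x \<and> int q dvd y)) \<and>
        (\<exists>E. hform v x y = (int m)\<^sup>2 * E \<and> (\<forall>q. prime q \<longrightarrow> q dvd Q \<longrightarrow> \<not> int q dvd E) \<and> [c * E = r] (mod int p))))"
proof -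
  obtain xp m0 where m0: "admissible_modulus v R m0" "\<not> int p dvd m0" "[c * poly v xp = r * m0\<^sup>2] (mod int p)"
    using target_residue[OF p v bez R K large c r] by blast
  define m where "m = nat \<bar>m0\<bar>"
  have im: "int m = \<bar>m0\<bar>" by (simp add: m_def)
  have m: "admissible_modulus v R (int m)" using m0(1) by (simp add: im admissible_modulus_def)
  have mpos: "m > 0" using m0(1) by (simp add: m_def admissible_modulus_def)
  have npm: "\<not> p dvd m" using m0(2) by (simp add: im flip: int_dvd_int_iff)
  have cm: "[c * poly v xp = r * (int m)\<^sup>2] (mod int p)" using m0(3) by (simp add: im)
  obtain \<xi> where \<xi>: "int m ^ 3 dvd poly v \<xi> - (int m)\<^sup>2" using admissible_modulus_square_value[OF bez m] by blast
  show ?thesis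
  proof (rule exI[of _ m], rule conjI[OF mpos], rule allI)
    fix z :: nat
    define PW where "PW = {q. prime q \<and> q \<le> z \<and> \<not> q dvd m \<and> q \<noteq> p}"
    have fPW: "finite PW" unfolding PW_def by (rule finite_subset[of _ "{..z}"]) auto
    define W where "W = \<Prod>PW"
    have copm: "coprime m p" using npm p by (metis prime_imp_coprime coprime_commute)
    hence copmp: "coprime (m ^ 3) p" by simp
    have copW: "coprime (m ^ 3 * p) W" unfolding W_def
    proof (rule prod_coprime_right)
      fix q assume q: "q \<in> PW"
      hence qq: "prime q" "\<not> q dvd m" "q \<noteq> p" by (auto simp: PW_def)
      have "coprime m q" using qq by (metis prime_imp_coprime coprime_commute)
      moreover have "coprime p q" using qq p by (simp add: primes_coprime)
      ultimately show "coprime (m ^ 3 * p) q" by simp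
    qed
    define Q where "Q = m ^ 3 * p * W"
    have W0: "W > 0" unfolding W_def by (rule prod_pos) (auto simp: PW_def dest: prime_gt_0_nat)
    have Q0: "Q > 0" using mpos prime_gt_0_nat[OF p] W0 by (simp add: Q_def)
    have cop1: "coprime (int (m ^ 3)) (int p)" "coprime (int (m ^ 3 * p)) (int W)"
      using copmp copW by (simp_all only: coprime_int_iff)
    obtain x1 where x1: "[x1 = \<xi>] (mod int (m ^ 3))" "[x1 = xp] (mod int p)"
      using binary_chinese_remainder_int[OF cop1(1)] by blast
    obtain x0 where x0: "[x0 = x1] (mod int (m ^ 3 * p))" "[x0 = 1] (mod int W)"
      using binary_chinese_remainder_int[OF cop1(2)] by blast
    \<comment> \<open>At the primes of \<open>W\<close> the point is (1, 0), where a monic form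
      takes the value 1.\<close>
    obtain y0 where y0: "[y0 = 1] (mod int (m ^ 3 * p))" "[y0 = 0] (mod int W)"
      using binary_chinese_remainder_int[OF cop1(2)] by blast
    have qW: "q dvd W \<longleftrightarrow> q \<in> PW" if "prime q" for q
    proof -
      have "q dvd W \<longleftrightarrow> (\<exists>k\<in>PW. q dvd k)" unfolding W_def by (rule prime_dvd_prod_iff[OF fPW that])
      also have "\<dots> \<longleftrightarrow> q \<in> PW" using that by (auto simp: PW_def dest: primes_dvd_imp_eq)
      finally show ?thesis .
    qed
    show "\<exists>Q x0 y0. Q > 0 \<and> (\<forall>q. prime q \<longrightarrow> q \<le> z \<longrightarrow> q dvd Q) \<and>
     (\<forall>x y. [x = x0] (mod int Q) \<longrightarrow> [y = y0] (mod int Q) \<longrightarrow>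
        (\<forall>q. prime q \<longrightarrow> q dvd Q \<longrightarrow> \<not> (int q dvd x \<and> int q dvd y)) \<and>
        (\<exists>E. hform v x y = (int m)\<^sup>2 * E \<and> (\<forall>q. prime q \<longrightarrow> q dvd Q \<longrightarrow> \<not> int q dvd E) \<and> [c * E = r] (mod int p)))"
    proof (rule exI[of _ Q], rule exI[of _ x0], rule exI[of _ y0], rule conjI[OF Q0], rule conjI; (intro allI impI)?)
      fix q :: nat assume q: "prime q" "q \<le> z"
      show "q dvd Q"
      proof (cases "q dvd m \<or> q = p")
        case True
        thus ?thesis by (auto simp: Q_def intro: dvd_trans[of q m] dvd_power)
      next
        case False
        hence "q dvd W" using q qW by (simp add: PW_def)
        thus ?thesis by (simp add: Q_def)
      qed
    next
      fix x y assume x: "[x = x0] (mod int Q)" and y: "[y = y0] (mod int Q)"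
      have xm: "[x = \<xi>] (mod int (m ^ 3))" "[x = xp] (mod int p)" "[x = 1] (mod int W)"
      proof -
        have "[x = x0] (mod int (m ^ 3 * p))" "[x = x0] (mod int W)"
          by (rule cong_dvd_modulus[OF x], simp add: Q_def)+
        hence 1: "[x = x1] (mod int (m ^ 3 * p))" and 2: "[x = 1] (mod int W)"
          using x0 by (blast intro: cong_trans)+
        show "[x = 1] (mod int W)" by (rule 2)
        have "[x = x1] (mod int (m ^ 3))" "[x = x1] (mod int p)" by (rule cong_dvd_modulus[OF 1], simp)+
        thus "[x = \<xi>] (mod int (m ^ 3))" "[x = xp] (mod int p)" using x1 by (blast intro: cong_trans)+
      qed
      have ym: "[y = 1] (mod int (m ^ 3))" "[y = 1] (mod int p)" "[y = 0] (mod int W)"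
      proof -
        have "[y = y0] (mod int (m ^ 3 * p))" "[y = y0] (mod int W)"
          by (rule cong_dvd_modulus[OF y], simp add: Q_def)+
        hence 1: "[y = 1] (mod int (m ^ 3 * p))" and 2: "[y = 0] (mod int W)"
          using y0 by (blast intro: cong_trans)+
        show "[y = 0] (mod int W)" by (rule 2)
        show "[y = 1] (mod int (m ^ 3))" "[y = 1] (mod int p)" by (rule cong_dvd_modulus[OF 1], simp)+
      qed
      have cases: "q dvd m \<or> q = p \<or> q dvd W" if "prime q" "q dvd Q" for q
        using that p by (auto simp: Q_def prime_dvd_mult_iff primes_dvd_imp_eq dest: prime_dvd_power)
      have one: "\<not> int q dvd t" if "prime q" "[t = 1] (mod int M)" "q dvd M" for q M t
      proof
        assume "int q dvd t"
        moreover have "[t = 1] (mod int q)" using that(2) by (rule cong_dvd_modulus) (use that(3) in simp)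
        ultimately have "int q dvd 1" using cong_dvd_iff by blast
        thus False using that(1) by simp
      qed
      have nxy: "\<not> (int q dvd x \<and> int q dvd y)" if q: "prime q" "q dvd Q" for q
        using cases[OF q]
      proof (elim disjE)
        assume "q dvd m"
        hence "q dvd m ^ 3" by (auto intro: dvd_trans[of q m] dvd_power)
        thus ?thesis using one[OF q(1) ym(1)] by blast
      next
        assume "q = p"
        thus ?thesis using one[OF q(1) ym(2)] by auto
      next
        assume "q dvd W"
        thus ?thesis using one[OF q(1) xm(3)] by blast
      qed
      have val: "[hform v x y = poly v s] (mod M)" if "[x = s] (mod M)" "[y = 1] (mod M)" for s M
      proof -
        have "[hform v x y = hform v (s * 1) 1] (mod M)" using that by (intro hform_cong_args) simp_all
        thus ?thesis using hform_scale[of v s 1] by simp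
      qed
      have "int m ^ 3 dvd hform v x y - poly v \<xi>" using val[OF xm(1) ym(1)] by (simp add: cong_iff_dvd_diff)
      hence "int m ^ 3 dvd (hform v x y - poly v \<xi>) + (poly v \<xi> - (int m)\<^sup>2)" using \<xi> by (rule dvd_add)
      hence "int m ^ 3 dvd hform v x y - (int m)\<^sup>2" by simp
      then obtain t where t: "hform v x y - (int m)\<^sup>2 = int m ^ 3 * t" by (auto simp: dvd_def)
      define E where "E = 1 + int m * t"
      have HE: "hform v x y = (int m)\<^sup>2 * E" using t by (simp add: E_def algebra_simps power2_eq_square power3_eq_cube)
      have cE: "[c * E = r] (mod int p)"
      proof -
        have "[c * hform v x y = c * poly v xp] (mod int p)" by (intro cong_scalar_left val xm ym)
        hence "[c * hform v x y = r * (int m)\<^sup>2] (mod int p)" using cm by (rule cong_trans)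
        hence "[(c * E) * (int m)\<^sup>2 = r * (int m)\<^sup>2] (mod int p)" by (simp add: HE mult_ac)
        moreover have "coprime ((int m)\<^sup>2) (int p)" using copm by simp
        ultimately show ?thesis by (simp add: cong_mult_rcancel)
      qed
      have "\<not> int q dvd E" if q: "prime q" "q dvd Q" for q
        using cases[OF q]
      proof (elim disjE)
        assume "q dvd m"
        thus ?thesis using one[OF q(1), of E m] by (simp add: E_def cong_iff_dvd_diff)
      next
        assume qp: "q = p"
        show ?thesis
        proof
          assume "int q dvd E"
          hence "int p dvd c * E" using qp by simp
          thus False using cE r cong_dvd_iff by blast
        qed
      next
        assume qW: "q dvd W"
        have "[hform v x y = x ^ degree v] (mod y)" by (rule hform_mod_second[OF v(1)])
        moreover have "int q dvd y" using ym(3) qW by (metis cong_0_iff dvd_trans int_dvd_int_iff)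
        ultimately have "[hform v x y = x ^ degree v] (mod int q)" using cong_dvd_modulus by blast
        moreover have "\<not> int q dvd x ^ degree v" using one[OF q(1) xm(3) qW] q(1) prime_dvd_power[of "int q"] by auto
        ultimately have "\<not> int q dvd hform v x y" using cong_dvd_iff by blast
        thus ?thesis unfolding HE by (blast intro: dvd_mult)
      qed
      hence "\<exists>E. hform v x y = (int m)\<^sup>2 * E \<and> (\<forall>q. prime q \<longrightarrow> q dvd Q \<longrightarrow> \<not> int q dvd E) \<and> [c * E = r] (mod int p)"
        using HE cE by blast
      thus "(\<forall>q. prime q \<longrightarrow> q dvd Q \<longrightarrow> \<not> (int q dvd x \<and> int q dvd y)) \<and>
        (\<exists>E. hform v x y = (int m)\<^sup>2 * E \<and> (\<forall>q. prime q \<longrightarrow> q dvd Q \<longrightarrow> \<not> int q dvd E) \<and> [c * E = r] (mod int p))"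
        using nxy by blast
    qed
  qed
qed

section \<open>Squarefree values of a binary form\<close>

lemma card_two_congruences_le:
  fixes Q M q :: nat and S :: "int set"
  assumes cop: "coprime Q q" and pos: "Q > 0" "q > 0" and S: "finite S" "S \<subseteq> {0..<int q}"
  shows "card {x\<in>{1..int (Q * M)}. [x = x0] (mod int Q) \<and> x mod int q \<in> S} \<le> Suc (M div q) * card S"
proof -
  define I where "I = {x\<in>{1..int (Q * M)}. [x = x0] (mod int Q) \<and> x mod int q \<in> S}"
  define f where "f x = (nat (x - 1) div (Q * q), x mod int q)" for x
  have "f ` I \<subseteq> {..M div q} \<times> S"
  proof (rule image_subsetI)
    fix x assume x: "x \<in> I"
    have "x \<in> {1..int (Q * M)}" using x by (simp add: I_def)
    hence "nat (x - 1) \<le> Q * M" by (simp add: nat_le_iff)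
    hence "nat (x - 1) div (Q * q) \<le> Q * M div (Q * q)" by (rule div_le_mono)
    also have "\<dots> = M div q" using pos by simp
    finally show "f x \<in> {..M div q} \<times> S" using x by (simp add: f_def I_def)
  qed
  moreover have "inj_on f I"
  proof (rule inj_onI)
    fix i j assume ij: "i \<in> I" "j \<in> I" "f i = f j"
    have "i mod int q = j mod int q" using ij(3) by (simp add: f_def)
    hence d1: "int q dvd i - j" by (simp add: mod_eq_dvd_iff)
    have "[i = x0] (mod int Q)" "[j = x0] (mod int Q)" using ij by (auto simp: I_def)
    hence "[i = j] (mod int Q)" by (meson cong_sym cong_trans)
    hence d2: "int Q dvd i - j" by (simp add: cong_iff_dvd_diff)
    have "coprime (int Q) (int q)" using cop by simp
    hence "int Q * int q dvd i - j" using d1 d2 by (intro divides_mult)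
    hence d: "int (Q * q) dvd i - j" by simp
    define P where "P = Q * q"
    have P0: "P > 0" using pos by (simp add: P_def)
    have rng: "i \<in> {1..int (Q * M)}" "j \<in> {1..int (Q * M)}" using ij by (simp_all add: I_def)
    define s where "s = nat (i - 1) div P"
    have s: "nat (i - 1) div P = s" "nat (j - 1) div P = s" using ij(3) by (auto simp: f_def s_def P_def)
    have qq: "s * P \<le> x \<and> x < s * P + P" if "x div P = s" for x
      unfolding that[symmetric] using div_mult_mod_eq[of x P] mod_less_divisor[OF P0, of x] by linarith
    have "s * P \<le> nat (i - 1)" "nat (i - 1) < s * P + P" "s * P \<le> nat (j - 1)" "nat (j - 1) < s * P + P"
      using qq[OF s(1)] qq[OF s(2)] by auto
    hence "\<bar>int (nat (i - 1)) - int (nat (j - 1))\<bar> < int P" by linarith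
    hence "\<bar>i - j\<bar> < int P" using rng by auto
    hence "i - j = 0" using d unfolding P_def by (metis abs_of_nat dvd_imp_le_int not_le)
    thus "i = j" by simp
  qed
  ultimately have "card I \<le> card ({..M div q} \<times> S)" using S(1) by (metis card_image card_mono finite_SigmaI finite_atMost)
  thus ?thesis by (simp add: I_def card_cartesian_product)
qed

text \<open>As q does not divide R, roots modulo q are simple, so reduction from roots modulo q^2 to
  roots modulo q is injective.\<close>

lemma card_roots_mod_prime_square_le:
  fixes v A B :: "int poly"
  assumes q: "prime q" and v: "lead_coeff v = 1" and bez: "A * v + B * pderiv v = [:R:]" and R: "\<not> int q dvd R"
  shows "card {s\<in>{0..<int (q\<^sup>2)}. int (q\<^sup>2) dvd poly v s} \<le> degree v"
proof -
  define S where "S = {s\<in>{0..<int (q\<^sup>2)}. int (q\<^sup>2) dvd poly v s}"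
  define T where "T = {s\<in>{0..<int q}. int q dvd poly v s}"
  have qi: "prime (int q)" using q by simp
  have q0: "q > 0" by (rule prime_gt_0_nat[OF q])
  have qq: "int q dvd int (q\<^sup>2)" by (simp add: power2_eq_square)
  have "(\<lambda>s. s mod int q) ` S \<subseteq> T"
  proof (rule image_subsetI)
    fix s assume s: "s \<in> S"
    have "int q dvd poly v s" using s qq unfolding S_def by (blast intro: dvd_trans)
    moreover have "[poly v (s mod int q) = poly v s] (mod int q)"
      unfolding poly_altdef by (intro cong_sum cong_mult cong_pow cong_refl) simp
    ultimately have "int q dvd poly v (s mod int q)" using cong_dvd_iff by blast
    thus "s mod int q \<in> T" using q0 by (simp add: T_def)
  qed
  moreover have "inj_on (\<lambda>s. s mod int q) S"
  proof (rule inj_onI)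
    fix s t assume st: "s \<in> S" "t \<in> S" "s mod int q = t mod int q"
    hence "int q dvd t - s" by (simp add: mod_eq_dvd_iff dvd_diff_commute)
    then obtain h where h: "t = s + int q * h" by (metis dvd_def add.commute diff_add_cancel)
    have vs: "int (q\<^sup>2) dvd poly v s" "int (q\<^sup>2) dvd poly v t" using st by (simp_all add: S_def)
    have "int (q\<^sup>2) dvd (int q * h)\<^sup>2" by (simp add: power_mult_distrib)
    hence "int (q\<^sup>2) dvd poly v (s + int q * h) - poly v s - int q * h * poly (pderiv v) s"
      using poly_taylor_square dvd_trans by blast
    hence "int (q\<^sup>2) dvd (poly v t - poly v s) - (poly v t - poly v s - int q * h * poly (pderiv v) s)"
      unfolding h[symmetric] by (rule dvd_diff[OF dvd_diff[OF vs(2,1)]])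
    hence "int q * int q dvd int q * (h * poly (pderiv v) s)" by (simp add: power2_eq_square mult_ac)
    hence "int q dvd h * poly (pderiv v) s" using q0 by simp
    moreover have "\<not> int q dvd poly (pderiv v) s"
    proof
      assume d: "int q dvd poly (pderiv v) s"
      have "int q dvd poly v s" using vs(1) qq dvd_trans by blast
      moreover have "poly A s * poly v s + poly B s * poly (pderiv v) s = R"
        using arg_cong[OF bez, of "\<lambda>q. poly q s"] by simp
      ultimately show False using d R by (metis dvd_add dvd_mult)
    qed
    ultimately have "int q dvd h" using qi by (simp add: prime_dvd_mult_iff)
    hence "int (q\<^sup>2) dvd t - s" by (simp add: h power2_eq_square)
    moreover have "\<bar>t - s\<bar> < int (q\<^sup>2)" using st by (auto simp: S_def)
    ultimately have "t - s = 0" by (metis abs_of_nat dvd_imp_le_int not_le)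
    thus "s = t" by simp
  qed
  moreover have "finite T" unfolding T_def by (rule finite_Collect_conjI) simp
  ultimately have "card S \<le> card T" by (metis card_image card_mono)
  also have "\<dots> \<le> degree v" unfolding T_def
    by (rule roots_mod_prime_le_degree[OF q monic_not_pconst_dvd[OF q v]])
  finally show ?thesis by (simp add: S_def)
qed

lemma sum_inverse_squares_primes_le:
  assumes "1 \<le> z" "finite A" "\<And>q. q \<in> A \<Longrightarrow> z < q"
  shows "(\<Sum>q\<in>A. 1 / real q ^ 2) \<le> 1 / real z"
proof (cases "A = {}")
  case False
  have "A \<subseteq> {Suc z..Max A}" using assms by (auto simp: Suc_le_eq)
  hence "(\<Sum>q\<in>A. 1 / real q ^ 2) \<le> (\<Sum>q=Suc z..Max A. 1 / real q ^ 2)" by (intro sum_mono2) auto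
  also have "\<dots> \<le> 1 / (real (Suc z) - 1)" by (rule sum_inverse_squares_le) (use assms in simp)
  finally show ?thesis by simp
qed simp

section \<open>Factors of a monic form\<close>

lemma hform_prod_mset:
  assumes "y \<noteq> 0" "0 \<notin># F"
  shows "hform (prod_mset F) x y = (\<Prod>u\<in>#F. hform u x y)"
  using assms(2)
proof (induction F)
  case empty
  show ?case by (simp add: hform_def)
next
  case (add u F)
  have "prod_mset F \<noteq> 0" using add by (simp add: prod_mset_zero_iff)
  thus ?case using add assms(1) by (simp add: hform_mult)
qed

lemma irreducible_factors_monic:
  fixes v u :: "int poly"
  assumes v: "lead_coeff v = 1" and u: "u \<in> prime_factors v"
  shows "lead_coeff u = 1" "irreducible u" "1 \<le> degree u" "u dvd v"
proof -
  have p: "prime u" "u dvd v" using u by auto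
  show "u dvd v" by (rule p(2))
  show "irreducible u" using p(1) by (simp add: prime_elem_imp_irreducible)
  obtain w where w: "v = u * w" using p(2) by (auto simp: dvd_def)
  have "lead_coeff u * lead_coeff w = 1" using v unfolding w by (simp add: lead_coeff_mult)
  hence "lead_coeff u dvd 1" by (metis dvd_triv_left)
  hence 1: "\<bar>lead_coeff u\<bar> = 1" by simp
  have "normalize u = u" using p(1) by (simp add: normalize_prime)
  hence "unit_factor u = 1" using p(1) by (metis prime_def prime_elem_not_zeroI unit_factor_normalize)
  hence "coeff (unit_factor u) 0 = 1" by simp
  hence "sgn (lead_coeff u) = 1" by (simp add: unit_factor_poly_def)
  thus lc: "lead_coeff u = 1" using 1 by (simp add: sgn_if split: if_splits)
  show "1 \<le> degree u"
  proof (rule ccontr)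
    assume "\<not> 1 \<le> degree u"
    hence "u = [:coeff u 0:]" by (metis degree_0_id less_one not_le)
    moreover have "coeff u 0 = 1" using lc \<open>\<not> 1 \<le> degree u\<close> by (metis less_one not_le)
    ultimately have "u = [:1:]" by simp
    hence "u = 1" by simp
    thus False using p(1) by simp
  qed
qed

lemma prime_dvd_hform_factor:
  fixes v :: "int poly" and q :: int
  assumes v: "lead_coeff v = 1" and y: "y \<noteq> 0" and q: "prime q" "q dvd hform v x y"
  shows "\<exists>u\<in>prime_factors v. q dvd hform u x y"
proof -
  have v0: "v \<noteq> 0" using v by auto
  have norm: "normalize p = p" if "lead_coeff p = 1" for p :: "int poly"
  proof -
    have "unit_factor p = 1" using that by (simp add: unit_factor_poly_def)
    thus ?thesis using unit_factor_mult_normalize[of p] by simp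
  qed
  have "lead_coeff (prod_mset F) = 1" if "\<forall>u\<in>#F. lead_coeff u = 1" for F :: "int poly multiset"
    using that by (induction F) (auto simp: lead_coeff_mult)
  hence "lead_coeff (prod_mset (prime_factorization v)) = 1" using irreducible_factors_monic(1)[OF v] by blast
  hence "prod_mset (prime_factorization v) = v"
    using prod_mset_prime_factorization_weak[OF v0] norm v by metis
  moreover have "0 \<notin># prime_factorization v" by auto
  ultimately have "hform v x y = (\<Prod>u\<in>#prime_factorization v. hform u x y)" using hform_prod_mset[OF y] by metis
  hence "q dvd (\<Prod>u\<in>#prime_factorization v. hform u x y)" using q(2) by simp
  thus ?thesis using q(1) by (auto simp: prime_dvd_prod_mset_iff)
qed

text \<open>The ratio x/y is a simple root of v modulo q, so q divides only one of the two factors u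
  and w = v/u, and q^2 falls entirely on that factor.\<close>

lemma prime_square_dvd_hform_factor:
  fixes v A B :: "int poly" and q :: nat
  assumes v: "lead_coeff v = 1" and bez: "A * v + B * pderiv v = [:R:]" and R: "\<not> int q dvd R"
    and y: "y \<noteq> 0" and q: "prime q" "int (q\<^sup>2) dvd hform v x y" and cop: "coprime x y"
  shows "\<exists>u\<in>prime_factors v. int (q\<^sup>2) dvd hform u x y"
proof -
  have qi: "prime (int q)" using q by simp
  have q0: "q > 0" using q(1) by (rule prime_gt_0_nat)
  have qd: "int q dvd hform v x y" using q(2) by (auto simp: power2_eq_square intro: dvd_trans[OF dvd_triv_left])
  obtain u where u: "u \<in> prime_factors v" "int q dvd hform u x y"
    using prime_dvd_hform_factor[OF v y qi qd] by blast
  note um = irreducible_factors_monic[OF v u(1)]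
  obtain w where w: "v = u * w" using um(4) by (auto simp: dvd_def)
  have uw0: "u \<noteq> 0" "w \<noteq> 0" using v w by auto
  have hv: "hform v x y = hform u x y * hform w x y" unfolding w by (rule hform_mult[OF y uw0])
  have "\<not> int q dvd hform w x y"
  proof
    assume a: "int q dvd hform w x y"
    have copq: "coprime y (int q)" by (rule coprime_second_of_dvd_hform[OF v q0 qd cop])
    obtain s where s: "int q dvd poly v (int s)" "int q dvd x - int s * y"
      using form_ratio_root_coprime[OF q0 qd copq] by blast
    have sc: "[x = int s * y] (mod int q)" using s(2) by (simp add: cong_iff_dvd_diff)
    have ev: "int q dvd poly p (int s)" if "int q dvd hform p x y" for p
    proof -
      have "int q dvd y ^ degree p * poly p (int s)" using hform_cong_root[OF sc, of p] that cong_dvd_iff by blast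
      thus ?thesis using copq by (simp add: coprime_dvd_mult_right_iff coprime_commute)
    qed
    have "int q dvd poly (pderiv v) (int s)" unfolding w using ev[OF u(2)] ev[OF a] by (simp add: pderiv_mult)
    moreover have "poly A (int s) * poly v (int s) + poly B (int s) * poly (pderiv v) (int s) = R"
      using arg_cong[OF bez, of "\<lambda>q. poly q (int s)"] by simp
    ultimately show False using s(1) R by (metis dvd_add dvd_mult)
  qed
  hence "coprime (int (q\<^sup>2)) (hform w x y)" using qi by (simp add: prime_imp_coprime)
  hence "int (q\<^sup>2) dvd hform u x y" using q(2) unfolding hv by (simp add: coprime_dvd_mult_left_iff)
  thus ?thesis using u(1) by blast
qed

lemma card_form_value_le:
  assumes u: "lead_coeff u = 1" "1 \<le> degree u"
  shows "finite {x. hform u x y = t}" "card {x. hform u x y = t} \<le> degree u"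
proof -
  define D where "D = degree u"
  define P where "P = (\<Sum>k\<le>D. monom (coeff u k * y ^ (D - k)) k) - [:t:]"
  have cP: "coeff P k = (if k \<le> D then coeff u k * y ^ (D - k) else 0) - (if k = 0 then t else 0)" for k
    by (simp add: P_def coeff_sum coeff_pCons split: nat.split)
  have "coeff P D = 1" using u by (simp add: cP D_def)
  hence P0: "P \<noteq> 0" by auto
  have dP: "degree P \<le> D" by (rule degree_le) (auto simp: cP)
  have eq: "{x. hform u x y = t} = {x. poly P x = 0}"
    by (simp add: P_def poly_sum poly_monom hform_def D_def mult_ac)
  show "finite {x. hform u x y = t}" unfolding eq by (rule poly_roots_finite[OF P0])
  show "card {x. hform u x y = t} \<le> degree u"
    unfolding eq using card_poly_roots_bound[OF P0] dP by (simp add: D_def)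
qed

section \<open>Counting points in a residue class by their common and square divisors\<close>

lemma card_class_ge:
  fixes Q M :: nat and x0 :: int
  assumes Q: "Q > 0"
  shows "M \<le> card {x\<in>{1..int (Q * M)}. [x = x0] (mod int Q)}"
proof -
  define r where "r = (x0 - 1) mod int Q + 1"
  have r: "1 \<le> r" "r \<le> int Q" "[r = x0] (mod int Q)"
  proof -
    have "0 \<le> (x0 - 1) mod int Q" "(x0 - 1) mod int Q < int Q" using Q by auto
    thus "1 \<le> r" "r \<le> int Q" by (auto simp: r_def)
    have "[(x0 - 1) mod int Q + 1 = (x0 - 1) + 1] (mod int Q)" by (intro cong_add cong_refl) simp
    thus "[r = x0] (mod int Q)" by (simp add: r_def)
  qed
  define f where "f i = r + int Q * int i" for i
  have "f ` {..<M} \<subseteq> {x\<in>{1..int (Q * M)}. [x = x0] (mod int Q)}"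
  proof (rule image_subsetI)
    fix i assume i: "i \<in> {..<M}"
    have "int Q * int i + int Q \<le> int (Q * M)"
    proof -
      have "Q * Suc i \<le> Q * M" using i by (intro mult_le_mono2) auto
      hence "int (Q * Suc i) \<le> int (Q * M)" by (simp only: of_nat_le_iff)
      thus ?thesis by (simp add: algebra_simps)
    qed
    hence "f i \<le> int (Q * M)" using r by (simp add: f_def)
    moreover have "0 \<le> int Q * int i" by simp
    hence "1 \<le> f i" using r unfolding f_def by linarith
    moreover have "[f i = x0 + 0] (mod int Q)" unfolding f_def by (intro cong_add r(3)) (simp add: cong_0_iff)
    ultimately show "f i \<in> {x\<in>{1..int (Q * M)}. [x = x0] (mod int Q)}" by simp
  qed
  hence "card (f ` {..<M}) \<le> card {x\<in>{1..int (Q * M)}. [x = x0] (mod int Q)}"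
    by (intro card_mono finite_Collect_conjI) auto
  moreover have "inj_on f {..<M}" using Q by (auto simp: inj_on_def f_def)
  ultimately show ?thesis by (simp add: card_image)
qed

lemma card_class_le:
  fixes Q M :: nat and x0 :: int
  assumes Q: "Q > 0"
  shows "card {x\<in>{1..int (Q * M)}. [x = x0] (mod int Q)} \<le> Suc M"
  using card_two_congruences_le[of Q 1 "{0}" M x0] Q by simp

lemma card_common_prime_le:
  fixes Q M q :: nat
  assumes Q: "Q > 0" and q: "prime q" "\<not> q dvd Q"
  shows "real (card {(x, y). x \<in> {1..int (Q * M)} \<and> y \<in> {1..int (Q * M)} \<and> [x = x0] (mod int Q) \<and> [y = y0] (mod int Q) \<and>
     int q dvd x \<and> int q dvd y}) \<le> 2 * real M ^ 2 * (1 / real q ^ 2) + 2"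
proof -
  have q0: "q > 0" by (rule prime_gt_0_nat[OF q(1)])
  have cop: "coprime Q q" using q by (metis prime_imp_coprime coprime_commute)
  define X where "X x0 = {x\<in>{1..int (Q * M)}. [x = x0] (mod int Q) \<and> x mod int q \<in> {0}}" for x0
  have cX: "card (X x0) \<le> Suc (M div q)" for x0
    unfolding X_def using card_two_congruences_le[OF cop Q q0, of "{0}" M x0] q0 by simp
  have "{(x, y). x \<in> {1..int (Q * M)} \<and> y \<in> {1..int (Q * M)} \<and> [x = x0] (mod int Q) \<and> [y = y0] (mod int Q) \<and>
     int q dvd x \<and> int q dvd y} = X x0 \<times> X y0" by (auto simp: X_def dvd_eq_mod_eq_0)
  hence "card {(x, y). x \<in> {1..int (Q * M)} \<and> y \<in> {1..int (Q * M)} \<and> [x = x0] (mod int Q) \<and> [y = y0] (mod int Q) \<and>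
     int q dvd x \<and> int q dvd y} \<le> Suc (M div q) * Suc (M div q)"
    using mult_le_mono[OF cX cX] by (simp add: card_cartesian_product del: mult_Suc mult_Suc_right)
  hence "real (card {(x, y). x \<in> {1..int (Q * M)} \<and> y \<in> {1..int (Q * M)} \<and> [x = x0] (mod int Q) \<and> [y = y0] (mod int Q) \<and>
     int q dvd x \<and> int q dvd y}) \<le> real (Suc (M div q) * Suc (M div q))" by (simp only: of_nat_le_iff)
  also have "\<dots> = (real (M div q) + 1) ^ 2" by (simp add: power2_eq_square algebra_simps)
  also have "\<dots> \<le> (real M / real q + 1) ^ 2" by (intro power_mono add_right_mono of_nat_div_le_of_nat) simp
  also have "(a + 1) ^ 2 \<le> 2 * a ^ 2 + 2" for a :: real
    using zero_le_power2[of "a - 1"] by (simp add: power2_eq_square algebra_simps)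
  finally show ?thesis by (simp add: power_divide)
qed

text \<open>Once y is prime to q, the ratio x/y is one of at most deg v roots modulo q^2, so each y
  leaves few classes for x.\<close>

lemma card_prime_square_medium_le:
  fixes v A B :: "int poly" and Q M q :: nat
  assumes v: "lead_coeff v = 1" and bez: "A * v + B * pderiv v = [:R:]" and R: "\<not> int q dvd R"
    and Q: "Q > 0" and q: "prime q" "\<not> q dvd Q"
  shows "real (card {(x, y). x \<in> {1..int (Q * M)} \<and> y \<in> {1..int (Q * M)} \<and> [x = x0] (mod int Q) \<and> [y = y0] (mod int Q) \<and>
     \<not> (int q dvd x \<and> int q dvd y) \<and> int (q\<^sup>2) dvd hform v x y})
    \<le> (real M + 1) * (real (degree v) * (real M * (1 / real q ^ 2) + 1))"
proof -
  define D where "D = degree v"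
  have q0: "q > 0" by (rule prime_gt_0_nat[OF q(1)])
  have qi: "prime (int q)" using q by simp
  have qq: "int q dvd int (q\<^sup>2)" by (simp add: power2_eq_square)
  have cop: "coprime Q (q\<^sup>2)" using q by (metis prime_imp_coprime coprime_commute coprime_power_right_iff)
  define S where "S = {s\<in>{0..<int (q\<^sup>2)}. int (q\<^sup>2) dvd poly v s}"
  have fS: "finite S" unfolding S_def by (rule finite_Collect_conjI) simp
  have cS: "card S \<le> D" unfolding S_def D_def by (rule card_roots_mod_prime_square_le[OF q(1) v bez R])
  define Y where "Y = {y\<in>{1..int (Q * M)}. [y = y0] (mod int Q)}"
  define X where "X y = {x\<in>{1..int (Q * M)}. [x = x0] (mod int Q) \<and> x mod int (q\<^sup>2) \<in> (\<lambda>s. (s * y) mod int (q\<^sup>2)) ` S}" for y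
  have fY: "finite Y" unfolding Y_def by (rule finite_Collect_conjI) simp
  have fX: "finite (X y)" for y unfolding X_def by (rule finite_Collect_conjI) simp
  have cX: "card (X y) \<le> Suc (M div q\<^sup>2) * D" for y
  proof -
    have "card (X y) \<le> Suc (M div q\<^sup>2) * card ((\<lambda>s. (s * y) mod int (q\<^sup>2)) ` S)"
      unfolding X_def using q0 fS by (intro card_two_congruences_le[OF cop Q]) auto
    also have "\<dots> \<le> Suc (M div q\<^sup>2) * D"
      using card_image_le[OF fS, of "\<lambda>s. (s * y) mod int (q\<^sup>2)"] cS by (intro mult_le_mono2) simp
    finally show ?thesis .
  qed
  have "{(x, y). x \<in> {1..int (Q * M)} \<and> y \<in> {1..int (Q * M)} \<and> [x = x0] (mod int Q) \<and> [y = y0] (mod int Q) \<and>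
     \<not> (int q dvd x \<and> int q dvd y) \<and> int (q\<^sup>2) dvd hform v x y} \<subseteq> (\<Union>y\<in>Y. (\<lambda>x. (x, y)) ` X y)"
  proof (rule subrelI)
    fix x y assume "(x, y) \<in> {(x, y). x \<in> {1..int (Q * M)} \<and> y \<in> {1..int (Q * M)} \<and> [x = x0] (mod int Q) \<and> [y = y0] (mod int Q) \<and>
      \<not> (int q dvd x \<and> int q dvd y) \<and> int (q\<^sup>2) dvd hform v x y}"
    hence xy: "x \<in> {1..int (Q * M)}" "y \<in> {1..int (Q * M)}" "[x = x0] (mod int Q)" "[y = y0] (mod int Q)"
      "int (q\<^sup>2) dvd hform v x y" "\<not> (int q dvd x \<and> int q dvd y)" by simp_all
    have "int q dvd hform v x y" using qq xy(5) by (rule dvd_trans)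
    hence "\<not> int q dvd y" by (rule prime_dvd_hform_not_dvd_snd[OF v qi _ xy(6)])
    hence "coprime y (int (q\<^sup>2))" using qi by (metis prime_imp_coprime coprime_commute coprime_power_right_iff of_nat_power)
    then obtain w where w: "w < q\<^sup>2" "int (q\<^sup>2) dvd poly v (int w)" "int (q\<^sup>2) dvd x - int w * y"
      using form_ratio_root_coprime[OF _ xy(5)] q0 by auto
    have "int w \<in> S" using w(1,2) unfolding S_def by (simp del: of_nat_power)
    moreover have "x mod int (q\<^sup>2) = (int w * y) mod int (q\<^sup>2)" using w(3) by (simp only: mod_eq_dvd_iff)
    ultimately have "x \<in> X y" using xy(1,3) by (simp add: X_def del: of_nat_power)
    thus "(x, y) \<in> (\<Union>y\<in>Y. (\<lambda>x. (x, y)) ` X y)" using xy(2,4) by (auto simp: Y_def)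
  qed
  hence "card {(x, y). x \<in> {1..int (Q * M)} \<and> y \<in> {1..int (Q * M)} \<and> [x = x0] (mod int Q) \<and> [y = y0] (mod int Q) \<and>
     \<not> (int q dvd x \<and> int q dvd y) \<and> int (q\<^sup>2) dvd hform v x y} \<le> card (\<Union>y\<in>Y. (\<lambda>x. (x, y)) ` X y)"
    using fY fX by (intro card_mono) auto
  also have "\<dots> \<le> (\<Sum>y\<in>Y. card ((\<lambda>x. (x, y)) ` X y))" by (rule card_UN_le[OF fY])
  also have "\<dots> \<le> (\<Sum>y\<in>Y. Suc (M div q\<^sup>2) * D)"
    by (rule sum_mono) (rule order_trans[OF card_image_le[OF fX] cX])
  also have "\<dots> = card Y * (Suc (M div q\<^sup>2) * D)" by simp
  also have "\<dots> \<le> Suc M * (Suc (M div q\<^sup>2) * D)" unfolding Y_def by (rule mult_le_mono1[OF card_class_le[OF Q]])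
  finally have "real (card {(x, y). x \<in> {1..int (Q * M)} \<and> y \<in> {1..int (Q * M)} \<and> [x = x0] (mod int Q) \<and> [y = y0] (mod int Q) \<and>
     \<not> (int q dvd x \<and> int q dvd y) \<and> int (q\<^sup>2) dvd hform v x y}) \<le> real (Suc M * (Suc (M div q\<^sup>2) * D))" by (simp only: of_nat_le_iff)
  also have "\<dots> = (real M + 1) * (real D * (real (M div q\<^sup>2) + 1))" by (simp add: algebra_simps)
  also have "\<dots> \<le> (real M + 1) * (real D * (real M / real (q\<^sup>2) + 1))"
    by (intro mult_left_mono add_right_mono of_nat_div_le_of_nat) auto
  finally show ?thesis by (simp add: D_def)
qed

text \<open>Two points with the same root modulo q^2 have a determinant x y' - x' y divisible by q^2
  and smaller than q^2. They are proportional, and coprimality makes them equal.\<close>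

lemma card_prime_square_large_le:
  fixes v A B :: "int poly" and N q :: nat
  assumes v: "lead_coeff v = 1" and bez: "A * v + B * pderiv v = [:R:]" and R: "\<not> int q dvd R"
    and q: "prime q" "N < q"
  shows "card {(x, y). x \<in> {1..int N} \<and> y \<in> {1..int N} \<and> coprime x y \<and> int (q\<^sup>2) dvd hform v x y} \<le> degree v"
proof -
  have q0: "q > 0" by (rule prime_gt_0_nat[OF q(1)])
  define S where "S = {s\<in>{0..<int (q\<^sup>2)}. int (q\<^sup>2) dvd poly v s}"
  have fS: "finite S" unfolding S_def by (rule finite_Collect_conjI) simp
  define Z where "Z = {(x, y). x \<in> {1..int N} \<and> y \<in> {1..int N} \<and> coprime x y \<and> int (q\<^sup>2) dvd hform v x y}"
  have "\<forall>z\<in>Z. \<exists>s\<in>S. int (q\<^sup>2) dvd fst z - s * snd z"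
  proof
    fix z assume z: "z \<in> Z"
    have h: "int (q\<^sup>2) dvd hform v (fst z) (snd z)" "coprime (fst z) (snd z)" using z by (auto simp: Z_def)
    have "q\<^sup>2 > 0" using q0 by simp
    from form_ratio_root[OF v this h] obtain w where "w < q\<^sup>2" "int (q\<^sup>2) dvd poly v (int w)" "int (q\<^sup>2) dvd fst z - int w * snd z"
      by blast
    thus "\<exists>s\<in>S. int (q\<^sup>2) dvd fst z - s * snd z" unfolding S_def by (intro bexI[of _ "int w"]) (simp_all del: of_nat_power)
  qed
  then obtain f where f: "\<And>z. z \<in> Z \<Longrightarrow> f z \<in> S \<and> int (q\<^sup>2) dvd fst z - f z * snd z" by metis
  have "inj_on f Z"
  proof (rule inj_onI, safe)
    fix x y x' y' assume z: "(x, y) \<in> Z" "(x', y') \<in> Z" "f (x, y) = f (x', y')"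
    define s where "s = f (x, y)"
    have d: "int (q\<^sup>2) dvd x - s * y" "int (q\<^sup>2) dvd x' - s * y'" using f[OF z(1)] f[OF z(2)] z(3) by (auto simp: s_def)
    have b: "x \<in> {1..int N}" "y \<in> {1..int N}" "coprime x y" "x' \<in> {1..int N}" "y' \<in> {1..int N}" "coprime x' y'"
      using z by (auto simp: Z_def)
    have "x * y' - x' * y = (x - s * y) * y' - (x' - s * y') * y" by (simp add: algebra_simps)
    hence dv: "int (q\<^sup>2) dvd x * y' - x' * y" using d by (metis dvd_diff dvd_mult2)
    have 1: "0 \<le> x * y'" "x * y' \<le> int N * int N" "0 \<le> x' * y" "x' * y \<le> int N * int N"
      using b by (auto intro!: mult_mono)
    have "int N * int N < int q * int q" using q(2) by (intro mult_strict_mono) auto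
    hence "\<bar>x * y' - x' * y\<bar> < int (q\<^sup>2)" using 1 unfolding power2_eq_square of_nat_mult by linarith
    hence "x * y' - x' * y = 0" using dv by (metis abs_of_nat dvd_imp_le_int not_le)
    hence eq: "x * y' = x' * y" by simp
    have "x dvd x' * y" "x' dvd x * y'" using eq by (metis dvd_triv_left)+
    hence "x dvd x'" "x' dvd x" using b(3,6) by (auto simp: coprime_dvd_mult_left_iff)
    hence xx: "x = x'" using b(1,4) by (auto intro: zdvd_antisym_nonneg)
    show "x = x'" by (rule xx)
    show "y = y'" using eq xx b(1) by simp
  qed
  moreover have "f ` Z \<subseteq> S" using f by blast
  ultimately have "card Z \<le> card S" using fS by (metis card_image card_mono)
  also have "\<dots> \<le> degree v" unfolding S_def by (rule card_roots_mod_prime_square_le[OF q(1) v bez R])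
  finally show ?thesis by (simp add: Z_def)
qed

text \<open>Good points make up a positive proportion of the N^2 points of the box. Finitely many E
  would account for only O(N) of them, since a given y and a given value leave at most deg v choices
  of x.\<close>

lemma infinitely_many_squarefree_values:
  fixes v A B :: "int poly" and c r :: int and m p :: nat
  assumes v: "lead_coeff v = 1" "2 \<le> degree v" and bez: "A * v + B * pderiv v = [:R:]" and R: "R \<noteq> 0"
    and fac: "\<And>u. u \<in> prime_factors v \<Longrightarrow> degree u \<le> 6" and m: "m > 0" and c: "c \<noteq> 0"
    and loc: "\<And>z::nat. \<exists>Q x0 y0. Q > 0 \<and> (\<forall>q. prime q \<longrightarrow> q \<le> z \<longrightarrow> q dvd Q) \<and>
     (\<forall>x y. [x = x0] (mod int Q) \<longrightarrow> [y = y0] (mod int Q) \<longrightarrow>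
        (\<forall>q. prime q \<longrightarrow> q dvd Q \<longrightarrow> \<not> (int q dvd x \<and> int q dvd y)) \<and>
        (\<exists>E. hform v x y = (int m)\<^sup>2 * E \<and> (\<forall>q. prime q \<longrightarrow> q dvd Q \<longrightarrow> \<not> int q dvd E) \<and> [c * E = r] (mod int p)))"
  shows "infinite {E. squarefree E \<and> coprime E c \<and> [c * E = r] (mod int p) \<and> (\<exists>x y. x > 0 \<and> hform v x y = (int m)\<^sup>2 * E)}"
proof
  define EE where "EE = {E. squarefree E \<and> coprime E c \<and> [c * E = r] (mod int p) \<and> (\<exists>x y. x > 0 \<and> hform v x y = (int m)\<^sup>2 * E)}"
  assume "finite {E. squarefree E \<and> coprime E c \<and> [c * E = r] (mod int p) \<and> (\<exists>x y. x > 0 \<and> hform v x y = (int m)\<^sup>2 * E)}"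
  hence fE: "finite EE" by (simp add: EE_def)
  define D where "D = degree v"
  have D: "D \<ge> 2" using v by (simp add: D_def)
  define F where "F = prime_factors v"
  have fF: "finite F" by (simp add: F_def)
  \<comment> \<open>Primes above z divide neither R nor c, and 16 (D + 1) <= z bounds the
    contribution of the primes above z through the sum of 1/q^2.\<close>
  define z where "z = 16 * (D + 1) + nat \<bar>R\<bar> + nat \<bar>c\<bar>"
  have nR: "\<not> int q dvd R" if "z < q" for q
  proof
    assume "int q dvd R"
    hence "\<bar>int q\<bar> \<le> \<bar>R\<bar>" using R by (rule dvd_imp_le_int[rotated])
    thus False using that by (simp add: z_def)
  qed
  obtain Q x0 y0 where Q: "Q > 0" "\<And>q. prime q \<Longrightarrow> q \<le> z \<Longrightarrow> q dvd Q"
    and lxy: "\<And>x y. [x = x0] (mod int Q) \<Longrightarrow> [y = y0] (mod int Q) \<Longrightarrow>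
        (\<forall>q. prime q \<longrightarrow> q dvd Q \<longrightarrow> \<not> (int q dvd x \<and> int q dvd y)) \<and>
        (\<exists>E. hform v x y = (int m)\<^sup>2 * E \<and> (\<forall>q. prime q \<longrightarrow> q dvd Q \<longrightarrow> \<not> int q dvd E) \<and> [c * E = r] (mod int p))"
    using loc[of z] by blast
  define \<epsilon> where "\<epsilon> = 1 / (8 * (real (card F) + 1) * real Q ^ 2)"
  have \<epsilon>: "\<epsilon> > 0" using Q(1) by (simp add: \<epsilon>_def)
  define LB where "LB u \<Lambda> N = {(x, y). x \<in> {1..int N} \<and> y \<in> {1..int N} \<and> coprime x y \<and>
     (\<exists>q. \<Lambda> * N\<^sup>2 < q \<and> int (q\<^sup>2) dvd hform u x y)}" for u and \<Lambda> N :: nat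
  have "\<forall>u\<in>F. \<exists>\<Lambda> N0 :: nat. \<forall>N\<ge>N0. real (card (LB u \<Lambda> N)) \<le> \<epsilon> * real N ^ 2"
  proof
    fix u assume u: "u \<in> F"
    note um = irreducible_factors_monic[OF v(1), of u]
    have uF: "u \<in> prime_factors v" using u by (simp add: F_def)
    obtain w where w: "v = u * w" using um(4)[OF uF] by (auto simp: dvd_def)
    have "(A * w + B * pderiv w) * u + (B * w) * pderiv u = [:R:]"
      unfolding bez[symmetric] w by (simp add: pderiv_mult algebra_simps)
    from large_square_divisors[OF um(1)[OF uF] um(2)[OF uF] um(3)[OF uF] fac[OF uF] this R \<epsilon>]
    show "\<exists>\<Lambda> N0 :: nat. \<forall>N\<ge>N0. real (card (LB u \<Lambda> N)) \<le> \<epsilon> * real N ^ 2" unfolding LB_def .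
  qed
  then obtain \<Lambda>u Nu :: "int poly \<Rightarrow> nat" where
    LN: "\<And>u N. u \<in> F \<Longrightarrow> N \<ge> Nu u \<Longrightarrow> real (card (LB u (\<Lambda>u u) N)) \<le> \<epsilon> * real N ^ 2" by metis
  \<comment> \<open>One \<Lambda> serves all factors, so the primes up to \<Lambda> N^2 handled by
    \<open>PL\<close> meet the range of \<open>large_square_divisors\<close> for every u.\<close>
  define \<Lambda> where "\<Lambda> = Suc (\<Sum>u\<in>F. \<Lambda>u u)"
  define NB where "NB = (\<Sum>u\<in>F. Nu u)"
  have LL: "\<Lambda>u u \<le> \<Lambda>" "Nu u \<le> NB" if "u \<in> F" for u
    using member_le_sum[OF that, of \<Lambda>u] member_le_sum[OF that, of Nu] fF by (auto simp: \<Lambda>_def NB_def)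
  define \<eta> where "\<eta> = 1 / (64 * real D * real \<Lambda> * real Q ^ 2)"
  have "\<Lambda> \<ge> 1" by (simp add: \<Lambda>_def)
  hence \<Lambda>1: "real \<Lambda> \<ge> 1" by simp
  have Q1: "real Q \<ge> 1" using Q(1) by simp
  have \<eta>: "\<eta> > 0" using Q1 D \<Lambda>1 by (simp add: \<eta>_def)
  obtain n0 where n0: "\<And>n. n \<ge> n0 \<Longrightarrow> real (prime_count n) \<le> \<eta> * real n" using prime_count_sublinear[OF \<eta>] by blast
  \<comment> \<open>The box side is large enough for the prime estimates and for all factors, and
    its last terms contradict the final inequality M <= 2 (card EE) Q D.\<close>
  define M where "M = 64 * Q + n0 + NB + z + 4 * card EE * Q * D + 1"
  define N where "N = Q * M"
  have MN: "M \<le> N" using Q(1) by (simp add: N_def)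
  have M1: "real M \<ge> 1" by (simp add: M_def)
  have nN: "real N = real Q * real M" by (simp add: N_def)
  define TT where "TT = {(x, y). x \<in> {1..int N} \<and> y \<in> {1..int N} \<and> [x = x0] (mod int Q) \<and> [y = y0] (mod int Q)}"
  have fTT: "finite TT" by (rule finite_subset[of _ "{1..int N} \<times> {1..int N}"]) (auto simp: TT_def)
  have cTT: "real M ^ 2 \<le> real (card TT)"
  proof -
    have "TT = {x\<in>{1..int (Q * M)}. [x = x0] (mod int Q)} \<times> {y\<in>{1..int (Q * M)}. [y = y0] (mod int Q)}"
      by (auto simp: TT_def N_def)
    hence "M * M \<le> card TT" using mult_le_mono[OF card_class_ge[OF Q(1)] card_class_ge[OF Q(1)]]
      by (simp add: card_cartesian_product)
    hence "real (M * M) \<le> real (card TT)" by (simp only: of_nat_le_iff)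
    thus ?thesis by (simp add: power2_eq_square)
  qed
  define PQ where "PQ = {q. prime q \<and> z < q \<and> q \<le> N \<and> \<not> q dvd Q}"
  define PL where "PL = {q. prime q \<and> N < q \<and> q \<le> \<Lambda> * N\<^sup>2}"
  have fPQ: "finite PQ" by (rule finite_subset[OF _ finite_primes_le[of N]]) (auto simp: PQ_def)
  have fPL: "finite PL" by (rule finite_subset[OF _ finite_primes_le[of "\<Lambda> * N\<^sup>2"]]) (auto simp: PL_def)
  have cPQ: "real (card PQ) \<le> \<eta> * real N"
  proof -
    have "card PQ \<le> prime_count N" unfolding prime_count_def by (rule card_mono[OF finite_primes_le]) (auto simp: PQ_def)
    moreover have "real (prime_count N) \<le> \<eta> * real N" using MN by (intro n0) (simp add: M_def)
    ultimately show ?thesis by linarith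
  qed
  have cPL: "real (card PL) \<le> \<eta> * (real \<Lambda> * real N ^ 2)"
  proof -
    have "card PL \<le> prime_count (\<Lambda> * N\<^sup>2)" unfolding prime_count_def by (rule card_mono[OF finite_primes_le]) (auto simp: PL_def)
    moreover have "n0 \<le> \<Lambda> * N\<^sup>2"
    proof -
      have "n0 \<le> N" using MN by (simp add: M_def)
      also have "N \<le> N\<^sup>2" by (simp add: power2_eq_square)
      also have "\<dots> \<le> \<Lambda> * N\<^sup>2" by (simp add: \<Lambda>_def)
      finally show ?thesis .
    qed
    ultimately show ?thesis using n0[of "\<Lambda> * N\<^sup>2"] by simp
  qed
  have sq: "(\<Sum>q\<in>PQ. 1 / real q ^ 2) \<le> 1 / real z"
    by (rule sum_inverse_squares_primes_le[OF _ fPQ]) (auto simp: PQ_def z_def)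
  define B0 where "B0 q = {(x, y). x \<in> {1..int (Q * M)} \<and> y \<in> {1..int (Q * M)} \<and> [x = x0] (mod int Q) \<and> [y = y0] (mod int Q) \<and>
     int q dvd x \<and> int q dvd y}" for q :: nat
  define B1 where "B1 q = {(x, y). x \<in> {1..int (Q * M)} \<and> y \<in> {1..int (Q * M)} \<and> [x = x0] (mod int Q) \<and> [y = y0] (mod int Q) \<and>
     \<not> (int q dvd x \<and> int q dvd y) \<and> int (q\<^sup>2) dvd hform v x y}" for q :: nat
  define B2 where "B2 q = {(x, y). x \<in> {1..int N} \<and> y \<in> {1..int N} \<and> coprime x y \<and> int (q\<^sup>2) dvd hform v x y}" for q :: nat
  define B3 where "B3 u = LB u (\<Lambda>u u) N" for u
  have c0: "real (card (\<Union>q\<in>PQ. B0 q)) \<le> 2 * real M ^ 2 / real z + 2 * (\<eta> * real N)"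
  proof -
    have "card (\<Union>q\<in>PQ. B0 q) \<le> (\<Sum>q\<in>PQ. card (B0 q))" by (rule card_UN_le[OF fPQ])
    hence "real (card (\<Union>q\<in>PQ. B0 q)) \<le> (\<Sum>q\<in>PQ. real (card (B0 q)))" by (simp only: of_nat_le_iff flip: of_nat_sum)
    also have "\<dots> \<le> (\<Sum>q\<in>PQ. 2 * real M ^ 2 * (1 / real q ^ 2) + 2)"
      unfolding B0_def by (rule sum_mono, rule card_common_prime_le[OF Q(1)]) (auto simp: PQ_def)
    also have "\<dots> = 2 * real M ^ 2 * (\<Sum>q\<in>PQ. 1 / real q ^ 2) + 2 * real (card PQ)"
      by (simp add: sum.distrib sum_distrib_left)
    also have "\<dots> \<le> 2 * real M ^ 2 * (1 / real z) + 2 * (\<eta> * real N)"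
      using sq cPQ by (intro add_mono mult_left_mono) auto
    finally show ?thesis by simp
  qed
  have c1: "real (card (\<Union>q\<in>PQ. B1 q)) \<le> 2 * real M * (real D * (real M / real z + \<eta> * real N))"
  proof -
    have "card (\<Union>q\<in>PQ. B1 q) \<le> (\<Sum>q\<in>PQ. card (B1 q))" by (rule card_UN_le[OF fPQ])
    hence "real (card (\<Union>q\<in>PQ. B1 q)) \<le> (\<Sum>q\<in>PQ. real (card (B1 q)))" by (simp only: of_nat_le_iff flip: of_nat_sum)
    also have "\<dots> \<le> (\<Sum>q\<in>PQ. (real M + 1) * (real D * (real M * (1 / real q ^ 2) + 1)))"
      unfolding B1_def D_def
      by (rule sum_mono, rule card_prime_square_medium_le[OF v(1) bez _ Q(1)]) (auto simp: PQ_def nR)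
    also have "\<dots> = (real M + 1) * (real D * (real M * (\<Sum>q\<in>PQ. 1 / real q ^ 2) + real (card PQ)))"
      unfolding sum_distrib_left[symmetric] sum.distrib by simp
    also have "\<dots> \<le> (2 * real M) * (real D * (real M * (1 / real z) + \<eta> * real N))"
      using sq cPQ M1 by (intro mult_mono add_mono mult_left_mono)
        (auto intro!: add_nonneg_nonneg mult_nonneg_nonneg sum_nonneg)
    finally show ?thesis by simp
  qed
  have c2: "real (card (\<Union>q\<in>PL. B2 q)) \<le> \<eta> * (real \<Lambda> * real N ^ 2) * real D"
  proof -
    have zN: "z \<le> N" using MN by (simp add: M_def)
    have "card (\<Union>q\<in>PL. B2 q) \<le> (\<Sum>q\<in>PL. card (B2 q))" by (rule card_UN_le[OF fPL])
    also have "\<dots> \<le> (\<Sum>q\<in>PL. D)" unfolding B2_def D_def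
      by (rule sum_mono, rule card_prime_square_large_le[OF v(1) bez]) (use zN in \<open>auto simp: PL_def nR\<close>)
    finally have "real (card (\<Union>q\<in>PL. B2 q)) \<le> real (\<Sum>q\<in>PL. D)" by (simp only: of_nat_le_iff)
    also have "\<dots> = real (card PL) * real D" by simp
    also have "\<dots> \<le> \<eta> * (real \<Lambda> * real N ^ 2) * real D" using cPL by (intro mult_right_mono) auto
    finally show ?thesis .
  qed
  have c3: "real (card (\<Union>u\<in>F. B3 u)) \<le> real (card F) * (\<epsilon> * real N ^ 2)"
  proof -
    have "card (\<Union>u\<in>F. B3 u) \<le> (\<Sum>u\<in>F. card (B3 u))" by (rule card_UN_le[OF fF])
    hence "real (card (\<Union>u\<in>F. B3 u)) \<le> (\<Sum>u\<in>F. real (card (B3 u)))" by (simp only: of_nat_le_iff flip: of_nat_sum)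
    also have "\<dots> \<le> (\<Sum>u\<in>F. \<epsilon> * real N ^ 2)"
    proof (rule sum_mono)
      fix u assume u: "u \<in> F"
      have "Nu u \<le> N" using LL(2)[OF u] MN by (simp add: M_def)
      thus "real (card (B3 u)) \<le> \<epsilon> * real N ^ 2" unfolding B3_def by (rule LN[OF u])
    qed
    finally show ?thesis by simp
  qed
  define Bad where "Bad = (\<Union>q\<in>PQ. B0 q) \<union> (\<Union>q\<in>PQ. B1 q) \<union> (\<Union>q\<in>PL. B2 q) \<union> (\<Union>u\<in>F. B3 u)"
  have fB: "finite Bad"
    by (rule finite_subset[of _ "{1..int N} \<times> {1..int N}"]) (auto simp: Bad_def B0_def B1_def B2_def B3_def LB_def N_def)
  have "card Bad \<le> card (\<Union>q\<in>PQ. B0 q) + card (\<Union>q\<in>PQ. B1 q) + card (\<Union>q\<in>PL. B2 q) + card (\<Union>u\<in>F. B3 u)"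
    unfolding Bad_def by (intro order_trans[OF card_Un_le] add_mono order_refl)
  hence "real (card Bad) \<le> real (card (\<Union>q\<in>PQ. B0 q)) + real (card (\<Union>q\<in>PQ. B1 q)) + real (card (\<Union>q\<in>PL. B2 q)) + real (card (\<Union>u\<in>F. B3 u))"
    by (simp only: of_nat_le_iff flip: of_nat_add)
  also have "\<dots> \<le> 2 * real M ^ 2 / real z + 2 * (\<eta> * real N) + 2 * real M * (real D * (real M / real z + \<eta> * real N))
     + \<eta> * (real \<Lambda> * real N ^ 2) * real D + real (card F) * (\<epsilon> * real N ^ 2)"
    using c0 c1 c2 c3 by linarith
  also have "\<dots> = 2 * (real D + 1) / real z * real M ^ 2 + 2 * (\<eta> * real N) + 2 * real M * real D * \<eta> * real N
     + \<eta> * (real \<Lambda> * real N ^ 2) * real D + real (card F) * (\<epsilon> * real N ^ 2)"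
    by (simp add: algebra_simps power2_eq_square add_divide_distrib)
  \<comment> \<open>The constants in z, \<epsilon> and \<eta> are tuned so that these five losses
    sum to less than half of the at least M^2 points of the residue class.\<close>
  also have "\<dots> \<le> 1 / 8 * real M ^ 2 + 1 / 32 * real M ^ 2 + 1 / 32 * real M ^ 2 + 1 / 64 * real M ^ 2 + 1 / 8 * real M ^ 2"
  proof (intro add_mono)
    have z16: "16 * (real D + 1) \<le> real z" by (simp add: z_def)
    have z0: "real z > 0" by (simp add: z_def)
    have "2 * (real D + 1) / real z \<le> 1 / 8" using z16 z0 by (simp add: field_simps)
    thus "2 * (real D + 1) / real z * real M ^ 2 \<le> 1 / 8 * real M ^ 2" by (intro mult_right_mono) auto
    have e1: "\<eta> * real N * (real D * real \<Lambda> * real Q) = real M / 64" using D \<Lambda>1 Q1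
      by (simp add: \<eta>_def nN power2_eq_square field_simps)
    have ge: "\<eta> * real N \<ge> 0" using \<eta> by simp
    have d1: "1 \<le> real D" using D by simp
    have k1: "1 \<le> real \<Lambda> * real Q" using mult_mono[OF \<Lambda>1 Q1] by simp
    have "\<eta> * real N * (real D * 1) \<le> \<eta> * real N * (real D * (real \<Lambda> * real Q))"
      using ge d1 k1 by (intro mult_left_mono) auto
    hence h1: "\<eta> * real N * real D \<le> real M / 64" using e1 by (simp add: mult.assoc)
    have "\<eta> * real N * 1 \<le> \<eta> * real N * real D" using ge d1 by (intro mult_left_mono) auto
    hence h2: "\<eta> * real N \<le> real M / 64" using h1 by simp
    have MM: "real M \<le> real M ^ 2" using M1 by (simp add: power2_eq_square)
    show "2 * (\<eta> * real N) \<le> 1 / 32 * real M ^ 2" using h2 MM by linarith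
    have "2 * real M * (\<eta> * real N * real D) \<le> 2 * real M * (real M / 64)" using h1 by (intro mult_left_mono) auto
    thus "2 * real M * real D * \<eta> * real N \<le> 1 / 32 * real M ^ 2" by (simp add: power2_eq_square mult_ac)
    have "\<eta> * (real \<Lambda> * real N ^ 2) * real D = 1 / 64 * real M ^ 2" using D \<Lambda>1 Q1
      by (simp add: \<eta>_def nN power2_eq_square field_simps)
    thus "\<eta> * (real \<Lambda> * real N ^ 2) * real D \<le> 1 / 64 * real M ^ 2" by simp
    have "real (card F) * (\<epsilon> * real N ^ 2) = real (card F) / (real (card F) + 1) * (1 / 8 * real M ^ 2)"
      using Q1 by (simp add: \<epsilon>_def nN power_mult_distrib)
    also have "\<dots> \<le> 1 * (1 / 8 * real M ^ 2)" by (intro mult_right_mono) auto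
    finally show "real (card F) * (\<epsilon> * real N ^ 2) \<le> 1 / 8 * real M ^ 2" by simp
  qed
  finally have cBad: "real (card Bad) \<le> 1 / 2 * real M ^ 2" by simp
  \<comment> \<open>Prime squares dividing E are excluded by size: primes of Q by the local
    conditions, then q <= N by \<open>B1\<close>, q <= \<Lambda> N^2 by \<open>B2\<close>, and
    larger q by \<open>B3\<close> for the one factor they divide. \<open>B0\<close> secures
    coprimality first.\<close>
  have good: "\<exists>E\<in>EE. hform v x y = (int m)\<^sup>2 * E" if g: "(x, y) \<in> TT - Bad" for x y
  proof -
    have b: "x \<in> {1..int N}" "y \<in> {1..int N}" "[x = x0] (mod int Q)" "[y = y0] (mod int Q)" using g by (auto simp: TT_def)
    have nB: "\<And>q. q \<in> PQ \<Longrightarrow> (x, y) \<notin> B0 q" "\<And>q. q \<in> PQ \<Longrightarrow> (x, y) \<notin> B1 q" "\<And>q. q \<in> PL \<Longrightarrow> (x, y) \<notin> B2 q"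
      "\<And>u. u \<in> F \<Longrightarrow> (x, y) \<notin> B3 u" using g by (auto simp: Bad_def)
    have l1: "\<And>q. prime q \<Longrightarrow> q dvd Q \<Longrightarrow> \<not> (int q dvd x \<and> int q dvd y)" using lxy[OF b(3,4)] by blast
    obtain E where E: "hform v x y = (int m)\<^sup>2 * E" "\<And>q. prime q \<Longrightarrow> q dvd Q \<Longrightarrow> \<not> int q dvd E" "[c * E = r] (mod int p)"
      using lxy[OF b(3,4)] by blast
    have npos: "\<exists>q0. q = int q0 \<and> prime q0" if "prime q" for q :: int
    proof -
      have "q \<ge> 0" using that by (rule prime_ge_0_int)
      hence "q = int (nat q)" by simp
      thus ?thesis using that by (metis prime_nat_int_transfer)
    qed
    have nxy: "\<not> (int q dvd x \<and> int q dvd y)" if q: "prime q" for q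
    proof (cases "q dvd Q")
      case False
      hence "z < q" using Q(2)[OF q] by (cases "q \<le> z") auto
      moreover have "q \<le> N" if "int q dvd x"
        using zdvd_imp_le[OF that] b(1) by simp
      ultimately have "int q dvd x \<Longrightarrow> q \<in> PQ" using q False by (simp add: PQ_def)
      thus ?thesis using nB(1)[of q] b by (auto simp: B0_def N_def)
    qed (use l1[OF q] in blast)
    have cop: "coprime x y"
    proof (rule ccontr)
      assume "\<not> coprime x y"
      hence "\<not> is_unit (gcd x y)" by (simp only: is_unit_gcd not_False_eq_True)
      moreover have "gcd x y \<noteq> 0" using b(1) by simp
      ultimately obtain q where "q dvd gcd x y" "prime q" using prime_divisor_exists by blast
      thus False using npos[of q] nxy by auto
    qed
    have nsq: "\<not> int (q\<^sup>2) dvd E" if q: "prime q" for q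
    proof
      assume dE: "int (q\<^sup>2) dvd E"
      have "int q dvd E" using dE by (rule dvd_trans[rotated]) (simp add: power2_eq_square)
      hence nQ: "\<not> q dvd Q" using E(2)[OF q] by blast
      hence zq: "z < q" using Q(2)[OF q] by (cases "q \<le> z") auto
      have dv: "int (q\<^sup>2) dvd hform v x y" unfolding E(1) using dE by (rule dvd_mult)
      show False
      proof (cases "q \<le> N")
        case True
        hence "q \<in> PQ" using q zq nQ by (simp add: PQ_def)
        thus False using nB(2)[of q] b nxy[OF q] dv by (simp add: B1_def N_def)
      next
        case False
        show False
        proof (cases "q \<le> \<Lambda> * N\<^sup>2")
          case True
          hence "q \<in> PL" using q False by (simp add: PL_def)
          thus False using nB(3)[of q] b cop dv by (simp add: B2_def)
        next
          case big: False
          have "y \<noteq> 0" using b(2) by auto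
          from prime_square_dvd_hform_factor[OF v(1) bez nR[OF zq] this q dv cop]
          obtain u where u: "u \<in> F" "int (q\<^sup>2) dvd hform u x y" by (auto simp: F_def)
          have "\<Lambda>u u * N\<^sup>2 \<le> \<Lambda> * N\<^sup>2" using LL(1)[OF u(1)] by (rule mult_le_mono1)
          hence "\<Lambda>u u * N\<^sup>2 < q" using big by linarith
          thus False using nB(4)[OF u(1)] b cop u(2) unfolding B3_def LB_def by blast
        qed
      qed
    qed
    have "squarefree E"
    proof (rule ccontr)
      assume "\<not> squarefree E"
      then obtain a where a: "a\<^sup>2 dvd E" "\<not> is_unit a" by (auto simp: squarefree_def)
      have "\<exists>q. prime q \<and> q dvd a"
      proof (cases "a = 0")
        case False
        thus ?thesis using prime_divisor_exists[of a] a(2) by blast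
      qed (auto intro!: exI[of _ 2])
      then obtain q where q: "prime q" "q dvd a" by blast
      obtain q0 where q0: "q = int q0" "prime q0" using npos[OF q(1)] by blast
      have "q\<^sup>2 dvd E" by (rule dvd_trans[OF dvd_power_same[OF q(2)] a(1)])
      hence "int (q0\<^sup>2) dvd E" by (simp add: q0(1))
      thus False using nsq[OF q0(2)] by blast
    qed
    moreover have "coprime E c"
    proof (rule ccontr)
      assume "\<not> coprime E c"
      hence "\<not> is_unit (gcd E c)" by (simp only: is_unit_gcd not_False_eq_True)
      moreover have "gcd E c \<noteq> 0" using c by simp
      ultimately obtain q where q: "q dvd gcd E c" "prime q" using prime_divisor_exists by blast
      obtain q0 where q0: "q = int q0" "prime q0" using npos[OF q(2)] by blast
      have "int q0 dvd c" using q(1) q0(1) by simp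
      hence "\<bar>int q0\<bar> \<le> \<bar>c\<bar>" using c by (rule dvd_imp_le_int[rotated])
      hence "q0 \<le> z" by (simp add: z_def)
      hence "\<not> int q0 dvd E" using E(2)[OF q0(2)] Q(2)[OF q0(2)] by blast
      thus False using q(1) q0(1) by simp
    qed
    moreover have "x > 0" using b(1) by simp
    ultimately have "E \<in> EE" using E(1,3) unfolding EE_def by blast
    thus ?thesis using E(1) by blast
  qed
  define V where "V t y = {x. hform v x y = t}" for t y
  have fV: "finite (V t y)" "card (V t y) \<le> D" for t y
    unfolding V_def D_def using v by (intro card_form_value_le; simp)+
  have "TT - Bad \<subseteq> (\<Union>E\<in>EE. \<Union>y\<in>{1..int N}. (\<lambda>x. (x, y)) ` V ((int m)\<^sup>2 * E) y)"
  proof (rule subrelI)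
    fix x y assume g: "(x, y) \<in> TT - Bad"
    obtain E where "E \<in> EE" "hform v x y = (int m)\<^sup>2 * E" using good[OF g] by blast
    moreover have "y \<in> {1..int N}" using g by (auto simp: TT_def)
    ultimately show "(x, y) \<in> (\<Union>E\<in>EE. \<Union>y\<in>{1..int N}. (\<lambda>x. (x, y)) ` V ((int m)\<^sup>2 * E) y)"
      unfolding V_def by blast
  qed
  hence "card (TT - Bad) \<le> card (\<Union>E\<in>EE. \<Union>y\<in>{1..int N}. (\<lambda>x. (x, y)) ` V ((int m)\<^sup>2 * E) y)"
    using fE fV by (intro card_mono) auto
  also have "\<dots> \<le> (\<Sum>E\<in>EE. card (\<Union>y\<in>{1..int N}. (\<lambda>x. (x, y)) ` V ((int m)\<^sup>2 * E) y))" by (rule card_UN_le[OF fE])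
  also have "\<dots> \<le> (\<Sum>E\<in>EE. \<Sum>y\<in>{1..int N}. card ((\<lambda>x. (x, y)) ` V ((int m)\<^sup>2 * E) y))"
    by (intro sum_mono card_UN_le) simp
  also have "\<dots> \<le> (\<Sum>E\<in>EE. \<Sum>y\<in>{1..int N}. D)"
    by (intro sum_mono) (rule order_trans[OF card_image_le[OF fV(1)] fV(2)])
  also have "\<dots> = card EE * N * D" by simp
  finally have "real (card (TT - Bad)) \<le> real (card EE * N * D)" by (simp only: of_nat_le_iff)
  hence up: "real (card (TT - Bad)) \<le> real (card EE * Q * D) * real M" by (simp add: N_def mult_ac)
  have "real (card TT) - real (card Bad) \<le> real (card (TT - Bad))"
    using diff_card_le_card_Diff[OF fB, of TT] by linarith
  hence "1 / 2 * real M ^ 2 \<le> real (card EE * Q * D) * real M" using cTT cBad up by linarith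
  hence "real M * (real M / 2) \<le> real M * real (card EE * Q * D)" by (simp add: power2_eq_square mult_ac)
  hence "real M / 2 \<le> real (card EE * Q * D)" using M1 by (simp only: mult_le_cancel_left_pos)
  moreover have "real (4 * card EE * Q * D + 1) \<le> real M" by (simp only: of_nat_le_iff) (simp add: M_def)
  moreover have "0 \<le> real (card EE * Q * D)" by simp
  ultimately show False by simp
qed

section \<open>Reduction to a monic form of even degree\<close>

lemma rat_poly_clear_denominators:
  fixes a :: "rat poly"
  shows "\<exists>n A. n \<noteq> 0 \<and> smult (of_int n) a = rat_poly_of A"
proof (induction a)
  case 0
  show ?case by (intro exI[of _ 1] exI[of _ 0]) simp
next
  case (pCons q a)
  then obtain n A where A: "n \<noteq> 0" "smult (of_int n) a = rat_poly_of A" by blast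
  obtain x y where xy: "quotient_of q = (x, y)" by force
  have y: "y > 0" "q = of_int x / of_int y" using quotient_of_denom_pos[OF xy] quotient_of_div[OF xy] by auto
  have "smult (of_int (n * y)) (pCons q a) = pCons (of_int (n * x)) (smult (of_int y) (smult (of_int n) a))"
    using y by (simp add: mult.commute)
  also have "\<dots> = rat_poly_of (pCons (n * x) (smult y A))"
    unfolding A(2) by (simp add: of_int_hom.map_poly_hom_smult of_int_hom.map_poly_pCons_hom)
  finally show ?case using A(1) y(1) by (intro exI[of _ "n * y"] exI[of _ "pCons (n * x) (smult y A)"]) simp
qed

lemma bezout_of_coprime:
  fixes f g :: "int poly"
  assumes f: "f \<noteq> 0" and gcd: "degree (gcd (rat_poly_of f) (rat_poly_of g)) = 0"
  shows "\<exists>A B R. R \<noteq> 0 \<and> A * f + B * g = [:R:]"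
proof -
  define d where "d = gcd (rat_poly_of f) (rat_poly_of g)"
  define a b where "a = fst (bezout_coefficients (rat_poly_of f) (rat_poly_of g))"
    and "b = snd (bezout_coefficients (rat_poly_of f) (rat_poly_of g))"
  have bez: "a * rat_poly_of f + b * rat_poly_of g = d"
    unfolding a_def b_def d_def by (rule bezout_coefficients_fst_snd)
  have "d \<noteq> 0" using f by (simp add: d_def)
  moreover have "d = [:coeff d 0:]" using gcd by (metis d_def degree_0_id)
  ultimately obtain k where k: "d = [:k:]" "k \<noteq> 0" by (metis pCons_0_0)
  obtain x y where xy: "quotient_of k = (x, y)" by force
  have y: "y > 0" "k = of_int x / of_int y" using quotient_of_denom_pos[OF xy] quotient_of_div[OF xy] by auto
  obtain n A where A: "n \<noteq> 0" "smult (of_int n) a = rat_poly_of A" using rat_poly_clear_denominators by blast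
  obtain m B where B: "m \<noteq> 0" "smult (of_int m) b = rat_poly_of B" using rat_poly_clear_denominators by blast
  have "rat_poly_of (smult (m * y) A * f + smult (n * y) B * g) =
     smult (of_int (m * y)) (rat_poly_of A) * rat_poly_of f + smult (of_int (n * y)) (rat_poly_of B) * rat_poly_of g"
    by (simp add: of_int_poly_hom.hom_add of_int_poly_hom.hom_mult of_int_hom.map_poly_hom_smult)
  also have "\<dots> = smult (of_int (m * y * n)) (a * rat_poly_of f + b * rat_poly_of g)"
    unfolding A(2)[symmetric] B(2)[symmetric] by (simp add: smult_add_right mult_ac)
  also have "\<dots> = rat_poly_of [:m * n * x:]" unfolding bez k(1) using y by (simp add: of_int_hom.map_poly_pCons_hom mult_ac)
  finally have "smult (m * y) A * f + smult (n * y) B * g = [:m * n * x:]"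
    by (simp only: of_int_poly_hom.eq_iff)
  moreover have "m * n * x \<noteq> 0" using A B k(2) y by auto
  ultimately show ?thesis by blast
qed

text \<open>A nonconstant rational gcd would have a complex zero. Complex roots are convenient
  because reversal of a polynomial acts on nonzero roots by inversion.\<close>

lemma bezout_of_no_common_complex_root:
  fixes f g :: "int poly"
  assumes f: "f \<noteq> 0"
    and nr: "\<And>s :: complex. poly (map_poly of_int f) s = 0 \<Longrightarrow> poly (map_poly of_int g) s = 0 \<Longrightarrow> False"
  shows "\<exists>A B R. R \<noteq> 0 \<and> A * f + B * g = [:R:]"
proof (rule bezout_of_coprime[OF f], rule ccontr)
  define d where "d = gcd (rat_poly_of f) (rat_poly_of g)"
  assume "degree (gcd (rat_poly_of f) (rat_poly_of g)) \<noteq> 0"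
  hence dd: "degree d \<noteq> 0" by (simp add: d_def)
  define h :: "rat poly \<Rightarrow> complex poly" where "h = map_poly of_rat"
  have hmult: "h (p * q) = h p * h q" for p q
    unfolding h_def by (intro poly_eqI) (simp add: coeff_map_poly coeff_mult of_rat_sum of_rat_mult)
  have hint: "h (rat_poly_of p) = map_poly of_int p" for p
    unfolding h_def by (intro poly_eqI) (simp add: coeff_map_poly)
  have "degree (h d) = degree d" unfolding h_def by (rule degree_map_poly) simp
  hence "\<not> (\<exists>a l. a \<noteq> 0 \<and> l = 0 \<and> h d = pCons a l)" using dd by auto
  then obtain s where s: "poly (h d) s = 0" using fundamental_theorem_of_algebra_alt by blast
  obtain p q where pq: "rat_poly_of f = d * p" "rat_poly_of g = d * q"
    unfolding d_def by (meson dvd_def gcd_dvd1 gcd_dvd2)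
  have "poly (h (rat_poly_of f)) s = 0" "poly (h (rat_poly_of g)) s = 0" unfolding pq hmult using s by simp_all
  thus False using nr[of s] by (simp add: hint)
qed

text \<open>Near s the reversal is x^D g(1/x); its derivative at a zero is a nonzero multiple of
  g'(1/s).\<close>

lemma reflect_poly_common_root:
  fixes g :: "complex poly"
  assumes s: "s \<noteq> 0" and h: "poly (reflect_poly g) s = 0" "poly (pderiv (reflect_poly g)) s = 0"
  shows "poly g (inverse s) = 0" "poly (pderiv g) (inverse s) = 0"
proof -
  define D where "D = degree g"
  have r: "poly (reflect_poly g) x = x ^ D * poly g (inverse x)" if "x \<noteq> 0" for x
    unfolding D_def by (rule poly_reflect_poly_nz[OF that])
  show g0: "poly g (inverse s) = 0" using h(1) r[OF s] s by simp
  have "((\<lambda>x. x ^ D * poly g (inverse x)) has_field_derivative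
     (of_nat D * s ^ (D - 1)) * poly g (inverse s) + s ^ D * (poly (pderiv g) (inverse s) * (- inverse (s ^ 2)))) (at s)"
    by (rule derivative_eq_intros DERIV_chain2[OF poly_DERIV] refl s)+ (simp_all add: power2_eq_square s)
  moreover have "eventually (\<lambda>x. x ^ D * poly g (inverse x) = poly (reflect_poly g) x) (nhds s)"
    by (rule eventually_mono[OF t1_space_nhds[OF s]]) (simp add: r)
  ultimately have "(poly (reflect_poly g) has_field_derivative
     (of_nat D * s ^ (D - 1)) * poly g (inverse s) + s ^ D * (poly (pderiv g) (inverse s) * (- inverse (s ^ 2)))) (at s)"
    by (subst (asm) DERIV_cong_ev[OF refl _ refl])
  from DERIV_unique[OF this poly_DERIV]
  have "(of_nat D * s ^ (D - 1)) * poly g (inverse s) + s ^ D * (poly (pderiv g) (inverse s) * (- inverse (s ^ 2)))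
     = poly (pderiv (reflect_poly g)) s" .
  thus "poly (pderiv g) (inverse s) = 0" using h(2) g0 s by simp
qed

text \<open>Reversal keeps the nonzero roots simple. The extra factor x^e with e <= 1 adds at most a
  simple root at 0, where the reversed polynomial takes the nonzero leading coefficient of
  g.\<close>

lemma bezout_reflected:
  fixes g A B :: "int poly"
  assumes g: "coeff g 0 = 1" and bez: "A * g + B * pderiv g = [:R:]" and R: "R \<noteq> 0" and e: "e \<le> 1"
  shows "\<exists>A' B' R'. R' \<noteq> 0 \<and> A' * (monom 1 e * reflect_poly g) + B' * pderiv (monom 1 e * reflect_poly g) = [:R':]"
proof (rule bezout_of_no_common_complex_root)
  define v where "v = monom 1 e * reflect_poly g"
  have g0: "g \<noteq> 0" using g by auto
  show "monom 1 e * reflect_poly g \<noteq> 0" using g0 by simp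
  define G :: "complex poly" where "G = map_poly of_int g"
  define H where "H = reflect_poly G"
  have rG: "map_poly of_int (reflect_poly g) = H"
    unfolding H_def G_def by (intro poly_eqI) (simp add: coeff_map_poly coeff_reflect_poly)
  have mv: "map_poly of_int v = monom 1 e * H" unfolding v_def by (simp add: rG of_int_poly_hom.hom_mult of_int_hom.map_poly_hom_monom)
  have mv': "map_poly of_int (pderiv v) = pderiv (monom 1 e * H)" unfolding mv[symmetric] by (simp add: of_int_hom.map_poly_pderiv)
  have bezG: "poly (map_poly of_int A) t * poly G t + poly (map_poly of_int B) t * poly (pderiv G) t = of_int R" for t :: complex
  proof -
    have "map_poly of_int (A * g + B * pderiv g) = (map_poly of_int [:R:] :: complex poly)" by (simp only: bez)
    hence "map_poly of_int A * G + map_poly of_int B * pderiv G = [:of_int R:]"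
      by (simp add: G_def of_int_poly_hom.hom_add of_int_poly_hom.hom_mult of_int_hom.map_poly_pderiv of_int_hom.map_poly_pCons_hom)
    from arg_cong[OF this, of "\<lambda>q. poly q t"] show ?thesis by simp
  qed
  fix s :: complex
  assume "poly (map_poly of_int (monom 1 e * reflect_poly g)) s = 0"
    "poly (map_poly of_int (pderiv (monom 1 e * reflect_poly g))) s = 0"
  hence v0: "poly (monom 1 e * H) s = 0" "poly (pderiv (monom 1 e * H)) s = 0"
    unfolding v_def[symmetric] mv mv' by simp_all
  show False
  proof (cases "s = 0")
    case False
    have H0: "poly H s = 0" using v0(1) False by (simp add: poly_monom)
    have "poly (pderiv (monom 1 e * H)) s = s ^ e * poly (pderiv H) s + poly H s * poly (pderiv (monom 1 e)) s"
      by (simp add: pderiv_mult poly_monom)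
    hence "poly (pderiv H) s = 0" using v0(2) H0 False by simp
    from reflect_poly_common_root[OF False H0[unfolded H_def] this[unfolded H_def]]
    show False using bezG[of "inverse s"] R by simp
  next
    case True
    have G0: "G \<noteq> 0" using g0 by (simp add: G_def)
    have H0: "poly H 0 \<noteq> 0" unfolding H_def using G0 by simp
    show False
    proof (cases "e = 0")
      case True
      thus False using v0(1) H0 \<open>s = 0\<close> by (simp add: monom_0)
    next
      case False
      hence "e = 1" using e by simp
      hence "poly (pderiv (monom 1 e * H)) 0 = poly H 0"
        by (simp add: pderiv_mult pderiv_monom poly_monom monom_0)
      thus False using v0(2) H0 \<open>s = 0\<close> by simp
    qed
  qed
qed

text \<open>The rational irreducible factors are scaled to integer polynomials; n and k collect the
  denominators and the content of f.\<close>

lemma int_factorization_small_degree: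
  fixes f :: "int poly"
  assumes f: "f \<noteq> 0" and small: "\<And>g :: rat poly. irreducible g \<Longrightarrow> g dvd rat_poly_of f \<Longrightarrow> degree g \<le> d"
  shows "\<exists>n k M. n \<noteq> 0 \<and> smult n f = smult k (prod_mset M) \<and> (\<forall>P\<in>#M. degree P \<le> d)"
proof -
  define F where "F = prime_factorization (rat_poly_of f)"
  have f0: "rat_poly_of f \<noteq> 0" using f by simp
  have "\<exists>n M. n \<noteq> 0 \<and> rat_poly_of (prod_mset M) = smult (of_int n) (prod_mset G) \<and> (\<forall>P\<in>#M. degree P \<le> d)"
    if "\<forall>p\<in>#G. degree p \<le> d" for G :: "rat poly multiset"
    using that
  proof (induction G)
    case empty
    show ?case by (intro exI[of _ 1] exI[of _ "{#}"]) simp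
  next
    case (add p G)
    then obtain n M where M: "n \<noteq> 0" "rat_poly_of (prod_mset M) = smult (of_int n) (prod_mset G)" "\<forall>P\<in>#M. degree P \<le> d"
      by auto
    obtain m P where P: "m \<noteq> 0" "smult (of_int m) p = rat_poly_of P" using rat_poly_clear_denominators by blast
    have "degree P = degree (rat_poly_of P)" by simp
    also have "\<dots> = degree p" unfolding P(2)[symmetric] using P(1) by simp
    finally have "degree P \<le> d" using add.prems by simp
    moreover have "rat_poly_of (prod_mset (add_mset P M)) = smult (of_int (m * n)) (prod_mset (add_mset p G))"
      by (simp add: of_int_poly_hom.hom_mult M(2) P(2)[symmetric] mult_ac)
    ultimately show ?case using M(1,3) P(1) by (intro exI[of _ "m * n"] exI[of _ "add_mset P M"]) auto
  qed
  moreover have "\<forall>p\<in>#F. degree p \<le> d"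
  proof
    fix p assume "p \<in># F"
    hence "prime p" "p dvd rat_poly_of f" by (auto simp: F_def)
    thus "degree p \<le> d" using small by (simp add: prime_elem_imp_irreducible)
  qed
  ultimately obtain n M where M: "n \<noteq> 0" "rat_poly_of (prod_mset M) = smult (of_int n) (prod_mset F)" "\<forall>P\<in>#M. degree P \<le> d"
    by blast
  have "normalize (prod_mset F) = normalize (rat_poly_of f)"
    unfolding F_def by (rule prod_mset_prime_factorization_weak[OF f0])
  hence "rat_poly_of f dvd prod_mset F" by (metis associated_iff_dvd)
  moreover have "prod_mset F dvd rat_poly_of f" using \<open>normalize _ = _\<close> by (metis associated_iff_dvd)
  ultimately obtain k where k: "rat_poly_of f = smult k (prod_mset F)"
  proof -
    obtain u where u: "rat_poly_of f = prod_mset F * u" using \<open>prod_mset F dvd _\<close> by (auto simp: dvd_def)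
    have "degree (rat_poly_of f) \<le> degree (prod_mset F)"
      using \<open>rat_poly_of f dvd _\<close> by (rule dvd_imp_degree_le) (use u f0 in auto)
    moreover have "degree (rat_poly_of f) = degree (prod_mset F) + degree u"
      using f0 unfolding u by (intro degree_mult_eq) auto
    ultimately have "degree u = 0" by linarith
    then obtain a where "u = [:a:]" by (metis degree_0_id)
    thus ?thesis using u that[of a] by (simp add: mult.commute)
  qed
  obtain x y where xy: "quotient_of k = (x, y)" by force
  have y: "y > 0" "k = of_int x / of_int y" using quotient_of_denom_pos[OF xy] quotient_of_div[OF xy] by auto
  have "rat_poly_of (smult (n * y) f) = smult (of_int (n * y)) (rat_poly_of f)" by (simp add: of_int_hom.map_poly_hom_smult)
  also have "\<dots> = smult (of_int x) (smult (of_int n) (prod_mset F))" unfolding k using y by (simp add: mult.commute)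
  also have "\<dots> = rat_poly_of (smult x (prod_mset M))" unfolding M(2)[symmetric] by (simp add: of_int_hom.map_poly_hom_smult)
  finally have "smult (n * y) f = smult x (prod_mset M)" by (simp only: of_int_poly_hom.eq_iff)
  thus ?thesis using M(1,3) y(1) by (intro exI[of _ "n * y"] exI[of _ x] exI[of _ M]) simp
qed

lemma pcompose_linear_dvd:
  fixes f :: "int poly"
  shows "\<exists>g. pcompose f [:a, c:] = [:poly f a:] + smult c g"
proof (induction f)
  case 0
  show ?case by (intro exI[of _ 0]) simp
next
  case (pCons b f)
  then obtain g where g: "pcompose f [:a, c:] = [:poly f a:] + smult c g" by blast
  have "pcompose (pCons b f) [:a, c:] = [:poly (pCons b f) a:] + smult c ([:0, poly f a:] + [:a, c:] * g)"
    by (simp add: pcompose_pCons g algebra_simps smult_add_right)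
  thus ?case by blast
qed

lemma exists_nonroot:
  fixes f :: "int poly"
  assumes "f \<noteq> 0"
  shows "\<exists>a. poly f a \<noteq> 0"
  using poly_roots_finite[OF assms] infinite_UNIV_char_0 by (metis (mono_tags, lifting) Collect_cong UNIV_def)

text \<open>Reversal makes the monic variable x the denominator of t = y/x, and the factor
  \<open>monom 1 e\<close> adds e to the power of x in front.\<close>

lemma hform_reflected:
  fixes g :: "int poly"
  assumes g: "coeff g 0 = 1" and x: "x \<noteq> 0"
  shows "rat_of_int (hform (monom 1 e * reflect_poly g) x y) =
    of_int x ^ (degree g + e) * poly (rat_poly_of g) (of_int y / of_int x)"
proof -
  define v where "v = monom 1 e * reflect_poly g"
  define n where "n = degree g + e"
  have g0: "g \<noteq> 0" using g by auto
  have dv: "degree v = n" unfolding v_def n_def using g0 g by (subst degree_mult_eq) (auto simp: degree_monom_eq)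
  have "reflect_poly (monom 1 e :: int poly) = reflect_poly [:0, 1:] ^ e"
    unfolding x_as_monom reflect_poly_power[symmetric] x_pow_n ..
  hence "reflect_poly (monom 1 e :: int poly) = 1" by (simp add: reflect_poly_def)
  hence "reflect_poly v = g" unfolding v_def reflect_poly_mult using g by simp
  hence cg: "coeff v (n - j) = coeff g j" if "j \<le> n" for j
    using coeff_reflect_poly[of v j] that dv by simp
  have "hform v x y = (\<Sum>k\<le>n. coeff v k * x ^ k * y ^ (n - k))" by (simp add: hform_def dv)
  also have "\<dots> = (\<Sum>j\<le>n. coeff v (n - j) * x ^ (n - j) * y ^ (n - (n - j)))"
    by (rule sum.reindex_bij_witness[of _ "\<lambda>j. n - j" "\<lambda>j. n - j"]) auto
  also have "\<dots> = (\<Sum>j\<le>n. coeff g j * x ^ (n - j) * y ^ j)"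
    by (rule sum.cong) (auto simp: cg)
  also have "\<dots> = (\<Sum>j\<le>degree g. coeff g j * x ^ (n - j) * y ^ j)"
    by (rule sum.mono_neutral_right) (auto simp: n_def coeff_eq_0)
  finally have "rat_of_int (hform v x y) = (\<Sum>j\<le>degree g. of_int (coeff g j) * of_int x ^ (n - j) * of_int y ^ j)" by simp
  also have "\<dots> = (\<Sum>j\<le>degree g. of_int x ^ n * (of_int (coeff g j) * (of_int y / of_int x) ^ j))"
  proof (rule sum.cong[OF refl])
    fix j assume "j \<in> {..degree g}"
    hence "rat_of_int x ^ n = of_int x ^ (n - j) * of_int x ^ j" by (simp add: n_def flip: power_add)
    thus "of_int (coeff g j) * rat_of_int x ^ (n - j) * of_int y ^ j =
      of_int x ^ n * (of_int (coeff g j) * (of_int y / of_int x) ^ j)" using x by (simp add: power_divide)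
  qed
  also have "\<dots> = of_int x ^ n * poly (rat_poly_of g) (of_int y / of_int x)"
    by (simp add: poly_altdef sum_distrib_left)
  finally show ?thesis by (simp only: v_def n_def)
qed

text \<open>Substitution followed by reversal is multiplicative and does not raise degrees, so a
  prime factor divides the image of one factor of f, a power of x, or a constant.\<close>

lemma reflected_factor_degree:
  fixes f u :: "int poly"
  assumes u: "prime_elem u" "u dvd monom 1 e * reflect_poly (pcompose f [:a, b:])" and b: "b \<noteq> 0" and d: "1 \<le> d"
    and fact: "n \<noteq> 0" "smult n f = smult k (prod_mset M)" "\<forall>P\<in>#M. degree P \<le> d" and f: "f \<noteq> 0"
  shows "degree u \<le> d"
proof -
  define T where "T P = reflect_poly (pcompose P [:a, b:])" for P :: "int poly"
  have T: "T (smult c P) = smult c (T P)" "T (P * P') = T P * T P'" "T 1 = 1" for c P P'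
    by (simp_all add: T_def pcompose_smult reflect_poly_smult pcompose_mult reflect_poly_mult)
  have Tp: "T (prod_mset M) = prod_mset (image_mset T M)" by (induction M) (simp_all add: T)
  have deg: "degree (T P) \<le> degree P" for P
    unfolding T_def using degree_reflect_poly_le[of "pcompose P [:a, b:]"] degree_pcompose[of P "[:a, b:]"] b by simp
  have T0: "T P \<noteq> 0" if "P \<noteq> 0" for P
    using that pcompose_eq_0[of P "[:a, b:]"] b by (auto simp: T_def)
  have nf: "smult n f \<noteq> 0" using fact(1) f by simp
  have nM: "k \<noteq> 0" "prod_mset M \<noteq> 0"
    using nf unfolding fact(2) by (metis smult_0_left, metis smult_0_right)
  have "u dvd smult n (monom 1 e * T f)" using u(2) by (simp add: T_def dvd_smult)
  also have "smult n (monom 1 e * T f) = monom 1 e * T (smult n f)" by (simp add: T)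
  also have "\<dots> = [:k:] * ([:0, 1:] ^ e * prod_mset (image_mset T M))"
    unfolding fact(2) T Tp x_as_monom x_pow_n by (simp add: mult.commute)
  finally have "u dvd [:k:] \<or> u dvd [:0, 1:] ^ e \<or> u dvd prod_mset (image_mset T M)"
    using u(1) prime_elem_dvd_multD by blast
  thus ?thesis
  proof (elim disjE)
    assume "u dvd [:k:]"
    hence "degree u \<le> degree [:k:]" using nM by (intro dvd_imp_degree_le) auto
    thus ?thesis by simp
  next
    assume "u dvd [:0, 1:] ^ e"
    hence "u dvd [:0, 1:]" using u(1) prime_elem_dvd_power by blast
    hence "degree u \<le> degree [:0, 1 :: int:]" by (intro dvd_imp_degree_le) auto
    thus ?thesis using d by simp
  next
    assume "u dvd prod_mset (image_mset T M)"
    moreover have "\<exists>P\<in>#N. u dvd T P" if "u dvd prod_mset (image_mset T N)" for N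
      using that
    proof (induction N)
      case empty
      thus ?case using u(1) by (simp add: prime_elem_def)
    next
      case (add P N)
      thus ?case using prime_elem_dvd_multD[OF u(1)] by fastforce
    qed
    ultimately obtain P where P: "P \<in># M" "u dvd T P" by blast
    have "P \<noteq> 0" using P(1) nM(2) by (auto simp: prod_mset_zero_iff)
    hence "degree u \<le> degree (T P)" using P(2) T0 by (intro dvd_imp_degree_le) auto
    also have "\<dots> \<le> d" using deg[of P] P(1) fact(3) by force
    finally show ?thesis .
  qed
qed

theorem theorem1p3:
  fixes f :: "int poly"
  assumes "degree f > 0"
    and "discriminant (rat_poly_of f) \<noteq> 0"
    and "\<And>g :: rat poly. irreducible g \<Longrightarrow> g dvd rat_poly_of f \<Longrightarrow> degree g \<le> 6"
  shows "\<exists>P\<^sub>0 :: nat. \<forall>p :: nat. \<forall>r :: int. prime p \<longrightarrow> p > P\<^sub>0 \<longrightarrow> \<not> int p dvd r \<longrightarrow>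
           infinite {d \<in> S_rat f. [d = r] (mod int p)}"
proof -
  have f0: "f \<noteq> 0" using assms(1) by auto
  have "resultant (rat_poly_of f) (pderiv (rat_poly_of f)) \<noteq> 0"
    using assms(2) by (auto simp: discriminant_def)
  hence "degree (gcd (rat_poly_of f) (pderiv (rat_poly_of f))) = 0" by (simp add: resultant_0_gcd)
  hence "degree (gcd (rat_poly_of f) (rat_poly_of (pderiv f))) = 0" by (simp add: of_int_hom.map_poly_pderiv)
  from bezout_of_coprime[OF f0 this] obtain A B R0 where bezf: "R0 \<noteq> 0" "A * f + B * pderiv f = [:R0:]" by blast
  obtain a where a: "poly f a \<noteq> 0" using exists_nonroot[OF f0] by blast
  define c where "c = poly f a"
  have c0: "c \<noteq> 0" using a by (simp add: c_def)
  obtain g1 where g1: "pcompose f [:a, c:] = [:poly f a:] + smult c g1" using pcompose_linear_dvd by blast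
  define g where "g = 1 + g1"
  have fg: "pcompose f [:a, c:] = smult c g" unfolding g1 g_def by (simp add: c_def smult_add_right)
  have g0: "coeff g 0 = 1"
  proof -
    have "poly (pcompose f [:a, c:]) 0 = c" by (simp add: poly_pcompose c_def)
    hence "c * poly g 0 = c" unfolding fg by simp
    thus ?thesis using c0 by (simp add: poly_0_coeff_0)
  qed
  hence gn: "g \<noteq> 0" by auto
  have dg: "degree g = degree f"
  proof -
    have "degree (smult c g) = degree f * degree [:a, c:]" unfolding fg[symmetric] by (rule degree_pcompose)
    thus ?thesis using c0 by simp
  qed
  have bezg: "smult c (pcompose A [:a, c:]) * g + pcompose B [:a, c:] * pderiv g = [:R0:]"
  proof -
    have "smult c (pderiv g) = pcompose (pderiv f) [:a, c:] * pderiv [:a, c:]"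
      unfolding pderiv_pcompose[symmetric] fg by (simp add: pderiv_smult)
    hence "smult c (pderiv g) = smult c (pcompose (pderiv f) [:a, c:])" by (simp add: pderiv_pCons mult.commute)
    hence pg: "pderiv g = pcompose (pderiv f) [:a, c:]" using c0 by (auto simp: poly_eq_iff)
    have "pcompose (A * f + B * pderiv f) [:a, c:] = [:R0:]" unfolding bezf(2) by simp
    thus ?thesis unfolding pg by (simp add: pcompose_add pcompose_mult fg)
  qed
  \<comment> \<open>This is the parity of deg f, so that deg f + e is even.\<close>
  define e where "e = degree f mod 2"
  define v where "v = monom 1 e * reflect_poly g"
  obtain A' B' R where R: "R \<noteq> 0" "A' * v + B' * pderiv v = [:R:]"
  proof -
    have "e \<le> 1" by (simp add: e_def)
    from bezout_reflected[OF g0 bezg bezf(1) this] show ?thesis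
      using that unfolding v_def[symmetric] by blast
  qed
  have dv: "degree v = degree f + e" unfolding v_def using gn g0 dg
    by (subst degree_mult_eq) (auto simp: degree_monom_eq)
  have lcr: "lead_coeff (reflect_poly g) = 1"
    using g0 by (simp add: coeff_reflect_poly)
  have v1: "lead_coeff v = 1" unfolding v_def lead_coeff_mult using lcr by (simp add: degree_monom_eq)
  have v2: "2 \<le> degree v" unfolding dv e_def using assms(1) by (cases "degree f = 1") auto
  obtain k where k: "degree v = 2 * k"
  proof -
    have "even (degree f + degree f mod 2)" by simp
    then obtain k where "degree f + degree f mod 2 = 2 * k" by (rule evenE)
    thus ?thesis by (intro that[of k]) (simp only: dv e_def)
  qed
  obtain n k' F where F: "n \<noteq> 0" "smult n f = smult k' (prod_mset F)" "\<forall>P\<in>#F. degree P \<le> 6"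
    using int_factorization_small_degree[OF f0 assms(3)] by blast
  have fac: "degree u \<le> 6" if u: "u \<in> prime_factors v" for u
  proof (rule reflected_factor_degree[OF _ _ c0 _ F f0, of u e a])
    show "prime_elem u" using u by (blast intro: prime_imp_prime_elem in_prime_factors_imp_prime)
    have "u dvd v" using u by auto
    hence "u dvd smult c v" by (rule dvd_smult)
    thus "u dvd monom 1 e * reflect_poly (pcompose f [:a, c:])"
      unfolding fg reflect_poly_smult v_def by simp
  qed simp
  \<comment> \<open>The curve parameter is c1 E, not c E: the square part of c is moved into the
    second coordinate, and E coprime to c1 keeps the product squarefree.\<close>
  define c1 where "c1 = squarefree_part c"
  define c2 where "c2 = square_part c"
  have cc: "c = c1 * c2 ^ 2" unfolding c1_def c2_def by (rule squarefree_decompose)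
  have c1: "c1 \<noteq> 0" "squarefree c1" by (simp_all add: c1_def)
  have c2: "c2 \<noteq> 0" using cc c0 by auto
  define K where "K = Suc (degree v)"
  show ?thesis
  \<comment> \<open>Beyond this threshold p divides neither R nor c1, and Stepanov's method applies
    to v.\<close>
  proof (intro exI[of _ "nat \<bar>R\<bar> + 2 * K * K + nat \<bar>c1\<bar>"] allI impI)
    fix p :: nat and r :: int
    assume p: "prime p" "nat \<bar>R\<bar> + 2 * K * K + nat \<bar>c1\<bar> < p" and r: "\<not> int p dvd r"
    have big: "\<not> int p dvd t" if "t \<noteq> 0" "nat \<bar>t\<bar> < p" for t
    proof
      assume "int p dvd t"
      hence "\<bar>int p\<bar> \<le> \<bar>t\<bar>" using that(1) by (rule dvd_imp_le_int[rotated])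
      thus False using that(2) by linarith
    qed
    have pR: "\<not> int p dvd R" and pc: "\<not> int p dvd c1" and pK: "2 * K * K < p"
      using big[OF R(1)] big[OF c1(1)] p(2) by auto
    obtain m :: nat where m: "m > 0" and loc: "\<And>z::nat. \<exists>Q x0 y0. Q > 0 \<and> (\<forall>q. prime q \<longrightarrow> q \<le> z \<longrightarrow> q dvd Q) \<and>
     (\<forall>x y. [x = x0] (mod int Q) \<longrightarrow> [y = y0] (mod int Q) \<longrightarrow>
        (\<forall>q. prime q \<longrightarrow> q dvd Q \<longrightarrow> \<not> (int q dvd x \<and> int q dvd y)) \<and>
        (\<exists>E. hform v x y = (int m)\<^sup>2 * E \<and> (\<forall>q. prime q \<longrightarrow> q dvd Q \<longrightarrow> \<not> int q dvd E) \<and> [c1 * E = r] (mod int p)))"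
      using local_conditions[OF p(1) v1 v2 R(2) pR K_def pK pc r] by blast
    define EE where "EE = {E. squarefree E \<and> coprime E c1 \<and> [c1 * E = r] (mod int p) \<and> (\<exists>x y. x > 0 \<and> hform v x y = (int m)\<^sup>2 * E)}"
    have "infinite EE" unfolding EE_def
      by (rule infinitely_many_squarefree_values[OF v1 v2 R(2,1) fac m c1(1) loc])
    moreover have "inj_on (\<lambda>E. c1 * E) EE" using c1(1) by (auto simp: inj_on_def)
    ultimately have "infinite ((\<lambda>E. c1 * E) ` EE)" by (simp add: finite_image_iff)
    moreover have "(\<lambda>E. c1 * E) ` EE \<subseteq> {d \<in> S_rat f. [d = r] (mod int p)}"
    proof safe
      fix E assume E: "E \<in> EE"
      show "[c1 * E = r] (mod int p)" using E by (simp add: EE_def)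
      obtain x y where xy: "x > 0" "hform v x y = (int m)\<^sup>2 * E" using E by (auto simp: EE_def)
      have sf: "squarefree (c1 * E)"
        using E c1(2) by (intro squarefree_mult_coprime) (auto simp: EE_def coprime_commute)
      define X where "X = rat_of_int x"
      have X: "X \<noteq> 0" using xy(1) by (simp add: X_def)
      define t where "t = of_int y / X"
      \<comment> \<open>With t = y/x one has g(t) = m^2 E / x^(2k), hence f(a + c t) = c1 c2^2 m^2 E
        / x^(2k); the square root of everything other than c1 E is this y'.\<close>
      define y' where "y' = of_int c2 * of_nat m / X ^ k"
      have "rat_poly_of (pcompose f [:a, c:]) = pcompose (rat_poly_of f) [:of_int a, of_int c:]"
        by (simp add: of_int_hom.map_poly_pcompose of_int_hom.map_poly_pCons_hom)
      hence "pcompose (rat_poly_of f) [:of_int a, of_int c:] = smult (of_int c) (rat_poly_of g)"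
        unfolding fg by (simp add: of_int_hom.map_poly_hom_smult)
      from arg_cong[OF this, of "\<lambda>q. poly q t"]
      have "poly (rat_poly_of f) (of_int a + of_int c * t) = of_int c * poly (rat_poly_of g) t"
        by (simp add: poly_pcompose mult.commute)
      moreover have "X ^ (2 * k) * poly (rat_poly_of g) t = of_int ((int m)\<^sup>2 * E)"
        using hform_reflected[OF g0, of x e y] xy k dv dg by (simp add: v_def[symmetric] X_def t_def)
      hence "poly (rat_poly_of g) t = of_int ((int m)\<^sup>2 * E) / X ^ (2 * k)" using X by (simp add: field_simps)
      ultimately have "of_int (c1 * E) * y'\<^sup>2 = poly (rat_poly_of f) (of_int a + of_int c * t)"
        by (simp add: y'_def cc power_divide power_mult_distrib power_mult mult_ac)
      moreover have "y' \<noteq> 0" using c2 m X by (simp add: y'_def)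
      ultimately show "c1 * E \<in> S_rat f" using sf unfolding S_rat_def twist_points_def by blast
    qed
    ultimately show "infinite {d \<in> S_rat f. [d = r] (mod int p)}" using infinite_super by blast
  qed
qed

end
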